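(* Let $M>0$ and $q\in\mathbb{N}$ be fixed, set $\alpha=0.5$, and define $\xi=1/(1-3/(4q))$. Consider a sequence of problems indexed by $n$, with dimension $d=d(n)$ and minimum leaf size $k=k(n)$, in each of which we have $n$ i.i.d. training examples $(X_i,Y_i)\in[0,1]^d\times[-M,M]$, distributed as $(X,Y)$. Suppose that: (1) $X_i$ is uniformly distributed over $[0,1]^d$; (2) $\lim_{n\to\infty}\log(n)\max\{\log(d),\log\log(n)\}/k=0$, and $\liminf d/n>0$; (3) (sparse signal) there is a signal set $\mathcal{Q}\subseteq\{1,\dots,d\}$ with $|\mathcal{Q}|\le q$ such that the set of random variables $\{(X_i)_j:j\notin\mathcal{Q}\}$ is jointly independent of $Y_i$ and $\{(X_i)_j:j\in\mathcal{Q}\}$; (4) (monotone signal) there are a minimum effect size $\beta>0$ and signs $\sigma_j\in\{\pm1\}$ such that for all $j\in\mathcal{Q}$ and all $x\in[0,1]^d$, $$\sigma_j\Bigl(\mathbb{E}\bigl[Y_i\mid (X_i)_{-j}=x_{-j},(X_i)_j>\tfrac12\bigr]-\mathbb{E}\bigl[Y_i\mid (X_i)_{-j}=x_{-j},(X_i)_j\le\tfrac12\bigr]\Bigr)\ge\beta,$$ where $x_{-j}\in[0,1]^{d-1}$ is the vector of all but the $j$-th coordinate of $x$; (5) (continuity) the function $x\mapsto\mathbb{E}[Y\mid X=x]$ is Lipschitz-continuous. Then the excess error rate of the (median) guess-and-check tree $\hat y$ satisfies $$\mathbb{E}\Bigl[\bigl(\hat y(X)-\mathbb{E}[Y\mid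 X]\bigr)^2\Bigr]=O\left(n^{-\frac{\log(\xi)}{\log(2\xi)}}\right),\quad\text{given } k\asymp n^{\frac{\log(\xi)}{\log(2\xi)}}.$$
   Context: The constants $\beta$ and the Lipschitz constant do not depend on $n$. Here $X$ is a new test point independent of the training data. Guess-and-check tree with "$\alpha=0.5$" (median version). Input: $n$ training examples $(X_i,Y_i)$ and minimum leaf size $k$. The tree starts from the root node $[0,1]^d$ and recursively applies the following splitting procedure until no more splits are possible, i.e., until all terminal nodes contain less than $2k$ training examples or there were no possible splits satisfying ( * ) below to begin with. 1. Select a currently unsplit node $\nu$ containing at least $2k$ training examples. 2. Pick a candidate splitting variable $j\in\{1,\dots,d\}$ uniformly at random. 3. Set $\hat\theta$ to be the median of the $(X_i)_j$ with $X_i\in\nu$. Write $N^-(\theta)=|\{i:X_i\in\nu,(X_i)_j\le\theta\}|$, $N^+(\theta)=|\{i:X_i\in\nu,(X_i)_j>\theta\}|$, $\Delta(\theta)=\frac{1}{N^+(\theta)}\sum_{\{i:X_i\in\nu,(X_i)_j>\theta\}}Y_i-\frac{1}{N^-(\theta)}\sum_{\{i:X_i\in\nu,(X_i)_j\le\theta\}}Y_i$, and $\ell(\theta)=\frac{4N^-(\theta)N^+(\theta)}{(N^-(\theta)+N^+(\theta))^2}\Delta^2(\theta)$. 4. If either there has already been a successful split along variable $j$ for some other node (of the tree), or $$( * )\qquad \ell(\hat\theta)\ge\left(2\times 9M\sqrt{\frac{\log(n)\log(d)}{k\log((1-\alpha)^{-1})}}\right)^2\quad(\alpha=0.5),$$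 the split succeeds and $\nu$ is cut at $\hat\theta$ along the $j$-th variable (into $\nu\cap\{x_j\le\hat\theta\}$ and $\nu\cap\{x_j>\hat\theta\}$); if not, $\nu$ is not split this time. The tree prediction $\hat y(x)$ is the average of the $Y_i$ with $X_i$ in the leaf containing $x$. The notation $a_n\asymp b_n$ means that $a_n/b_n$ is bounded above and below by positive constants. *)

theory Defs
  imports "HOL-Probability.Probability" "HOL-Library.Landau_Symbols"
begin

text \<open>
  Coordinates are indexed by \<open>{..<d}\<close> and training examples by \<open>{..<n}\<close>, since both
  dimension and sample size vary inside the statement.
\<close>

type_synonym point = "nat \<Rightarrow> real"
type_synonym sample = "nat \<Rightarrow> point \<times> real"

definition cube :: "nat \<Rightarrow> point set" where
  "cube d = ({..<d} \<rightarrow>\<^sub>E {0..1})"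

definition point_space :: "nat set \<Rightarrow> point measure" where
  "point_space I = (\<Pi>\<^sub>M j\<in>I. borel)"

definition others :: "nat \<Rightarrow> nat \<Rightarrow> point \<Rightarrow> point" where
  "others d j x = restrict x ({..<d} - {j})"


subsection \<open>Regression trees\<close>

datatype reg_tree = Terminal | Split nat real reg_tree reg_tree

text \<open>A node is named by the path from the root: \<open>False\<close> is the side \<open>x j \<le> \<theta>\<close>.\<close>

type_synonym node = "bool list"

fun leaves :: "reg_tree \<Rightarrow> node set" where
  "leaves Terminal = {[]}"
| "leaves (Split j \<theta> l r) = (#) False ` leaves l \<union> (#) True ` leaves r"

fun leaf_of :: "reg_tree \<Rightarrow> point \<Rightarrow> node" where
  "leaf_of Terminal x = []"
| "leaf_of (Split j \<theta> l r) x =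
     (if x j \<le> \<theta> then False # leaf_of l x else True # leaf_of r x)"

fun split_vars :: "reg_tree \<Rightarrow> nat set" where
  "split_vars Terminal = {}"
| "split_vars (Split j \<theta> l r) = insert j (split_vars l \<union> split_vars r)"

text \<open>The third equation is junk: there the path does not lead to a leaf.\<close>

fun split_leaf :: "reg_tree \<Rightarrow> node \<Rightarrow> nat \<Rightarrow> real \<Rightarrow> reg_tree" where
  "split_leaf Terminal p j \<theta> = Split j \<theta> Terminal Terminal"
| "split_leaf (Split i c l r) (b # p) j \<theta> =
     (if b then Split i c l (split_leaf r p j \<theta>) else Split i c (split_leaf l p j \<theta>) r)"
| "split_leaf (Split i c l r) [] j \<theta> = Split i c l r"

definition region :: "nat \<Rightarrow> reg_tree \<Rightarrow> node \<Rightarrow> point set" where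
  "region d T p = {x \<in> cube d. leaf_of T x = p}"

definition members :: "nat \<Rightarrow> nat \<Rightarrow> sample \<Rightarrow> reg_tree \<Rightarrow> node \<Rightarrow> nat set" where
  "members n d S T p = {i \<in> {..<n}. fst (S i) \<in> region d T p}"

definition predict :: "nat \<Rightarrow> nat \<Rightarrow> sample \<Rightarrow> reg_tree \<Rightarrow> point \<Rightarrow> real" where
  "predict n d S T x =
     (let I = members n d S T (leaf_of T x) in (\<Sum>i\<in>I. snd (S i)) / real (card I))"


subsection \<open>The split criterion\<close>

text \<open>For an even number of values this is the midpoint of the two middle ones.\<close>

definition median :: "nat set \<Rightarrow> (nat \<Rightarrow> real) \<Rightarrow> real" where
  "median I v =
     (let xs = sort (map v (sorted_list_of_set I)); m = length xs
      in (xs ! ((m - 1) div 2) + xs ! (m div 2)) / 2)"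

definition below :: "sample \<Rightarrow> nat set \<Rightarrow> nat \<Rightarrow> real \<Rightarrow> nat set" where
  "below S I j \<theta> = {i \<in> I. fst (S i) j \<le> \<theta>}"

definition above :: "sample \<Rightarrow> nat set \<Rightarrow> nat \<Rightarrow> real \<Rightarrow> nat set" where
  "above S I j \<theta> = {i \<in> I. fst (S i) j > \<theta>}"

definition split_effect :: "sample \<Rightarrow> nat set \<Rightarrow> nat \<Rightarrow> real \<Rightarrow> real" where
  "split_effect S I j \<theta> =
     1 / real (card (above S I j \<theta>)) * (\<Sum>i\<in>above S I j \<theta>. snd (S i))
     - 1 / real (card (below S I j \<theta>)) * (\<Sum>i\<in>below S I j \<theta>. snd (S i))"

definition split_gain :: "sample \<Rightarrow> nat set \<Rightarrow> nat \<Rightarrow> real \<Rightarrow> real" where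
  "split_gain S I j \<theta> =
     (let Nm = real (card (below S I j \<theta>)); Np = real (card (above S I j \<theta>))
      in 4 * Nm * Np / (Nm + Np)^2 * (split_effect S I j \<theta>)^2)"

definition split_threshold :: "real \<Rightarrow> real \<Rightarrow> nat \<Rightarrow> nat \<Rightarrow> nat \<Rightarrow> real" where
  "split_threshold \<alpha> M n d k =
     (2 * (9 * M * sqrt (ln (real n) * ln (real d) / (real k * ln (1 / (1 - \<alpha>))))))^2"

definition split_point :: "sample \<Rightarrow> nat set \<Rightarrow> nat \<Rightarrow> real" where
  "split_point S I j = median I (\<lambda>i. fst (S i) j)"

definition passes_check ::
  "real \<Rightarrow> nat \<Rightarrow> nat \<Rightarrow> nat \<Rightarrow> sample \<Rightarrow> nat set \<Rightarrow> nat \<Rightarrow> bool" where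
  "passes_check M n d k S I j \<longleftrightarrow>
     split_gain S I j (split_point S I j) \<ge> split_threshold (1 / 2) M n d k"


subsection \<open>The guess-and-check procedure\<close>

definition stopped :: "real \<Rightarrow> nat \<Rightarrow> nat \<Rightarrow> nat \<Rightarrow> sample \<Rightarrow> reg_tree \<Rightarrow> bool" where
  "stopped M n d k S T \<longleftrightarrow>
     (\<forall>p\<in>leaves T. card (members n d S T p) < 2 * k) \<or>
     (T = Terminal \<and> (\<forall>j<d. \<not> passes_check M n d k S (members n d S Terminal []) j))"

definition try_split ::
  "real \<Rightarrow> nat \<Rightarrow> nat \<Rightarrow> nat \<Rightarrow> sample \<Rightarrow> reg_tree \<Rightarrow> node \<Rightarrow> nat \<Rightarrow> reg_tree" where
  "try_split M n d k S T p j =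
     (let I = members n d S T p
      in if j \<in> split_vars T \<or> passes_check M n d k S I j
         then split_leaf T p j (split_point S I j) else T)"

text \<open>
  The algorithm leaves open which eligible node is attempted next.  A selection rule \<open>sel\<close>
  makes this choice from the training data and the list of all candidate variables drawn so
  far, which together determine the current tree.  \<open>J t\<close> is the candidate variable
  drawn in round \<open>t\<close>.
\<close>

type_synonym selection_rule = "sample \<Rightarrow> nat list \<Rightarrow> node"

primrec tree_at ::
  "real \<Rightarrow> nat \<Rightarrow> nat \<Rightarrow> nat \<Rightarrow> selection_rule \<Rightarrow> sample \<Rightarrow> (nat \<Rightarrow> nat) \<Rightarrow> nat \<Rightarrow> reg_tree" where
  "tree_at M n d k sel S J 0 = Terminal"
| "tree_at M n d k sel S J (Suc t) =
     (let T = tree_at M n d k sel S J t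
      in if stopped M n d k S T then T
         else try_split M n d k S T (sel S (map J [0..<t])) (J t))"

text \<open>
  For \<open>k \<ge> 1\<close> the procedure stops almost surely; the value of \<open>LEAST\<close> on the remaining
  null set is irrelevant.
\<close>

definition final_tree ::
  "real \<Rightarrow> nat \<Rightarrow> nat \<Rightarrow> nat \<Rightarrow> selection_rule \<Rightarrow> sample \<Rightarrow> (nat \<Rightarrow> nat) \<Rightarrow> reg_tree" where
  "final_tree M n d k sel S J =
     tree_at M n d k sel S J (LEAST t. stopped M n d k S (tree_at M n d k sel S J t))"

definition training_law :: "nat \<Rightarrow> (point \<times> real) measure \<Rightarrow> sample measure" where
  "training_law n D = (\<Pi>\<^sub>M i\<in>{..<n}. D)"

definition candidate_law :: "nat \<Rightarrow> (nat \<Rightarrow> nat) measure" where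
  "candidate_law d = (\<Pi>\<^sub>M t\<in>UNIV. measure_pmf (pmf_of_set {..<d}))"

definition valid_selection_rule ::
  "real \<Rightarrow> nat \<Rightarrow> nat \<Rightarrow> nat \<Rightarrow> (point \<times> real) measure \<Rightarrow> selection_rule \<Rightarrow> bool" where
  "valid_selection_rule M n d k D sel \<longleftrightarrow>
     (\<forall>h. (\<lambda>S. sel S h) \<in> measurable (training_law n D) (count_space UNIV)) \<and>
     (\<forall>S\<in>space (training_law n D). \<forall>J\<in>UNIV \<rightarrow> {..<d}. \<forall>t.
        let T = tree_at M n d k sel S J t; p = sel S (map J [0..<t])
        in \<not> stopped M n d k S T \<longrightarrow> p \<in> leaves T \<and> card (members n d S T p) \<ge> 2 * k)"


subsection \<open>Independence, conditional means and the excess error\<close>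

text \<open>
  As \<open>indep_var\<close>, but for random variables with values in spaces of different types:
  independence of the generated sigma-algebras.
\<close>

definition independent_rvs ::
  "'a measure \<Rightarrow> ('a \<Rightarrow> 'b) \<Rightarrow> 'b measure \<Rightarrow> ('a \<Rightarrow> 'c) \<Rightarrow> 'c measure \<Rightarrow> bool" where
  "independent_rvs P Z N Z' N' \<longleftrightarrow>
     prob_space.indep_set P (sets (vimage_algebra (space P) Z N))
       (sets (vimage_algebra (space P) Z' N'))"

text \<open>
  \<open>g\<close> is a version of \<open>z \<mapsto> E[W | Z = z]\<close> under \<open>P\<close>, where \<open>Z\<close> takes values in \<open>N\<close>.
  Conditioning additionally on an event \<open>A\<close> of positive probability amounts to replacing
  \<open>P\<close> by \<open>uniform_measure P A\<close>, which is \<open>P\<close> conditioned on \<open>A\<close>.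
\<close>

definition cond_mean_version ::
  "'a measure \<Rightarrow> ('a \<Rightarrow> 'b) \<Rightarrow> 'b measure \<Rightarrow> ('a \<Rightarrow> real) \<Rightarrow> ('b \<Rightarrow> real) \<Rightarrow> bool" where
  "cond_mean_version P Z N W g \<longleftrightarrow>
     g \<in> borel_measurable N \<and>
     (AE w in P. real_cond_exp P (vimage_algebra (space P) Z N) W w = g (Z w))"

text \<open>
  Here \<open>f\<close> is the regression function.  The expectation is over the training
  sample, the random candidates and an independent test point.
\<close>

definition excess_error ::
  "real \<Rightarrow> nat \<Rightarrow> nat \<Rightarrow> nat \<Rightarrow> (point \<times> real) measure \<Rightarrow> selection_rule \<Rightarrow> (point \<Rightarrow> real) \<Rightarrow> real"
where
  "excess_error M n d k D sel f =
     (\<integral>(S, J, x). (predict n d S (final_tree M n d k sel S J) x - f x)^2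
        \<partial>(training_law n D \<Otimes>\<^sub>M candidate_law d \<Otimes>\<^sub>M distr D (point_space {..<d}) fst))"

end

theory Submission
  imports Defs "HOL-Real_Asymp.Real_Asymp"
begin

text \<open>
  Write \<open>\<gamma> = ln \<xi> / ln (2 * \<xi>)\<close> for the exponent of the rate. Outside an event of negligible
  probability the check refuses every split along a noise variable, and it accepts a signal variable
  \<open>j \<in> Q\<close> at every node that has not been cut along \<open>j\<close> before. The tree then consists of median splits
  along signal variables, every leaf keeps at least \<open>k\<close> examples, and unless \<open>Q\<close> is empty and the root is
  never split, there are at least \<open>log 2 (n / k)\<close> splits, rounded down, above any leaf.

  For such a sample the order in which nodes are attempted is irrelevant, although the selection rule may
  look at the responses. Fix the test point \<open>x\<close> and follow the list of variables split on the way to its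
  leaf. A rejected candidate changes nothing, and an accepted one is uniform on \<open>Q\<close> given the past, so the
  list is a random walk that appends uniform elements of \<open>Q\<close> until the cell of \<open>x\<close> is small. Hence any
  function of the list that does not increase on average under a uniform extension, and that dominates
  the error at stopped lists, bounds the expected error given the sample (\<open>expected_value_bound\<close>). Two
  functions are combined.

  \<^item> Variance: the average, over all uniform continuations of the list, of the squared mean residual in
  the leaf. A given list defines a cell that depends on the inputs alone, so the cross terms of the
  residuals integrate to zero; as leaves have at least \<open>k\<close> examples, this contributes \<open>O(1 / k)\<close> without
  any logarithm (\<open>noise_average_integral\<close>).

  \<^item> Bias: a Lipschitz regression function that ignores the noise variables deviates within a cell by at
  most a constant times the Euclidean length of the sides along \<open>Q\<close>. A median split nearly halves one
  uniformly chosen side, so the sum of the squared sides shrinks on average by a factor close to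
  \<open>1 - 3 / (4 * card Q) \<le> 1 / \<xi>\<close> per split (\<open>child_side\<close>, \<open>contraction_sum\<close>). After \<open>log 2 (n / k)\<close> splits this
  leaves a multiple of \<open>(k / n) powr (log 2 \<xi>)\<close>, which is of order \<open>n powr (- \<gamma>)\<close> exactly when \<open>k\<close> is of
  order \<open>n powr \<gamma>\<close> (\<open>power_depth_bound\<close>).

  The event is described by counts and response sums over boxes in the coordinates \<open>Q\<close> and at most one
  more. Rounding the boxes to a grid of mesh \<open>1 / n\<close> leaves polynomially many of them, and a Bernstein
  bound makes all counts and sums accurate relative to the size of the box (\<open>concentratedI\<close>). For boxes
  over \<open>insert j Q\<close> the relative accuracy \<open>\<delta>\<close> is a small multiple of \<open>sqrt (ln n * ln d / k)\<close>, the order of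
  the square root of the split threshold; the tail \<open>exp (- (\<delta>\<^sup>2 * k / 4))\<close> then contains the product of the two logarithms,
  which beats the union over \<open>d\<close> coordinates and polynomially many boxes as both \<open>n\<close> and \<open>d\<close> grow. This
  \<open>\<delta>\<close> may be too coarse for the sides of the cells, whose relative errors add up over about \<open>ln n\<close> levels.
  The sides only involve boxes over \<open>Q\<close>, for which the finer accuracy \<open>k powr (- 1 / 4)\<close> is available.
\<close>

section \<open>Order statistics and medians\<close>

lemma sorted_nth_le_iff:
  fixes xs :: "'a::linorder list"
  assumes "sorted xs" "l < length xs"
  shows "xs ! l \<le> c \<longleftrightarrow> l < length (filter (\<lambda>y. y \<le> c) xs)"
  using assms
proof (induction xs arbitrary: l)
  case (Cons y ys)
  show ?case
  proof (cases "y \<le> c")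
    case True
    then show ?thesis using Cons by (cases l) auto
  next
    case False
    then have e: "filter (\<lambda>y. y \<le> c) ys = []"
      using Cons.prems by (auto simp: filter_empty_conv)
    have "y \<le> (y # ys) ! l"
      using Cons.prems by (cases l) auto
    then show ?thesis using False e by auto
  qed
qed simp

definition order_stat :: "nat \<Rightarrow> nat set \<Rightarrow> (nat \<Rightarrow> real) \<Rightarrow> real" where
  "order_stat l I v = sort (map v (sorted_list_of_set I)) ! l"

text \<open>
  Comparing an order statistic with a constant is a statement about a count. Cardinalities of the two
  halves of a node and measurability of the split point both follow from this.
\<close>

lemma order_stat_le_iff:
  assumes "finite I" "l < card I"
  shows "order_stat l I v \<le> c \<longleftrightarrow> l < card {i\<in>I. v i \<le> c}"
proof -
  let ?xs = "map v (sorted_list_of_set I)"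
  have "length (filter (\<lambda>y. y \<le> c) (sort ?xs)) = size (filter_mset (\<lambda>y. y \<le> c) (mset ?xs))"
    by (metis mset_filter mset_sort size_mset)
  also have "\<dots> = length (filter (\<lambda>y. y \<le> c) ?xs)"
    by (metis mset_filter size_mset)
  also have "\<dots> = length (filter (\<lambda>i. v i \<le> c) (sorted_list_of_set I))"
    by (simp add: filter_map o_def)
  also have "\<dots> = card (set (filter (\<lambda>i. v i \<le> c) (sorted_list_of_set I)))"
    by (metis distinct_card distinct_filter distinct_sorted_list_of_set)
  also have "set (filter (\<lambda>i. v i \<le> c) (sorted_list_of_set I)) = {i\<in>I. v i \<le> c}"
    using assms by auto
  finally show ?thesis
    unfolding order_stat_def using assms by (subst sorted_nth_le_iff) auto
qed

lemma median_eq_order_stat: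
  "median I v = (order_stat ((card I - 1) div 2) I v + order_stat (card I div 2) I v) / 2"
  by (cases "finite I") (auto simp: median_def order_stat_def Let_def)

lemma order_stat_in_image:
  assumes "finite I" "l < card I"
  shows "order_stat l I v \<in> v ` I"
proof -
  have "order_stat l I v \<in> set (sort (map v (sorted_list_of_set I)))"
    unfolding order_stat_def using assms by (intro nth_mem) simp
  then show ?thesis using assms by simp
qed

lemma order_stat_mono:
  assumes "finite I" "l \<le> l'" "l' < card I"
  shows "order_stat l I v \<le> order_stat l' I v"
  unfolding order_stat_def using assms by (intro sorted_nth_mono) auto

lemma order_stat_strict_mono:
  assumes "finite I" "l < l'" "l' < card I" "inj_on v I"
  shows "order_stat l I v < order_stat l' I v"
proof -
  have "distinct (map v (sorted_list_of_set I))"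
    using assms by (simp add: distinct_map)
  then have "sorted_wrt (<) (sort (map v (sorted_list_of_set I)))"
    by (simp add: strict_sorted_iff)
  then show ?thesis
    unfolding order_stat_def using assms
    by (intro sorted_wrt_nth_less[where P = "(<)"]) auto
qed

lemma median_between:
  assumes "finite I" "I \<noteq> {}" "\<And>i. i \<in> I \<Longrightarrow> a < v i \<and> v i \<le> b"
  shows "a < median I v" "median I v \<le> b"
proof -
  have "card I > 0" using assms by (simp add: card_gt_0_iff)
  then have l: "(card I - 1) div 2 < card I" "card I div 2 < card I" by auto
  have "a < order_stat ((card I - 1) div 2) I v \<and> order_stat ((card I - 1) div 2) I v \<le> b"
    using order_stat_in_image[OF assms(1) l(1), of v] assms(3) by auto
  moreover have "a < order_stat (card I div 2) I v \<and> order_stat (card I div 2) I v \<le> b"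
    using order_stat_in_image[OF assms(1) l(2), of v] assms(3) by auto
  ultimately show "a < median I v" "median I v \<le> b"
    unfolding median_eq_order_stat by auto
qed

text \<open>
  With distinct values and an odd number of them the middle value falls on the lower side, whence the
  rounding.
\<close>

lemma card_le_median:
  assumes "finite I" "inj_on v I"
  shows "card {i\<in>I. v i \<le> median I v} = (card I + 1) div 2"
proof (cases "I = {}")
  case False
  define m where "m = card I"
  define l where "l = (m - 1) div 2"
  have m: "m > 0" using False assms by (simp add: m_def card_gt_0_iff)
  have l: "l < m" "m div 2 < m" "l \<le> m div 2" "m div 2 \<le> l + 1" "l + 1 = (m + 1) div 2"
    unfolding l_def using m by linarith+
  have med: "median I v = (order_stat l I v + order_stat (m div 2) I v) / 2"
    by (simp add: median_eq_order_stat m_def l_def)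
  have "order_stat l I v \<le> median I v"
    using order_stat_mono[of I l "m div 2" v] assms l m_def med by auto
  then have lo: "l < card {i\<in>I. v i \<le> median I v}"
    using order_stat_le_iff[of I l] assms l m_def by auto
  have hi: "card {i\<in>I. v i \<le> median I v} \<le> l + 1"
  proof (cases "l + 1 < m")
    case True
    have "order_stat l I v < order_stat (l + 1) I v"
      using order_stat_strict_mono[of I l "l + 1" v] assms True m_def by auto
    moreover have "order_stat (m div 2) I v \<le> order_stat (l + 1) I v"
      using order_stat_mono[of I "m div 2" "l + 1" v] assms True m_def l by auto
    ultimately have "median I v < order_stat (l + 1) I v" by (simp add: med)
    then show ?thesis
      using order_stat_le_iff[of I "l + 1" v "median I v"] assms True m_def by auto
  next
    case False
    have "card {i\<in>I. v i \<le> median I v} \<le> m"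
      unfolding m_def using assms by (intro card_mono) auto
    then show ?thesis using False by simp
  qed
  show ?thesis using lo hi l(5) m_def by simp
qed simp

lemma below_above_partition:
  "below S I j \<theta> \<union> above S I j \<theta> = I" "below S I j \<theta> \<inter> above S I j \<theta> = {}"
  "below S I j \<theta> \<subseteq> I" "above S I j \<theta> \<subseteq> I"
  by (auto simp: below_def above_def)

lemma card_below_plus_above:
  "finite I \<Longrightarrow> card (below S I j \<theta>) + card (above S I j \<theta>) = card I"
  by (metis below_above_partition card_Un_disjoint finite_Un)

lemma card_median_halves:
  assumes "finite I" "inj_on (\<lambda>i. fst (S i) j) I"
  shows "card (below S I j (split_point S I j)) = (card I + 1) div 2"
    and "card (above S I j (split_point S I j)) = card I div 2"
proof -
  show b: "card (below S I j (split_point S I j)) = (card I + 1) div 2"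
    unfolding below_def split_point_def using card_le_median[OF assms] by simp
  show "card (above S I j (split_point S I j)) = card I div 2"
    using card_below_plus_above[OF assms(1), of S j "split_point S I j"] b by linarith
qed

section \<open>Cells cut out by median splits\<close>

definition descend :: "sample \<Rightarrow> point \<Rightarrow> nat set \<Rightarrow> nat \<Rightarrow> nat set" where
  "descend S x I j =
     (if x j \<le> split_point S I j then below S I j (split_point S I j)
      else above S I j (split_point S I j))"

type_synonym cell = "nat set \<times> point \<times> point"

definition cut :: "sample \<Rightarrow> point \<Rightarrow> cell \<Rightarrow> nat \<Rightarrow> cell" where
  "cut S x = (\<lambda>(I, a, b) j.
     (descend S x I j,
      (if x j \<le> split_point S I j then a else a(j := split_point S I j)),
      (if x j \<le> split_point S I j then b(j := split_point S I j) else b)))"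

text \<open>
  Lists are arbitrary here: whether the procedure would make these splits is a separate question. The
  corners start at \<open>0\<close> and \<open>1\<close> in every coordinate.
\<close>

definition cell :: "nat \<Rightarrow> sample \<Rightarrow> point \<Rightarrow> nat list \<Rightarrow> cell" where
  "cell n S x = foldl (cut S x) ({..<n}, \<lambda>_. 0, \<lambda>_. 1)"

definition cell_members :: "nat \<Rightarrow> sample \<Rightarrow> point \<Rightarrow> nat list \<Rightarrow> nat set" where
  "cell_members n S x = foldl (descend S x) {..<n}"

definition cell_lower :: "nat \<Rightarrow> sample \<Rightarrow> point \<Rightarrow> nat list \<Rightarrow> point" where
  "cell_lower n S x js = fst (snd (cell n S x js))"

definition cell_upper :: "nat \<Rightarrow> sample \<Rightarrow> point \<Rightarrow> nat list \<Rightarrow> point" where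
  "cell_upper n S x js = snd (snd (cell n S x js))"

lemma fst_cell: "fst (cell n S x js) = cell_members n S x js"
  unfolding cell_def cell_members_def
  by (induction js rule: rev_induct) (auto simp: cut_def split: prod.splits)

lemma cell_members_simps [simp]:
  "cell_members n S x [] = {..<n}"
  "cell_members n S x (js @ [j]) = descend S x (cell_members n S x js) j"
  by (simp_all add: cell_members_def)

lemma cell_bounds_simps:
  "cell_lower n S x [] = (\<lambda>_. 0)" "cell_upper n S x [] = (\<lambda>_. 1)"
  "cell_lower n S x (js @ [j]) =
     (let \<theta> = split_point S (cell_members n S x js) j
      in if x j \<le> \<theta> then cell_lower n S x js else (cell_lower n S x js)(j := \<theta>))"
  "cell_upper n S x (js @ [j]) =
     (let \<theta> = split_point S (cell_members n S x js) j
      in if x j \<le> \<theta> then (cell_upper n S x js)(j := \<theta>) else cell_upper n S x js)"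
  unfolding cell_lower_def cell_upper_def fst_cell[symmetric]
  by (simp_all add: cell_def cut_def Let_def split: prod.splits)

lemma descend_subset: "descend S x I j \<subseteq> I"
  by (auto simp: descend_def below_def above_def)

lemma cell_members_subset: "cell_members n S x js \<subseteq> {..<n}"
proof (induction js rule: rev_induct)
  case (snoc j js)
  then show ?case using descend_subset[of S x "cell_members n S x js" j] by auto
qed simp

lemma finite_cell_members [simp]: "finite (cell_members n S x js)"
  by (rule finite_subset[OF cell_members_subset]) simp

lemma card_descend:
  assumes "finite I" "inj_on (\<lambda>i. fst (S i) j) I"
  shows "card I div 2 \<le> card (descend S x I j)" "card (descend S x I j) \<le> (card I + 1) div 2"
proof -
  have "card I div 2 \<le> (card I + 1) div 2" by (intro div_le_mono) simp
  then show "card I div 2 \<le> card (descend S x I j)" "card (descend S x I j) \<le> (card I + 1) div 2"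
    unfolding descend_def using card_median_halves[OF assms] by simp_all
qed

definition side :: "nat \<Rightarrow> sample \<Rightarrow> point \<Rightarrow> nat list \<Rightarrow> nat \<Rightarrow> real" where
  "side n S x js j = cell_upper n S x js j - cell_lower n S x js j"

definition in_box :: "nat set \<Rightarrow> point \<Rightarrow> point \<Rightarrow> point \<Rightarrow> bool" where
  "in_box R a b x \<longleftrightarrow> (\<forall>j\<in>R. a j < x j \<and> x j \<le> b j)"

definition pos_cube :: "nat \<Rightarrow> point set" where
  "pos_cube d = ({..<d} \<rightarrow>\<^sub>E {0<..1})"

lemma pos_cubeD: "x \<in> pos_cube d \<Longrightarrow> j < d \<Longrightarrow> 0 < x j \<and> x j \<le> 1"
  by (auto simp: pos_cube_def PiE_def Pi_def)

lemma pos_cube_subset: "pos_cube d \<subseteq> cube d"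
  unfolding pos_cube_def cube_def by (intro PiE_mono) auto

definition generic :: "nat \<Rightarrow> nat \<Rightarrow> sample \<Rightarrow> bool" where
  "generic n d S \<longleftrightarrow>
     (\<forall>i<n. fst (S i) \<in> pos_cube d) \<and> (\<forall>j<d. inj_on (\<lambda>i. fst (S i) j) {..<n})"

lemma generic_inj: "generic n d S \<Longrightarrow> j < d \<Longrightarrow> inj_on (\<lambda>i. fst (S i) j) (cell_members n S x js)"
  using cell_members_subset unfolding generic_def by (meson inj_on_subset)

text \<open>
  The median of a nonempty cell lies above its lower and not above its upper corner, so each cut just
  replaces one corner by the split point. The median of an empty cell is an unspecified number.
\<close>

lemma cell_box:
  assumes "generic n d S" "x \<in> pos_cube d" "Q \<subseteq> {..<d}" "js \<in> lists Q"
    and "cell_members n S x js \<noteq> {}"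
  shows "cell_members n S x js =
           {i. i < n \<and> in_box Q (cell_lower n S x js) (cell_upper n S x js) (fst (S i))} \<and>
         in_box {..<d} (cell_lower n S x js) (cell_upper n S x js) x \<and>
         (\<forall>j. 0 \<le> cell_lower n S x js j \<and> cell_upper n S x js j \<le> 1) \<and>
         (\<forall>j. j \<notin> set js \<longrightarrow> cell_lower n S x js j = 0 \<and> cell_upper n S x js j = 1)"
  using assms(4,5)
proof (induction js rule: rev_induct)
  case Nil
  show ?case
    using assms(1-3) pos_cubeD by (fastforce simp: in_box_def cell_bounds_simps generic_def)
next
  case (snoc j js)
  let ?I = "cell_members n S x js" and ?a = "cell_lower n S x js" and ?b = "cell_upper n S x js"
  define \<theta> where "\<theta> = split_point S ?I j"
  have I: "?I \<noteq> {}" using snoc.prems descend_subset[of S x ?I j] by auto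
  have j: "j \<in> Q" "j < d" and js: "js \<in> lists Q" using snoc.prems assms(3) by auto
  note IH = snoc.IH[OF js I]
  have "?a j < median ?I (\<lambda>i. fst (S i) j)" "median ?I (\<lambda>i. fst (S i) j) \<le> ?b j"
    using j IH by (intro median_between[OF finite_cell_members I]; auto simp: in_box_def)+
  then have th: "?a j < \<theta>" "\<theta> \<le> ?b j" by (auto simp: \<theta>_def split_point_def)
  have m: "cell_members n S x (js @ [j]) =
      (if x j \<le> \<theta> then {i\<in>?I. fst (S i) j \<le> \<theta>} else {i\<in>?I. fst (S i) j > \<theta>})"
    by (simp add: descend_def \<theta>_def below_def above_def)
  have "0 < \<theta>" "\<theta> \<le> 1" using th IH by (meson le_less_trans order_trans)+
  have A: "in_box Q a' b' y \<longleftrightarrow> in_box Q ?a ?b y \<and> (if x j \<le> \<theta> then y j \<le> \<theta> else \<theta> < y j)"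
    if "a' = (if x j \<le> \<theta> then ?a else ?a(j := \<theta>))" "b' = (if x j \<le> \<theta> then ?b(j := \<theta>) else ?b)"
    for a' b' y
  proof (cases "x j \<le> \<theta>")
    case True
    have "in_box Q a' b' y \<longleftrightarrow> (\<forall>i\<in>Q. ?a i < y i \<and> y i \<le> ?b i \<and> (i = j \<longrightarrow> y j \<le> \<theta>))"
      unfolding in_box_def that using True th by (intro ball_cong) auto
    then show ?thesis using True j by (auto simp: in_box_def)
  next
    case False
    have "in_box Q a' b' y \<longleftrightarrow> (\<forall>i\<in>Q. ?a i < y i \<and> y i \<le> ?b i \<and> (i = j \<longrightarrow> \<theta> < y j))"
      unfolding in_box_def that using False th by (intro ball_cong) auto
    then show ?thesis using False j by (auto simp: in_box_def)
  qed
  have c: "cell_lower n S x (js @ [j]) = (if x j \<le> \<theta> then ?a else ?a(j := \<theta>))"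
    "cell_upper n S x (js @ [j]) = (if x j \<le> \<theta> then ?b(j := \<theta>) else ?b)"
    by (simp_all add: cell_bounds_simps \<theta>_def Let_def)
  show ?case
  proof (intro conjI)
    show "cell_members n S x (js @ [j]) = {i. i < n \<and>
        in_box Q (cell_lower n S x (js @ [j])) (cell_upper n S x (js @ [j])) (fst (S i))}"
      unfolding A[OF c] m using IH by auto
    show "in_box {..<d} (cell_lower n S x (js @ [j])) (cell_upper n S x (js @ [j])) x"
      unfolding c using IH by (auto simp: in_box_def)
    show "\<forall>i. 0 \<le> cell_lower n S x (js @ [j]) i \<and> cell_upper n S x (js @ [j]) i \<le> 1"
      unfolding c using IH \<open>0 < \<theta>\<close> \<open>\<theta> \<le> 1\<close> by auto
    show "\<forall>i. i \<notin> set (js @ [j]) \<longrightarrow>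
        cell_lower n S x (js @ [j]) i = 0 \<and> cell_upper n S x (js @ [j]) i = 1"
      unfolding c using IH by auto
  qed
qed

text \<open>
  Each split keeps at least half of the examples, rounded down; adding one absorbs the rounding.
\<close>

lemma card_cell_lower:
  assumes "generic n d S" "js \<in> lists {..<d}"
  shows "n + 1 \<le> (card (cell_members n S x js) + 1) * 2 ^ length js"
  using assms(2)
proof (induction js rule: rev_induct)
  case (snoc j js)
  let ?I = "cell_members n S x js"
  have "card ?I div 2 \<le> card (descend S x ?I j)"
    using snoc.prems assms generic_inj by (intro card_descend) auto
  then have "card ?I + 1 \<le> (card (descend S x ?I j) + 1) * 2" by presburger
  then have "(card ?I + 1) * 2 ^ length js \<le> (card (descend S x ?I j) + 1) * 2 * 2 ^ length js"
    by (intro mult_right_mono) auto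
  then show ?case using snoc by auto
qed simp

text \<open>
  As long as two examples remain every split loses one, so paths to nodes that are still to be split are
  shorter than \<open>n\<close>.
\<close>

lemma card_cell_plus_length:
  assumes "generic n d S" "js \<in> lists {..<d}" "card (cell_members n S x js) \<ge> 2"
  shows "card (cell_members n S x js) + length js \<le> n"
  using assms(2,3)
proof (induction js rule: rev_induct)
  case (snoc j js)
  let ?I = "cell_members n S x js"
  have inj: "inj_on (\<lambda>i. fst (S i) j) ?I"
    using snoc.prems assms generic_inj by auto
  have ge: "card (descend S x ?I j) \<ge> 2" using snoc.prems by simp
  moreover have "card (descend S x ?I j) \<le> (card ?I + 1) div 2"
    using card_descend(2)[OF _ inj, of x] by auto
  ultimately have "card (descend S x ?I j) < card ?I" "card ?I \<ge> 2" by linarith+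
  then show ?case using snoc by auto
qed simp

section \<open>Trees grown by median splits\<close>

fun path_vars :: "reg_tree \<Rightarrow> point \<Rightarrow> nat list" where
  "path_vars Terminal x = []"
| "path_vars (Split j \<theta> l r) x = j # (if x j \<le> \<theta> then path_vars l x else path_vars r x)"

text \<open>
  The trees that the procedure can reach on a well-behaved sample. Nonempty leaves bound the number of
  splits.
\<close>

fun grown :: "sample \<Rightarrow> nat set \<Rightarrow> nat set \<Rightarrow> reg_tree \<Rightarrow> bool" where
  "grown S Q I Terminal \<longleftrightarrow> I \<noteq> {}"
| "grown S Q I (Split j \<theta> l r) \<longleftrightarrow> j \<in> Q \<and> \<theta> = split_point S I j \<and>
     grown S Q (below S I j \<theta>) l \<and> grown S Q (above S I j \<theta>) r"

fun splits :: "reg_tree \<Rightarrow> nat" where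
  "splits Terminal = 0"
| "splits (Split j \<theta> l r) = Suc (splits l + splits r)"

lemma leaf_of_in_leaves: "leaf_of T x \<in> leaves T"
  by (induction T) auto

lemma members_grown:
  "grown S Q I T \<Longrightarrow>
     foldl (descend S x) I (path_vars T x) = {i\<in>I. leaf_of T (fst (S i)) = leaf_of T x}"
proof (induction T arbitrary: I)
  case (Split j \<theta> l r)
  show ?case
  proof (cases "x j \<le> \<theta>")
    case True
    then show ?thesis
      using Split by (auto simp: descend_def below_def split: if_splits)
  next
    case False
    then show ?thesis
      using Split by (auto simp: descend_def above_def split: if_splits)
  qed
qed auto

text \<open>
  The leaves are disjoint and nonempty; this limits how often the procedure can succeed.
\<close>

lemma splits_less_card: "finite I \<Longrightarrow> grown S Q I T \<Longrightarrow> splits T < card I"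
proof (induction T arbitrary: I)
  case Terminal
  then show ?case by (simp add: card_gt_0_iff)
next
  case (Split j \<theta> l r)
  have "finite (below S I j \<theta>)" "finite (above S I j \<theta>)"
    using Split.prems by (auto simp: below_def above_def)
  then have "splits l < card (below S I j \<theta>)" "splits r < card (above S I j \<theta>)"
    using Split by auto
  then show ?case
    using card_below_plus_above[OF Split.prems(1), of S j \<theta>] by simp
qed

lemma grown_split_leaf:
  "grown S Q I T \<Longrightarrow> p \<in> leaves T \<Longrightarrow> j \<in> Q \<Longrightarrow>
   I' = {i\<in>I. leaf_of T (fst (S i)) = p} \<Longrightarrow> \<theta> = split_point S I' j \<Longrightarrow>
   below S I' j \<theta> \<noteq> {} \<Longrightarrow> above S I' j \<theta> \<noteq> {} \<Longrightarrow> grown S Q I (split_leaf T p j \<theta>)"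
proof (induction T p j \<theta> arbitrary: I rule: split_leaf.induct)
  case (1 p j \<theta>)
  then show ?case by auto
next
  case (2 i c l r b p j \<theta>)
  show ?case
  proof (cases b)
    case True
    then have "I' = {k\<in>above S I i c. leaf_of r (fst (S k)) = p}"
      using "2.prems" by (auto simp: above_def)
    then show ?thesis using 2 True by auto
  next
    case False
    then have "I' = {k\<in>below S I i c. leaf_of l (fst (S k)) = p}"
      using "2.prems" by (auto simp: below_def)
    then show ?thesis using 2 False by auto
  qed
next
  case 3
  then show ?case by auto
qed

lemma splits_split_leaf: "p \<in> leaves T \<Longrightarrow> splits (split_leaf T p j \<theta>) = Suc (splits T)"
  by (induction T p j \<theta> rule: split_leaf.induct) auto

lemma path_vars_split_leaf:
  "p \<in> leaves T \<Longrightarrow>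
   path_vars (split_leaf T p j \<theta>) x = path_vars T x @ (if leaf_of T x = p then [j] else [])"
  by (induction T p j \<theta> rule: split_leaf.induct) (auto split: if_splits)

lemma grown_split_vars: "grown S Q I T \<Longrightarrow> split_vars T \<subseteq> Q"
  by (induction T arbitrary: I) auto

lemma path_vars_subset: "set (path_vars T x) \<subseteq> split_vars T"
  by (induction T) auto

section \<open>Histories of candidate variables\<close>

lemma measurable_history:
  assumes "\<And>i. sets (N i) = UNIV" "{..<t} \<subseteq> A"
  shows "(\<lambda>J. map J [0..<t]) \<in> measurable (PiM A N) (count_space (UNIV :: nat list set))"
  unfolding measurable_count_space_eq_countable[OF countableI_type]
proof (intro conjI ballI)
  show "(\<lambda>J. map J [0..<t]) \<in> space (PiM A N) \<rightarrow> UNIV" by simp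
next
  fix l :: "nat list"
  have "(\<lambda>J. map J [0..<t]) -` {l} \<inter> space (PiM A N) =
          {J \<in> space (PiM A N). length l = t \<and> (\<forall>i\<in>{..<t}. J i \<in> {l ! i})}"
  proof -
    have "map J [0..<t] = l \<longleftrightarrow> length l = t \<and> (\<forall>i\<in>{..<t}. J i \<in> {l ! i})" for J
      unfolding list_eq_iff_nth_eq by fastforce
    then show ?thesis by blast
  qed
  also have "\<dots> \<in> sets (PiM A N)"
  proof -
    have "{J \<in> space (PiM A N). J i \<in> {l ! i}} \<in> sets (PiM A N)" if "i \<in> {..<t}" for i
    proof -
      have "(\<lambda>J. J i) \<in> measurable (PiM A N) (N i)"
        using that assms(2) by (intro measurable_component_singleton) auto
      then have "(\<lambda>J. J i) -` {l ! i} \<inter> space (PiM A N) \<in> sets (PiM A N)"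
        using assms(1) by (intro measurable_sets) auto
      also have "(\<lambda>J. J i) -` {l ! i} \<inter> space (PiM A N) = {J \<in> space (PiM A N). J i \<in> {l ! i}}"
        by auto
      finally show ?thesis .
    qed
    then have "{J \<in> space (PiM A N). \<forall>i\<in>{..<t}. J i \<in> {l ! i}} \<in> sets (PiM A N)"
      by (intro sets.sets_Collect_finite_All) auto
    then show ?thesis by (cases "length l = t") auto
  qed
  finally show "(\<lambda>J. map J [0..<t]) -` {l} \<inter> space (PiM A N) \<in> sets (PiM A N)" .
qed

text \<open>
  The next candidate is uniform and independent of all earlier ones.
\<close>

lemma nn_integral_candidate_Suc:
  fixes g :: "nat list \<Rightarrow> ennreal"
  assumes "d > 0"
  shows "(\<integral>\<^sup>+J. g (map J [0..<Suc t]) \<partial>candidate_law d) =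
         (\<integral>\<^sup>+J. (\<Sum>j<d. g (map J [0..<t] @ [j])) / of_nat d \<partial>candidate_law d)"
proof -
  define U where "U = measure_pmf (pmf_of_set {..<d})"
  interpret product_prob_space "\<lambda>_::nat. U" UNIV
    by (intro product_prob_spaceI) (simp add: U_def prob_space_measure_pmf)
  have sU: "sets U = UNIV" by (simp add: U_def)
  have fin: "(\<integral>\<^sup>+J. h (map J [0..<t]) \<partial>candidate_law d) =
      (\<integral>\<^sup>+J. h (map J [0..<t]) \<partial>PiM {..<t} (\<lambda>_. U))" for h :: "nat list \<Rightarrow> ennreal" and t
  proof -
    have m: "(\<lambda>J. map J [0..<t]) \<in> measurable (PiM A (\<lambda>_. U)) (count_space UNIV)"
      if "{..<t} \<subseteq> A" for A
      using measurable_history[of "\<lambda>_. U" t A] sU that by simp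
    have "(\<integral>\<^sup>+J. h (map J [0..<t]) \<partial>PiM {..<t} (\<lambda>_. U)) =
        (\<integral>\<^sup>+J. h (map J [0..<t])
           \<partial>distr (PiM UNIV (\<lambda>_. U)) (PiM {..<t} (\<lambda>_. U)) (\<lambda>x. restrict x {..<t}))"
      by (subst distr_PiM_restrict_finite) auto
    also have "\<dots> = (\<integral>\<^sup>+J. h (map (restrict J {..<t}) [0..<t]) \<partial>PiM UNIV (\<lambda>_. U))"
    proof (rule nn_integral_distr)
      show "(\<lambda>x. restrict x {..<t}) \<in> measurable (PiM UNIV (\<lambda>_. U)) (PiM {..<t} (\<lambda>_. U))"
        by (rule measurable_restrict_subset) simp
      have "(\<lambda>J. h (map J [0..<t])) \<in> borel_measurable (PiM {..<t} (\<lambda>_. U))"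
        by (rule measurable_compose[OF m[OF order_refl]]) simp
      then show "(\<lambda>J. h (map J [0..<t])) \<in> borel_measurable
            (distr (PiM UNIV (\<lambda>_. U)) (PiM {..<t} (\<lambda>_. U)) (\<lambda>x. restrict x {..<t}))" by simp
    qed
    also have "\<dots> = (\<integral>\<^sup>+J. h (map J [0..<t]) \<partial>candidate_law d)"
      unfolding candidate_law_def U_def
      by (intro nn_integral_cong arg_cong[where f = h] map_cong) auto
    finally show ?thesis by simp
  qed
  have m: "(\<lambda>J. map J [0..<Suc t]) \<in> measurable (PiM (insert t {..<t}) (\<lambda>_. U)) (count_space UNIV)"
    using measurable_history[of "\<lambda>_. U" "Suc t" "insert t {..<t}"] sU
    by (auto simp: lessThan_Suc)
  have "(\<integral>\<^sup>+J. g (map J [0..<Suc t]) \<partial>candidate_law d) =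
      (\<integral>\<^sup>+J. g (map J [0..<Suc t]) \<partial>PiM (insert t {..<t}) (\<lambda>_. U))"
    by (subst fin) (simp add: lessThan_Suc)
  also have "\<dots> = (\<integral>\<^sup>+J. (\<integral>\<^sup>+j. g (map (J(t := j)) [0..<Suc t]) \<partial>U) \<partial>PiM {..<t} (\<lambda>_. U))"
    by (intro product_nn_integral_insert measurable_compose[OF m]) auto
  also have "\<dots> = (\<integral>\<^sup>+J. (\<integral>\<^sup>+j. g (map J [0..<t] @ [j]) \<partial>U) \<partial>PiM {..<t} (\<lambda>_. U))"
  proof (intro nn_integral_cong)
    fix J :: "nat \<Rightarrow> nat" and j
    have "map (J(t := j)) [0..<Suc t] = map J [0..<t] @ [j]" by simp
    then show "g (map (J(t := j)) [0..<Suc t]) = g (map J [0..<t] @ [j])" by simp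
  qed
  also have "\<dots> = (\<integral>\<^sup>+J. (\<Sum>j<d. g (map J [0..<t] @ [j])) / of_nat d \<partial>PiM {..<t} (\<lambda>_. U))"
    unfolding U_def using assms by (subst nn_integral_pmf_of_set) (auto simp: lessThan_empty_iff)
  also have "\<dots> = (\<integral>\<^sup>+J. (\<Sum>j<d. g (map J [0..<t] @ [j])) / of_nat d \<partial>candidate_law d)"
    by (rule fin[symmetric])
  finally show ?thesis .
qed

lemma AE_candidate_range:
  assumes "d > 0"
  shows "AE J in candidate_law d. \<forall>i. J i < d"
proof -
  interpret product_prob_space "\<lambda>_::nat. measure_pmf (pmf_of_set {..<d})" UNIV
    by (intro product_prob_spaceI) (simp add: prob_space_measure_pmf)
  have "AE J in candidate_law d. J i < d" for i
    unfolding candidate_law_def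
  proof (rule AE_component)
    show "AE j in measure_pmf (pmf_of_set {..<d}). j < d"
      using assms by (subst AE_measure_pmf_iff) (auto simp: set_pmf_of_set lessThan_empty_iff)
  qed auto
  then show ?thesis by (simp add: AE_all_countable)
qed

text \<open>
  The optional stopping principle in the form used below: functions of the history that do not increase
  on average stay below their initial value in expectation.
\<close>

lemma supermartingale_candidate:
  fixes W :: "nat list \<Rightarrow> ennreal"
  assumes d: "d > 0"
    and step: "\<And>l. l \<in> lists {..<d} \<Longrightarrow> (\<Sum>j<d. W (l @ [j])) \<le> of_nat d * W l"
  shows "(\<integral>\<^sup>+J. W (map J [0..<t]) \<partial>candidate_law d) \<le> W []"
proof (induction t)
  case 0
  interpret P: prob_space "candidate_law d"
    unfolding candidate_law_def by (intro prob_space_PiM prob_space_measure_pmf)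
  show ?case by (simp add: P.emeasure_space_1)
next
  case (Suc t)
  have "(\<integral>\<^sup>+J. W (map J [0..<Suc t]) \<partial>candidate_law d) =
        (\<integral>\<^sup>+J. (\<Sum>j<d. W (map J [0..<t] @ [j])) / of_nat d \<partial>candidate_law d)"
    by (rule nn_integral_candidate_Suc[OF d])
  also have "\<dots> \<le> (\<integral>\<^sup>+J. W (map J [0..<t]) \<partial>candidate_law d)"
  proof (rule nn_integral_mono_AE, use AE_candidate_range[OF d] in eventually_elim)
    fix J :: "nat \<Rightarrow> nat" assume "\<forall>i. J i < d"
    then have "(\<Sum>j<d. W (map J [0..<t] @ [j])) \<le> of_nat d * W (map J [0..<t])"
      by (intro step) auto
    then have "(\<Sum>j<d. W (map J [0..<t] @ [j])) / of_nat d \<le> of_nat d * W (map J [0..<t]) / of_nat d"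
      by (rule divide_right_mono_ennreal)
    also have "\<dots> = W (map J [0..<t])"
      using d by (subst mult.commute, subst ennreal_mult_divide_eq) auto
    finally show "(\<Sum>j<d. W (map J [0..<t] @ [j])) / of_nat d \<le> W (map J [0..<t])" .
  qed
  also have "\<dots> \<le> W []" by (rule Suc.IH)
  finally show ?case .
qed

section \<open>The growing tree as a random walk on lists of variables\<close>

lemma borel_measurable_history:
  fixes h :: "nat list \<Rightarrow> ennreal"
  shows "(\<lambda>J. h (map J [0..<t])) \<in> borel_measurable (candidate_law d)"
proof -
  have "(\<lambda>J. map J [0..<t]) \<in> measurable (candidate_law d) (count_space UNIV)"
    unfolding candidate_law_def by (rule measurable_history) auto
  from measurable_compose[OF this, of h borel] show ?thesis by simp
qed

text \<open>
  The deterministic properties of a training sample on which the procedure splits exactly along the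
  signal. Nodes are represented as cells of points of the cube, because every node that can be split
  contains an example and is the cell of that example.
\<close>

locale good_sample =
  fixes M :: real and n d k :: nat and S :: sample and Q :: "nat set" and sel :: selection_rule
  assumes n_pos: "n \<ge> 1" and k_pos: "k \<ge> 1" and d_pos: "d \<ge> 1" and Q: "Q \<subseteq> {..<d}"
    and generic: "generic n d S"
    and noise_fails: "\<And>x js j. x \<in> pos_cube d \<Longrightarrow> js \<in> lists Q \<Longrightarrow>
          2 * k \<le> card (cell_members n S x js) \<Longrightarrow> j < d \<Longrightarrow> j \<notin> Q \<Longrightarrow>
          \<not> passes_check M n d k S (cell_members n S x js) j"
    and signal_passes: "\<And>x js j. x \<in> pos_cube d \<Longrightarrow> js \<in> lists Q \<Longrightarrow>
          2 * k \<le> card (cell_members n S x js) \<Longrightarrow> j \<in> Q \<Longrightarrow> j \<notin> set js \<Longrightarrow>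
          passes_check M n d k S (cell_members n S x js) j"
    and selection: "\<And>J t. J \<in> UNIV \<rightarrow> {..<d} \<Longrightarrow> \<not> stopped M n d k S (tree_at M n d k sel S J t) \<Longrightarrow>
          sel S (map J [0..<t]) \<in> leaves (tree_at M n d k sel S J t) \<and>
          2 * k \<le> card (members n d S (tree_at M n d k sel S J t) (sel S (map J [0..<t])))"
begin

abbreviation tree_of :: "nat list \<Rightarrow> reg_tree" where
  "tree_of l \<equiv> tree_at M n d k sel S (\<lambda>t. if t < length l then l ! t else 0) (length l)"

lemma tree_at_cong:
  "(\<And>i. i < t \<Longrightarrow> J i = J' i) \<Longrightarrow> tree_at M n d k sel S J t = tree_at M n d k sel S J' t"
proof (induction t)
  case (Suc t)
  have "map J [0..<t] = map J' [0..<t]" using Suc.prems by simp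
  moreover have "tree_at M n d k sel S J t = tree_at M n d k sel S J' t" "J t = J' t"
    using Suc by auto
  ultimately show ?case by (simp only: tree_at.simps)
qed simp

lemma tree_of_map: "tree_of (map J [0..<t]) = tree_at M n d k sel S J t"
proof -
  have "tree_of (map J [0..<t]) =
      tree_at M n d k sel S (\<lambda>u. if u < t then map J [0..<t] ! u else 0) t" by simp
  also have "\<dots> = tree_at M n d k sel S J t" by (rule tree_at_cong) simp
  finally show ?thesis .
qed

lemma tree_of_Nil: "tree_of [] = Terminal" by simp

lemma tree_of_snoc:
  "tree_of (l @ [j]) =
     (if stopped M n d k S (tree_of l) then tree_of l
      else try_split M n d k S (tree_of l) (sel S l) j)"
proof -
  let ?J = "\<lambda>t. if t < length (l @ [j]) then (l @ [j]) ! t else 0"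
  have "tree_at M n d k sel S ?J (length l) = tree_of l"
    by (rule tree_at_cong) (simp add: nth_append)
  moreover have "map ?J [0..<length l] = l"
    by (rule nth_equalityI) (auto simp: nth_append)
  moreover have "?J (length l) = j" by simp
  ultimately show ?thesis by (simp only: length_append_singleton tree_at.simps Let_def)
qed

lemma selection_of:
  assumes "l \<in> lists {..<d}" "\<not> stopped M n d k S (tree_of l)"
  shows "sel S l \<in> leaves (tree_of l)" "2 * k \<le> card (members n d S (tree_of l) (sel S l))"
proof -
  let ?J = "\<lambda>t. if t < length l then l ! t else 0"
  have J: "?J \<in> UNIV \<rightarrow> {..<d}"
    using assms(1) d_pos by (auto simp: in_lists_conv_set)
  have "map ?J [0..<length l] = l" by (rule nth_equalityI) auto
  then show "sel S l \<in> leaves (tree_of l)" "2 * k \<le> card (members n d S (tree_of l) (sel S l))"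
    using selection[OF J, of "length l"] assms(2) by auto
qed

lemma sample_in_cube: "i < n \<Longrightarrow> fst (S i) \<in> pos_cube d" "i < n \<Longrightarrow> fst (S i) \<in> cube d"
  using generic pos_cube_subset by (auto simp: generic_def)

lemma members_eq: "members n d S T p = {i\<in>{..<n}. leaf_of T (fst (S i)) = p}"
  using sample_in_cube by (auto simp: members_def region_def)

lemma members_leaf_of:
  "grown S Q {..<n} T \<Longrightarrow> members n d S T (leaf_of T x) = cell_members n S x (path_vars T x)"
  using members_grown[of S Q "{..<n}" T x] by (simp add: members_eq cell_members_def)

lemma path_vars_in_lists: "grown S Q {..<n} T \<Longrightarrow> path_vars T x \<in> lists Q"
  using grown_split_vars path_vars_subset by (fastforce simp: in_lists_conv_set)

text \<open>
  An example in the node serves as the point. Assumptions on cells thus apply to the node chosen by the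
  selection rule.
\<close>

lemma leaf_is_cell:
  assumes "grown S Q {..<n} T" "2 * k \<le> card (members n d S T p)"
  obtains y where "y \<in> pos_cube d" "leaf_of T y = p"
    "members n d S T p = cell_members n S y (path_vars T y)" "path_vars T y \<in> lists Q"
proof -
  have "members n d S T p \<noteq> {}" using assms(2) k_pos by auto
  then obtain i where i: "i < n" "leaf_of T (fst (S i)) = p" by (auto simp: members_eq)
  show ?thesis
    using that[of "fst (S i)"] i sample_in_cube members_leaf_of[OF assms(1), of "fst (S i)"]
      path_vars_in_lists[OF assms(1)] by auto
qed

lemma try_split_noise:
  assumes T: "grown S Q {..<n} T" and "2 * k \<le> card (members n d S T p)" "j < d" "j \<notin> Q"
  shows "try_split M n d k S T p j = T"
proof -
  obtain y where y: "y \<in> pos_cube d" "leaf_of T y = p"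
    "members n d S T p = cell_members n S y (path_vars T y)" "path_vars T y \<in> lists Q"
    using leaf_is_cell[OF assms(1,2)] .
  have "\<not> passes_check M n d k S (members n d S T p) j"
    using noise_fails[OF y(1,4) _ assms(3,4)] assms(2) y(3) by simp
  moreover have "j \<notin> split_vars T" using grown_split_vars[OF T] assms by auto
  ultimately show ?thesis by (simp add: try_split_def Let_def)
qed

lemma try_split_signal:
  assumes T: "grown S Q {..<n} T" and c: "2 * k \<le> card (members n d S T p)" and j: "j \<in> Q"
    and p: "p \<in> leaves T"
  shows "try_split M n d k S T p j = split_leaf T p j (split_point S (members n d S T p) j)"
    and "grown S Q {..<n} (try_split M n d k S T p j)"
proof -
  obtain y where y: "y \<in> pos_cube d" "leaf_of T y = p"
    "members n d S T p = cell_members n S y (path_vars T y)" "path_vars T y \<in> lists Q"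
    using leaf_is_cell[OF assms(1,2)] .
  have "j \<in> split_vars T \<or> passes_check M n d k S (members n d S T p) j"
    using signal_passes[OF y(1,4) _ j] c y(3) path_vars_subset[of T y] by auto
  then show *: "try_split M n d k S T p j = split_leaf T p j (split_point S (members n d S T p) j)"
    by (auto simp: try_split_def Let_def)
  let ?I = "members n d S T p"
  have fin: "finite ?I" by (simp add: members_eq)
  have inj: "inj_on (\<lambda>i. fst (S i) j) ?I"
    using generic_inj[OF generic, of j y "path_vars T y"] y(3) j Q by auto
  have "card ?I \<ge> 2" using c k_pos by linarith
  then have "card (below S ?I j (split_point S ?I j)) > 0" "card (above S ?I j (split_point S ?I j)) > 0"
    unfolding card_median_halves[OF fin inj] by (auto simp: div_greater_zero_iff)
  then show "grown S Q {..<n} (try_split M n d k S T p j)"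
    unfolding * by (intro grown_split_leaf[OF T p j _ refl]) (auto simp: members_eq card_gt_0_iff)
qed

lemma grown_tree_of: "l \<in> lists {..<d} \<Longrightarrow> grown S Q {..<n} (tree_of l)"
proof (induction l rule: rev_induct)
  case Nil
  then show ?case using n_pos by (simp add: lessThan_empty_iff)
next
  case (snoc j l)
  then have l: "l \<in> lists {..<d}" "j < d" and g: "grown S Q {..<n} (tree_of l)" by auto
  show ?case
  proof (cases "stopped M n d k S (tree_of l)")
    case True
    then show ?thesis using g by (simp only: tree_of_snoc if_True)
  next
    case False
    note s = selection_of[OF l(1) False]
    show ?thesis
    proof (cases "j \<in> Q")
      case True
      show ?thesis
        using try_split_signal(2)[OF g s(2) True s(1)] False by (simp only: tree_of_snoc if_False)
    next
      case noise: False
      show ?thesis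
        using try_split_noise[OF g s(2) l(2) noise] g False by (simp only: tree_of_snoc if_False)
    qed
  qed
qed

text \<open>
  Without signal variables the root is the only node, and no variable passes the check there.
\<close>

lemma not_stopped_signal:
  assumes "grown S Q {..<n} T" "\<not> stopped M n d k S T"
  shows "Q \<noteq> {}"
proof
  assume "Q = {}"
  then have T: "T = Terminal" using assms(1) by (cases T) auto
  define y where "y = fst (S 0)"
  have y: "y \<in> pos_cube d" using sample_in_cube n_pos by (auto simp: y_def)
  have m: "members n d S T [] = cell_members n S y []" by (auto simp: members_eq T)
  have "\<exists>p\<in>leaves T. 2 * k \<le> card (members n d S T p)"
    using assms(2) by (force simp: stopped_def)
  then have "2 * k \<le> card (cell_members n S y [])" using m T by simp
  then have "\<forall>j<d. \<not> passes_check M n d k S (members n d S T []) j"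
    using noise_fails[OF y, of "[]"] \<open>Q = {}\<close> unfolding m by auto
  then show False using assms(2) T by (auto simp: stopped_def)
qed

lemma stopped_cell:
  assumes "grown S Q {..<n} T" "stopped M n d k S T"
  shows "card (cell_members n S x (path_vars T x)) < 2 * k \<or> Q = {} \<and> path_vars T x = []"
proof (rule ccontr)
  assume *: "\<not> ?thesis"
  then have c: "2 * k \<le> card (members n d S T (leaf_of T x))"
    by (simp add: members_leaf_of[OF assms(1)])
  then have T: "T = Terminal" "\<forall>j<d. \<not> passes_check M n d k S (members n d S Terminal []) j"
    using assms(2) leaf_of_in_leaves[of T x] unfolding stopped_def by (auto simp: not_less[symmetric])
  with * obtain j where j: "j \<in> Q" by auto
  define y where "y = fst (S 0)"
  have y: "y \<in> pos_cube d" using sample_in_cube n_pos by (auto simp: y_def)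
  have m: "members n d S Terminal [] = cell_members n S y []" by (auto simp: members_eq)
  have "passes_check M n d k S (members n d S Terminal []) j"
    unfolding m using c T j by (intro signal_passes[OF y]) (auto simp: members_eq)
  then show False using T(2) j Q by auto
qed

lemma history_step:
  assumes l: "l \<in> lists {..<d}" and ns: "\<not> stopped M n d k S (tree_of l)"
  shows "j < d \<Longrightarrow> j \<notin> Q \<Longrightarrow> tree_of (l @ [j]) = tree_of l"
    and "j \<in> Q \<Longrightarrow> splits (tree_of (l @ [j])) = Suc (splits (tree_of l))"
    and "j \<in> Q \<Longrightarrow> path_vars (tree_of (l @ [j])) x =
           path_vars (tree_of l) x @ (if leaf_of (tree_of l) x = sel S l then [j] else [])"
proof -
  note g = grown_tree_of[OF l] and s = selection_of[OF l ns]
  have e: "tree_of (l @ [j]) = try_split M n d k S (tree_of l) (sel S l) j"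
    using ns by (simp only: tree_of_snoc if_False)
  show "j < d \<Longrightarrow> j \<notin> Q \<Longrightarrow> tree_of (l @ [j]) = tree_of l"
    unfolding e by (rule try_split_noise[OF g s(2)])
  show "j \<in> Q \<Longrightarrow> splits (tree_of (l @ [j])) = Suc (splits (tree_of l))"
    unfolding e try_split_signal(1)[OF g s(2) _ s(1)] by (rule splits_split_leaf[OF s(1)])
  show "j \<in> Q \<Longrightarrow> path_vars (tree_of (l @ [j])) x =
           path_vars (tree_of l) x @ (if leaf_of (tree_of l) x = sel S l then [j] else [])"
    unfolding e try_split_signal(1)[OF g s(2) _ s(1)] by (rule path_vars_split_leaf[OF s(1)])
qed

lemma stopped_snoc:
  "stopped M n d k S (tree_of l) \<Longrightarrow> tree_of (l @ [j]) = tree_of l"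
  by (simp only: tree_of_snoc if_True)

lemma sum_split_signal:
  fixes h :: "nat \<Rightarrow> ennreal"
  assumes "\<And>j. j < d \<Longrightarrow> j \<notin> Q \<Longrightarrow> h j = c" and "(\<Sum>j\<in>Q. h j) \<le> e"
  shows "(\<Sum>j<d. h j) \<le> e + of_nat (d - card Q) * c"
proof -
  have "(\<Sum>j<d. h j) = (\<Sum>j\<in>Q. h j) + (\<Sum>j\<in>{..<d} - Q. h j)"
    using sum.subset_diff[OF Q, of h] by (simp add: add.commute)
  also have "(\<Sum>j\<in>{..<d} - Q. h j) = (\<Sum>j\<in>{..<d} - Q. c)"
    by (intro sum.cong) (auto intro: assms(1))
  also have "\<dots> = of_nat (d - card Q) * c"
    using Q by (simp add: card_Diff_subset finite_subset)
  finally show ?thesis using assms(2) by (simp add: add_right_mono)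
qed

text \<open>
  If the attempted node is not the one of \<open>x\<close>, or the candidate is a noise variable, the list of variables
  above \<open>x\<close> is unchanged; otherwise it is extended by a uniform element of \<open>Q\<close>. In each case the average of
  \<open>V\<close> does not increase, whatever node was selected.
\<close>

lemma potential_step:
  fixes V :: "nat list \<Rightarrow> ennreal"
  assumes V: "\<And>js. js \<in> lists Q \<Longrightarrow> 2 * k \<le> card (cell_members n S x js) \<Longrightarrow>
       (\<Sum>j\<in>Q. V (js @ [j])) \<le> of_nat (card Q) * V js"
    and l: "l \<in> lists {..<d}"
  shows "(\<Sum>j<d. V (path_vars (tree_of (l @ [j])) x)) \<le> of_nat d * V (path_vars (tree_of l) x)"
proof (cases "stopped M n d k S (tree_of l)")
  case True
  then show ?thesis by (simp only: stopped_snoc) simp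
next
  case False
  let ?T = "tree_of l"
  let ?js = "path_vars ?T x"
  note g = grown_tree_of[OF l] and s = selection_of[OF l False] and h = history_step[OF l False]
  have cQ: "card Q \<le> d" using Q card_mono[of "{..<d}" Q] by simp
  have "(\<Sum>j\<in>Q. V (path_vars (tree_of (l @ [j])) x)) \<le> of_nat (card Q) * V ?js"
  proof (cases "leaf_of ?T x = sel S l")
    case True
    then have "2 * k \<le> card (cell_members n S x ?js)"
      using s(2) members_leaf_of[OF g, of x] by simp
    moreover have "(\<Sum>j\<in>Q. V (path_vars (tree_of (l @ [j])) x)) = (\<Sum>j\<in>Q. V (?js @ [j]))"
      by (intro sum.cong refl, subst h(3)) (simp_all only: True if_True simp_thms)
    ultimately show ?thesis using V[OF path_vars_in_lists[OF g]] by simp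
  next
    case False
    have "(\<Sum>j\<in>Q. V (path_vars (tree_of (l @ [j])) x)) = (\<Sum>j\<in>Q. V ?js)"
      by (intro sum.cong refl, subst h(3)) (simp_all only: False if_False append_Nil2)
    then show ?thesis by simp
  qed
  moreover have "V (path_vars (tree_of (l @ [j])) x) = V ?js" if "j < d" "j \<notin> Q" for j
    by (simp only: h(1)[OF that])
  ultimately have "(\<Sum>j<d. V (path_vars (tree_of (l @ [j])) x)) \<le>
      of_nat (card Q) * V ?js + of_nat (d - card Q) * V ?js"
    by (intro sum_split_signal)
  also have "\<dots> = of_nat d * V ?js"
  proof -
    have "(of_nat d :: ennreal) = of_nat (card Q) + of_nat (d - card Q)"
      using cQ by (simp flip: of_nat_add)
    then show ?thesis by (simp add: distrib_right)
  qed
  finally show ?thesis .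
qed

text \<open>
  Every round succeeds with probability \<open>card Q / d\<close> and there are fewer than \<open>n\<close> successes. In quantitative
  form, \<open>2 ^ (n - splits)\<close> shrinks on average by the factor \<open>r = 1 - card Q / (2 * d)\<close> in each round before
  stopping.
\<close>

lemma stops_in_probability:
  assumes "Q \<noteq> {}"
  shows "(\<lambda>t. \<integral>\<^sup>+J. indicator {J. \<not> stopped M n d k S (tree_at M n d k sel S J t)} J
            \<partial>candidate_law d) \<longlonglongrightarrow> 0"
proof -
  define r where "r = 1 - real (card Q) / (2 * real d)"
  have "card Q \<ge> 1" using assms Q by (simp add: Suc_le_eq card_gt_0_iff finite_subset)
  moreover have cQ: "card Q \<le> d" using Q card_mono[of "{..<d}" Q] by simp
  ultimately have r: "1 / 2 \<le> r" "r < 1"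
    using d_pos by (auto simp: r_def field_simps)
  \<comment> \<open>The factor \<open>(1 / r) ^ length l\<close> compensates the expected decay, so that \<open>W\<close> does not increase on average.\<close>
  define W where "W l = (if stopped M n d k S (tree_of l) then 0
      else ennreal (2 ^ (n - splits (tree_of l)) * (1 / r) ^ length l))" for l
  have step: "(\<Sum>j<d. W (l @ [j])) \<le> of_nat d * W l" if l: "l \<in> lists {..<d}" for l
  proof (cases "stopped M n d k S (tree_of l)")
    case True
    then show ?thesis unfolding W_def by (simp only: stopped_snoc) simp
  next
    case False
    let ?m = "splits (tree_of l)"
    note h = history_step[OF l False]
    define A where "A = 2 ^ (n - ?m) * (1 / r) ^ length l"
    have A: "A \<ge> 0" using r by (simp add: A_def)
    have m: "?m < n" using splits_less_card[OF _ grown_tree_of[OF l]] by simp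
    then have e: "2 ^ (n - ?m) = 2 * (2 :: real) ^ (n - Suc ?m)"
      by (simp add: Suc_diff_Suc flip: power_Suc)
    have "W (l @ [j]) \<le> ennreal (A / (2 * r))" if "j \<in> Q" for j
    proof -
      have "W (l @ [j]) \<le> ennreal (2 ^ (n - Suc ?m) * (1 / r) ^ length (l @ [j]))"
        unfolding W_def by (simp only: h(2)[OF that]) simp
      also have "2 ^ (n - Suc ?m) * (1 / r) ^ length (l @ [j]) = A / (2 * r)"
        unfolding A_def e by simp
      finally show ?thesis .
    qed
    then have "(\<Sum>j\<in>Q. W (l @ [j])) \<le> of_nat (card Q) * ennreal (A / (2 * r))"
      using sum_bounded_above by metis
    moreover have "W (l @ [j]) = ennreal (A / r)" if "j < d" "j \<notin> Q" for j
      unfolding W_def A_def by (simp only: h(1)[OF that] False if_False) simp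
    ultimately have "(\<Sum>j<d. W (l @ [j])) \<le>
        of_nat (card Q) * ennreal (A / (2 * r)) + of_nat (d - card Q) * ennreal (A / r)"
      by (intro sum_split_signal)
    also have "\<dots> = ennreal (real (card Q) * (A / (2 * r)) + real (d - card Q) * (A / r))"
      using A r
      by (simp add: ennreal_of_nat_eq_real_of_nat ennreal_plus[symmetric] ennreal_mult[symmetric]
          del: ennreal_plus)
    also have "real (card Q) * (A / (2 * r)) + real (d - card Q) * (A / r) = real d * A"
    proof -
      have "real (card Q) / 2 + real (d - card Q) = real d * r"
        using cQ d_pos by (simp add: r_def field_simps of_nat_diff)
      moreover have "real (card Q) * (A / (2 * r)) + real (d - card Q) * (A / r) =
          (real (card Q) / 2 + real (d - card Q)) * (A / r)"
        by (simp add: distrib_right add_divide_distrib)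
      ultimately show ?thesis using r by simp
    qed
    also have "ennreal (real d * A) = of_nat d * W l"
      unfolding W_def A_def[symmetric] using A False
      by (simp add: ennreal_mult ennreal_of_nat_eq_real_of_nat)
    finally show ?thesis .
  qed
  have W0: "W [] \<le> ennreal (2 ^ n)" by (simp add: W_def)
  have bound: "(\<integral>\<^sup>+J. indicator {J. \<not> stopped M n d k S (tree_at M n d k sel S J t)} J \<partial>candidate_law d)
      \<le> ennreal (2 ^ n * r ^ t)" for t
  proof -
    have "(\<integral>\<^sup>+J. indicator {J. \<not> stopped M n d k S (tree_at M n d k sel S J t)} J \<partial>candidate_law d) \<le>
        (\<integral>\<^sup>+J. W (map J [0..<t]) * ennreal (r ^ t) \<partial>candidate_law d)"
    proof (rule nn_integral_mono)
      fix J
      let ?T = "tree_at M n d k sel S J t"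
      show "indicator {J. \<not> stopped M n d k S (tree_at M n d k sel S J t)} J \<le>
          W (map J [0..<t]) * ennreal (r ^ t)"
      proof (cases "stopped M n d k S ?T")
        case False
        have "1 \<le> ennreal (2 ^ (n - splits ?T) * (1 / r) ^ t * r ^ t)"
          using r by (simp add: power_divide)
        also have "\<dots> = W (map J [0..<t]) * ennreal (r ^ t)"
          unfolding W_def tree_of_map using False r by (simp add: ennreal_mult)
        finally show ?thesis using False by simp
      qed simp
    qed
    also have "\<dots> = (\<integral>\<^sup>+J. W (map J [0..<t]) \<partial>candidate_law d) * ennreal (r ^ t)"
      by (rule nn_integral_multc[OF borel_measurable_history])
    also have "\<dots> \<le> ennreal (2 ^ n) * ennreal (r ^ t)"
      using supermartingale_candidate[of d W t] d_pos step W0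
      by (intro mult_right_mono) (auto intro: order_trans)
    also have "\<dots> = ennreal (2 ^ n * r ^ t)" using r by (simp add: ennreal_mult)
    finally show ?thesis .
  qed
  have "(\<lambda>t. 2 ^ n * r ^ t) \<longlonglongrightarrow> 2 ^ n * 0"
    using r by (intro tendsto_intros LIMSEQ_power_zero) auto
  then have "(\<lambda>t. ennreal (2 ^ n * r ^ t)) \<longlonglongrightarrow> ennreal (2 ^ n * 0)"
    by (rule tendsto_ennrealI)
  then have lim: "(\<lambda>t. ennreal (2 ^ n * r ^ t)) \<longlonglongrightarrow> 0"
    by (simp only: mult_zero_right ennreal_0)
  show ?thesis
    by (rule tendsto_sandwich[OF always_eventually always_eventually tendsto_const lim])
      (rule allI, rule zero_le, rule allI, rule bound)
qed

lemma final_tree_eq: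
  assumes "stopped M n d k S (tree_at M n d k sel S J t)"
  shows "final_tree M n d k sel S J = tree_at M n d k sel S J t"
proof -
  let ?P = "\<lambda>t. stopped M n d k S (tree_at M n d k sel S J t)"
  define u where "u = (LEAST t. ?P t)"
  have u: "?P u" "u \<le> t" unfolding u_def using assms by (auto intro: LeastI Least_le)
  have "tree_at M n d k sel S J (u + m) = tree_at M n d k sel S J u" for m
    by (induction m) (use u in \<open>auto simp: Let_def\<close>)
  from this[of "t - u"] show ?thesis using u by (simp add: final_tree_def u_def)
qed

text \<open>
  The error may be bounded by any potential that is superharmonic for the walk on lists and dominates it
  at stopped trees. Boundedness of the error takes care of the runs that have not stopped by time \<open>t\<close>.
\<close>

lemma expected_value_bound:
  fixes V :: "nat list \<Rightarrow> ennreal" and \<Phi> :: "reg_tree \<Rightarrow> ennreal"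
  assumes V: "\<And>js. js \<in> lists Q \<Longrightarrow> 2 * k \<le> card (cell_members n S x js) \<Longrightarrow>
       (\<Sum>j\<in>Q. V (js @ [j])) \<le> of_nat (card Q) * V js"
    and \<Phi>: "\<And>T. grown S Q {..<n} T \<Longrightarrow> stopped M n d k S T \<Longrightarrow> \<Phi> T \<le> V (path_vars T x)"
    and C: "\<And>T. \<Phi> T \<le> ennreal C"
  shows "(\<integral>\<^sup>+J. \<Phi> (final_tree M n d k sel S J) \<partial>candidate_law d) \<le> V []"
proof -
  let ?ns = "\<lambda>t. indicator {J. \<not> stopped M n d k S (tree_at M n d k sel S J t)} :: _ \<Rightarrow> ennreal"
  let ?p = "\<lambda>t. \<integral>\<^sup>+J. ?ns t J \<partial>candidate_law d"
  have m1: "(\<lambda>J. V (path_vars (tree_at M n d k sel S J t) x)) \<in> borel_measurable (candidate_law d)" for t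
    using borel_measurable_history[of "\<lambda>l. V (path_vars (tree_of l) x)" t d] by (simp only: tree_of_map)
  have m2: "?ns t \<in> borel_measurable (candidate_law d)" for t
    using borel_measurable_history[of "\<lambda>l. indicator {l. \<not> stopped M n d k S (tree_of l)} l" t d]
    by (simp only: tree_of_map mem_Collect_eq indicator_def[abs_def])
  have bound: "(\<integral>\<^sup>+J. \<Phi> (final_tree M n d k sel S J) \<partial>candidate_law d) \<le> V [] + ennreal C * ?p t" for t
  proof -
    have d0: "0 < d" using d_pos by simp
    have "(\<integral>\<^sup>+J. \<Phi> (final_tree M n d k sel S J) \<partial>candidate_law d) \<le>
       (\<integral>\<^sup>+J. V (path_vars (tree_at M n d k sel S J t) x) + ennreal C * ?ns t J \<partial>candidate_law d)"
    proof (rule nn_integral_mono_AE, use AE_candidate_range[OF d0] in eventually_elim)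
      fix J :: "nat \<Rightarrow> nat" assume J: "\<forall>i. J i < d"
      show "\<Phi> (final_tree M n d k sel S J) \<le>
          V (path_vars (tree_at M n d k sel S J t) x) + ennreal C * ?ns t J"
      proof (cases "stopped M n d k S (tree_at M n d k sel S J t)")
        case True
        have "grown S Q {..<n} (tree_of (map J [0..<t]))"
          using J by (intro grown_tree_of) auto
        then show ?thesis
          using True \<Phi>[of "tree_at M n d k sel S J t"] final_tree_eq[OF True]
          by (simp only: tree_of_map) (auto intro: add_increasing2)
      next
        case False
        then show ?thesis using C by (auto intro: add_increasing)
      qed
    qed
    also have "\<dots> = (\<integral>\<^sup>+J. V (path_vars (tree_at M n d k sel S J t) x) \<partial>candidate_law d) + ennreal C * ?p t"
      using m1 m2 by (subst nn_integral_add) (auto simp: nn_integral_cmult)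
    also have "\<dots> \<le> V [] + ennreal C * ?p t"
    proof (rule add_right_mono)
      have "(\<integral>\<^sup>+J. V (path_vars (tree_of (map J [0..<t])) x) \<partial>candidate_law d) \<le> V (path_vars (tree_of []) x)"
        using potential_step[OF V] d_pos by (intro supermartingale_candidate) auto
      then show "(\<integral>\<^sup>+J. V (path_vars (tree_at M n d k sel S J t) x) \<partial>candidate_law d) \<le> V []"
        by (simp only: tree_of_map tree_of_Nil path_vars.simps)
    qed
    finally show ?thesis .
  qed
  show ?thesis
  proof (cases "Q = {}")
    case True
    have "stopped M n d k S (tree_at M n d k sel S J 0)" for J
      using not_stopped_signal[of Terminal] True n_pos by (auto simp: lessThan_empty_iff)
    then have "?p 0 = 0" by simp
    then show ?thesis using bound[of 0] by simp
  next
    case False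
    have "(\<lambda>t. V [] + ennreal C * ?p t) \<longlonglongrightarrow> V [] + ennreal C * 0"
      by (intro tendsto_add tendsto_const ennreal_tendsto_cmult stops_in_probability[OF False]) simp
    then show ?thesis
      using bound by (intro LIMSEQ_le_const[of _ "V []"]) auto
  qed
qed

end

section \<open>Measurability of cells\<close>

lemma borel_measurable_order_stat:
  assumes "finite I" "l < card I" "\<And>i. i \<in> I \<Longrightarrow> v i \<in> borel_measurable N"
  shows "(\<lambda>\<omega>. order_stat l I (\<lambda>i. v i \<omega>)) \<in> borel_measurable N"
proof (subst borel_measurable_iff_le, intro allI)
  fix c
  have c: "real (card {i\<in>I. v i \<omega> \<le> c}) = (\<Sum>i\<in>I. indicator {..c} (v i \<omega>))" for \<omega>
    using assms(1) by (simp add: indicator_def sum.If_cases Int_def)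
  then have "{\<omega> \<in> space N. order_stat l I (\<lambda>i. v i \<omega>) \<le> c} =
      {\<omega> \<in> space N. real l < (\<Sum>i\<in>I. indicator {..c} (v i \<omega>))}"
    unfolding order_stat_le_iff[OF assms(1,2)] c[symmetric] by simp
  also have "\<dots> \<in> sets N"
  proof -
    have "(\<lambda>\<omega>. \<Sum>i\<in>I. indicator {..c} (v i \<omega>) :: real) \<in> borel_measurable N"
      by (intro borel_measurable_sum measurable_compose[OF assms(3)]) auto
    then show ?thesis by measurable
  qed
  finally show "{\<omega> \<in> space N. order_stat l I (\<lambda>i. v i \<omega>) \<le> c} \<in> sets N" .
qed

lemma borel_measurable_median:
  assumes "finite I" "\<And>i. i \<in> I \<Longrightarrow> v i \<in> borel_measurable N"
  shows "(\<lambda>\<omega>. median I (\<lambda>i. v i \<omega>)) \<in> borel_measurable N"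
proof (cases "I = {}")
  case True
  then show ?thesis by (simp add: median_def)
next
  case False
  then have "card I > 0" using assms(1) by (simp add: card_gt_0_iff)
  then have "(card I - 1) div 2 < card I" "card I div 2 < card I" by auto
  then show ?thesis
    unfolding median_eq_order_stat
    by (intro borel_measurable_divide borel_measurable_add borel_measurable_order_stat assms) auto
qed

lemma measurable_subset_valued:
  fixes c :: "'a \<Rightarrow> nat set"
  assumes "finite A" "\<And>\<omega>. \<omega> \<in> space N \<Longrightarrow> c \<omega> \<subseteq> A"
    and "\<And>i. i \<in> A \<Longrightarrow> {\<omega> \<in> space N. i \<in> c \<omega>} \<in> sets N"
  shows "c \<in> measurable N (count_space (Pow A))"
proof (subst measurable_count_space_eq2)
  show "finite (Pow A)" using assms by simp
  have "c -` {B} \<inter> space N \<in> sets N" if "B \<in> Pow A" for B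
  proof -
    have "c -` {B} \<inter> space N = {\<omega> \<in> space N. \<forall>i\<in>A. (i \<in> c \<omega>) = (i \<in> B)}"
    proof -
      have "c \<omega> = B \<longleftrightarrow> (\<forall>i\<in>A. (i \<in> c \<omega>) = (i \<in> B))" if "\<omega> \<in> space N" for \<omega>
        using assms(2)[OF that] \<open>B \<in> Pow A\<close> by blast
      then show ?thesis by blast
    qed
    also have "\<dots> \<in> sets N"
    proof (intro sets.sets_Collect_finite_All assms(1))
      fix i assume i: "i \<in> A"
      have "{\<omega> \<in> space N. i \<in> c \<omega> \<longleftrightarrow> i \<in> B} =
          (if i \<in> B then {\<omega> \<in> space N. i \<in> c \<omega>} else space N - {\<omega> \<in> space N. i \<in> c \<omega>})" by auto
      then show "{\<omega> \<in> space N. (i \<in> c \<omega>) = (i \<in> B)} \<in> sets N" using assms(3)[OF i] by auto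
    qed
    finally show ?thesis .
  qed
  then show "c \<in> space N \<rightarrow> Pow A \<and> (\<forall>B\<in>Pow A. c -` {B} \<inter> space N \<in> sets N)"
    using assms(2) by auto
qed

lemma descend_cong:
  assumes "finite I" "\<And>i. i \<in> I \<Longrightarrow> fst (S i) = fst (S' i)"
  shows "descend S x I j = descend S' x I j"
proof -
  have "map (\<lambda>i. fst (S i) j) (sorted_list_of_set I) = map (\<lambda>i. fst (S' i) j) (sorted_list_of_set I)"
    using assms by simp
  then have "split_point S I j = split_point S' I j" unfolding split_point_def median_def by metis
  then show ?thesis unfolding descend_def below_def above_def using assms(2) by auto
qed

text \<open>
  Since the responses do not enter, the cell of a fixed list can be conditioned on when residuals are
  averaged.
\<close>

lemma cell_members_cong:
  assumes "\<And>i. i < n \<Longrightarrow> fst (S i) = fst (S' i)"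
  shows "cell_members n S x js = cell_members n S' x js"
proof (induction js rule: rev_induct)
  case (snoc j js)
  have "descend S x (cell_members n S x js) j = descend S' x (cell_members n S x js) j"
    using cell_members_subset[of n S x js] assms by (intro descend_cong) auto
  then show ?case using snoc by simp
qed simp

lemma generic_cong:
  assumes "\<And>i. i < n \<Longrightarrow> fst (S i) = fst (S' i)"
  shows "generic n d S \<longleftrightarrow> generic n d S'"
proof -
  have "inj_on (\<lambda>i. fst (S i) j) {..<n} \<longleftrightarrow> inj_on (\<lambda>i. fst (S' i) j) {..<n}" for j
    using assms by (intro inj_on_cong) simp
  then show ?thesis using assms by (simp add: generic_def)
qed

section \<open>Versions of conditional means\<close>

text \<open>
  The defining property of conditional means, transported from the generated sigma-algebra to test
  functions of the conditioning variable.
\<close>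

lemma cond_mean_version_integral:
  assumes P: "prob_space P" and Z: "Z \<in> measurable P N" and W: "W \<in> borel_measurable P"
    and g: "cond_mean_version P Z N W g" and h: "h \<in> borel_measurable N"
    and int: "integrable P (\<lambda>w. h (Z w) * W w)"
  shows "integrable P (\<lambda>w. h (Z w) * g (Z w))"
    and "(\<integral>w. h (Z w) * g (Z w) \<partial>P) = (\<integral>w. h (Z w) * W w \<partial>P)"
proof -
  interpret prob_space P by fact
  define F where "F = vimage_algebra (space P) Z N"
  have sp: "Z \<in> space P \<rightarrow> space N" using Z by (rule measurable_space[THEN funcsetI])
  have ZF: "Z \<in> measurable F N"
    unfolding F_def using sp by (rule measurable_vimage_algebra1)
  interpret finite_measure_subalgebra P F
  proof
    show "subalgebra P F"
      unfolding subalgebra_def F_def using Z sp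
      by (auto simp: sets_vimage_algebra2 measurable_sets)
  qed
  have gm: "g \<in> borel_measurable N" and ae: "AE w in P. real_cond_exp P F W w = g (Z w)"
    using g by (auto simp: cond_mean_version_def F_def)
  have hF: "(\<lambda>w. h (Z w)) \<in> borel_measurable F" by (rule measurable_compose[OF ZF h])
  note r = real_cond_exp_intg[OF int hF W]
  have ae': "AE w in P. h (Z w) * real_cond_exp P F W w = h (Z w) * g (Z w)"
    using ae by eventually_elim simp
  have m: "(\<lambda>w. h (Z w) * g (Z w)) \<in> borel_measurable P"
    using measurable_compose[OF Z h] measurable_compose[OF Z gm] by simp
  show "integrable P (\<lambda>w. h (Z w) * g (Z w))"
    by (rule integrable_cong_AE_imp[OF r(1) m ae'])
  have "(\<integral>w. h (Z w) * g (Z w) \<partial>P) = (\<integral>w. h (Z w) * real_cond_exp P F W w \<partial>P)"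
    using ae' r(1) m by (intro integral_cong_AE[symmetric]) auto
  then show "(\<integral>w. h (Z w) * g (Z w) \<partial>P) = (\<integral>w. h (Z w) * W w \<partial>P)" using r(2) by simp
qed

lemma cond_mean_version_bounded:
  assumes P: "prob_space P" and Z: "Z \<in> measurable P N" and W: "W \<in> borel_measurable P"
    and g: "cond_mean_version P Z N W g" and M: "AE w in P. W w \<in> {- M..M}"
  shows "AE w in P. g (Z w) \<in> {- M..M}"
proof -
  interpret prob_space P by fact
  define F where "F = vimage_algebra (space P) Z N"
  have sp: "Z \<in> space P \<rightarrow> space N" using Z by (rule measurable_space[THEN funcsetI])
  interpret finite_measure_subalgebra P F
  proof
    show "subalgebra P F"
      unfolding subalgebra_def F_def using Z sp
      by (auto simp: sets_vimage_algebra2 measurable_sets)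
  qed
  have ae: "AE w in P. real_cond_exp P F W w = g (Z w)"
    using g by (auto simp: cond_mean_version_def F_def)
  have int: "integrable P W"
    using M W by (intro integrable_const_bound[of _ M]) auto
  have "AE w in P. real_cond_exp P F W w \<ge> - M"
    using M by (intro real_cond_exp_ge_c int) auto
  moreover have "AE w in P. real_cond_exp P F W w \<le> M"
    using M by (intro real_cond_exp_le_c int) auto
  ultimately show ?thesis using ae by eventually_elim auto
qed

section \<open>Variance of leaf averages\<close>

text \<open>
  The expectation of \<open>\<Phi>\<close> at the first stopped list when \<open>js\<close> is extended by independent uniform elements
  of \<open>Q\<close>. The number \<open>h\<close> bounds the extensions and replaces a proof of termination.
\<close>

primrec leaf_average ::
  "nat set \<Rightarrow> (nat list \<Rightarrow> bool) \<Rightarrow> (nat list \<Rightarrow> ennreal) \<Rightarrow> nat \<Rightarrow> nat list \<Rightarrow> ennreal" where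
  "leaf_average Q stop \<Phi> 0 js = \<Phi> js"
| "leaf_average Q stop \<Phi> (Suc h) js =
     (if stop js then \<Phi> js
      else (\<Sum>j\<in>Q. leaf_average Q stop \<Phi> h (js @ [j])) / of_nat (card Q))"

lemma leaf_average_stop: "stop js \<Longrightarrow> leaf_average Q stop \<Phi> h js = \<Phi> js"
  by (cases h) auto

locale regression_model = prob_space D for D :: "(point \<times> real) measure" +
  fixes d :: nat and M :: real and f :: "point \<Rightarrow> real"
  assumes sets_D: "sets D = sets (point_space {..<d} \<Otimes>\<^sub>M borel)"
    and M_pos: "M > 0"
    and bounded: "AE z in D. snd z \<in> {- M..M}"
    and regression: "cond_mean_version D fst (point_space {..<d}) snd f"
begin

lemma measurable_fst_D [measurable]: "fst \<in> measurable D (point_space {..<d})"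
  using sets_D measurable_cong_sets[OF sets_D refl] by simp

lemma measurable_snd_D [measurable]: "snd \<in> borel_measurable D"
  using sets_D measurable_cong_sets[OF sets_D refl] by simp

lemma measurable_coordinate: "j < d \<Longrightarrow> (\<lambda>x. x j) \<in> borel_measurable (point_space {..<d})"
  unfolding point_space_def by simp

lemma measurable_fst_coordinate [measurable]: "j < d \<Longrightarrow> (\<lambda>z. fst z j) \<in> borel_measurable D"
  by (rule measurable_compose[OF measurable_fst_D measurable_coordinate])

lemma measurable_f [measurable]: "f \<in> borel_measurable (point_space {..<d})"
  using regression by (simp add: cond_mean_version_def)

lemma measurable_f_fst [measurable]: "(\<lambda>z. f (fst z)) \<in> borel_measurable D"
  by (rule measurable_compose[OF measurable_fst_D measurable_f])

lemma regression_bounded: "AE z in D. f (fst z) \<in> {- M..M}"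
  by (rule cond_mean_version_bounded[OF prob_space_axioms _ _ regression bounded]) measurable

definition residual :: "point \<times> real \<Rightarrow> real" where
  "residual z = snd z - f (fst z)"

lemma measurable_residual [measurable]: "residual \<in> borel_measurable D"
  unfolding residual_def[abs_def] by measurable

lemma residual_bounded: "AE z in D. \<bar>residual z\<bar> \<le> 2 * M"
  using bounded regression_bounded by eventually_elim (auto simp: residual_def)

text \<open>
  The regression function is a version of the conditional mean of the response given the input.
\<close>

lemma residual_orthogonal:
  assumes h: "h \<in> borel_measurable (point_space {..<d})" and b: "\<And>x. \<bar>h x\<bar> \<le> C"
  shows "(\<integral>z. h (fst z) * residual z \<partial>D) = 0"
proof -
  have hm: "(\<lambda>z. h (fst z)) \<in> borel_measurable D" by (rule measurable_compose[OF measurable_fst_D h])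
  have C: "C \<ge> 0" using b[of undefined] by linarith
  have int: "integrable D (\<lambda>z. h (fst z) * snd z)"
  proof (rule integrable_const_bound[of _ "C * M"])
    show "AE z in D. norm (h (fst z) * snd z) \<le> C * M"
      using bounded by eventually_elim (auto simp: abs_mult intro!: mult_mono b C)
  qed (use hm in measurable)
  note c = cond_mean_version_integral[where P = D and Z = fst and W = snd and h = h,
      OF prob_space_axioms measurable_fst_D measurable_snd_D regression h int]
  show ?thesis
    using c int by (simp add: residual_def right_diff_distrib)
qed

definition train :: "nat \<Rightarrow> sample measure" where "train n = training_law n D"

lemma product_prob_space_D: "product_prob_space (\<lambda>_::nat. D)"
  by (intro product_prob_spaceI) (rule prob_space_axioms)

lemma prob_space_train: "prob_space (train n)"
  unfolding train_def training_law_def by (intro prob_space_PiM prob_space_axioms)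

lemma measurable_sample [measurable]: "i < n \<Longrightarrow> (\<lambda>S. S i) \<in> measurable (train n) D"
  unfolding train_def training_law_def by simp

lemma measurable_sample_coordinate [measurable]:
  "i < n \<Longrightarrow> j < d \<Longrightarrow> (\<lambda>S. fst (S i) j) \<in> borel_measurable (train n)"
  by (rule measurable_compose[OF measurable_sample measurable_fst_coordinate])

lemma AE_train:
  assumes "AE z in D. P z" shows "AE S in train n. \<forall>i<n. P (S i)"
proof -
  interpret product_prob_space "\<lambda>_::nat. D" "{..<n}" by (rule product_prob_space_D)
  have "AE S in train n. P (S i)" if "i \<in> {..<n}" for i
    unfolding train_def training_law_def using that assms by (intro AE_component) auto
  then have "AE S in train n. \<forall>i\<in>{..<n}. P (S i)" by (intro AE_finite_allI) auto
  then show ?thesis by eventually_elim auto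
qed

lemma measurable_split_point:
  assumes "I \<subseteq> {..<n}" "j < d"
  shows "(\<lambda>S. split_point S I j) \<in> borel_measurable (train n)"
  unfolding split_point_def using assms finite_subset[OF assms(1)]
  by (intro borel_measurable_median measurable_sample_coordinate) auto

lemma measurable_descend:
  assumes "I \<subseteq> {..<n}" "j < d"
  shows "(\<lambda>S. descend S x I j) \<in> measurable (train n) (count_space (Pow {..<n}))"
proof (rule measurable_subset_valued)
  show "descend S x I j \<subseteq> {..<n}" for S using descend_subset assms(1) by blast
  define s where "s = (\<lambda>S. split_point S I j)"
  have [measurable]: "s \<in> borel_measurable (train n)"
    unfolding s_def by (rule measurable_split_point[OF assms])
  fix i assume i: "i \<in> {..<n}"
  define c where "c = (\<lambda>S::sample. fst (S i) j)"
  have [measurable]: "c \<in> borel_measurable (train n)"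
    unfolding c_def using i assms by (intro measurable_sample_coordinate) auto
  have "{S \<in> space (train n). i \<in> descend S x I j} = {S \<in> space (train n).
      i \<in> I \<and> (x j \<le> s S \<and> c S \<le> s S \<or> \<not> x j \<le> s S \<and> s S < c S)}"
    by (auto simp: descend_def below_def above_def s_def c_def)
  also have "\<dots> = (if i \<in> I then
      {S \<in> space (train n). x j \<le> s S} \<inter> {S \<in> space (train n). c S \<le> s S} \<union>
      {S \<in> space (train n). s S < c S} \<inter> {S \<in> space (train n). s S < x j} else {})"
    by auto
  also have "\<dots> \<in> sets (train n)"
    by (auto intro!: sets.Un sets.Int borel_measurable_le borel_measurable_less)
  finally show "{S \<in> space (train n). i \<in> descend S x I j} \<in> sets (train n)" .
qed simp

lemma measurable_cell_members:
  "js \<in> lists {..<d} \<Longrightarrow>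
     (\<lambda>S. cell_members n S x js) \<in> measurable (train n) (count_space (Pow {..<n}))"
proof (induction js rule: rev_induct)
  case (snoc j js)
  then have IH: "(\<lambda>S. cell_members n S x js) \<in> measurable (train n) (count_space (Pow {..<n}))"
    and j: "j < d" by auto
  have "(\<lambda>S. descend S x (cell_members n S x js) j) \<in> measurable (train n) (count_space (Pow {..<n}))"
    by (rule measurable_compose_countable'[OF _ IH]) (auto intro!: measurable_descend j countable_finite)
  then show ?case by simp
qed simp

text \<open>
  Events that can be conditioned on without affecting the mean of the residuals.
\<close>

definition depends_on_inputs :: "nat \<Rightarrow> (sample \<Rightarrow> bool) \<Rightarrow> bool" where
  "depends_on_inputs n G \<longleftrightarrow> {S \<in> space (train n). G S} \<in> sets (train n) \<and>
     (\<forall>S S'. (\<forall>i<n. fst (S i) = fst (S' i)) \<longrightarrow> G S = G S')"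

lemma depends_on_inputs_conj:
  "depends_on_inputs n G \<Longrightarrow> depends_on_inputs n G' \<Longrightarrow> depends_on_inputs n (\<lambda>S. G S \<and> G' S)"
  unfolding depends_on_inputs_def by (auto intro: sets.sets_Collect_conj)

lemma depends_on_inputs_cell:
  assumes "js \<in> lists {..<d}"
  shows "depends_on_inputs n (\<lambda>S. P (cell_members n S x js))"
  unfolding depends_on_inputs_def
proof (intro conjI allI impI)
  have "(\<lambda>S. cell_members n S x js) -` {A \<in> Pow {..<n}. P A} \<inter> space (train n) \<in> sets (train n)"
    by (rule measurable_sets[OF measurable_cell_members[OF assms]]) auto
  also have "(\<lambda>S. cell_members n S x js) -` {A \<in> Pow {..<n}. P A} \<inter> space (train n) =
      {S \<in> space (train n). P (cell_members n S x js)}"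
    using cell_members_subset by auto
  finally show "{S \<in> space (train n). P (cell_members n S x js)} \<in> sets (train n)" .
  fix S S' :: sample assume "\<forall>i<n. fst (S i) = fst (S' i)"
  then show "P (cell_members n S x js) = P (cell_members n S' x js)"
    using cell_members_cong[of n S S' x js] by simp
qed

lemma indicator_measurable:
  "depends_on_inputs n G \<Longrightarrow> (\<lambda>S. indicator {S. G S} S :: real) \<in> borel_measurable (train n)"
  "depends_on_inputs n G \<Longrightarrow> (\<lambda>S. indicator {S. G S} S :: ennreal) \<in> borel_measurable (train n)"
  by (auto simp: depends_on_inputs_def borel_measurable_indicator_iff Int_def conj_commute)

text \<open>
  Integrating first over example \<open>i\<close> alone, with its residual tested against a function of its input,
  gives zero.
\<close>

lemma residual_cross_term:
  assumes G: "depends_on_inputs n G" and i: "i < n" "i' < n" "i \<noteq> i'"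
  shows "(\<integral>S. indicator {S. G S} S * residual (S i) * residual (S i') \<partial>train n) = 0"
proof -
  let ?I = "{..<n} - {i}"
  interpret product_prob_space "\<lambda>_::nat. D" ?I by (rule product_prob_space_D)
  have ins: "{..<n} = insert i ?I" using i by auto
  define F where "F S = indicator {S. G S} S * residual (S i) * residual (S i')" for S :: sample
  have resm: "(\<lambda>S. residual (S l)) \<in> borel_measurable (train n)" if "l < n" for l
    by (rule measurable_compose[OF measurable_sample measurable_residual]) fact
  have Fm: "F \<in> borel_measurable (train n)"
    unfolding F_def[abs_def] using resm i indicator_measurable(1)[OF G] by measurable
  interpret T: prob_space "train n" by (rule prob_space_train)
  have "AE S in train n. \<bar>residual (S i)\<bar> \<le> 2 * M \<and> \<bar>residual (S i')\<bar> \<le> 2 * M"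
    using AE_train[OF residual_bounded, of n] i by auto
  then have "AE S in train n. norm (F S) \<le> 2 * M * (2 * M)"
  proof eventually_elim
    fix S :: sample assume "\<bar>residual (S i)\<bar> \<le> 2 * M \<and> \<bar>residual (S i')\<bar> \<le> 2 * M"
    then have "\<bar>residual (S i)\<bar> * \<bar>residual (S i')\<bar> \<le> 2 * M * (2 * M)"
      using M_pos by (intro mult_mono) auto
    then show "norm (F S) \<le> 2 * M * (2 * M)"
      using M_pos by (auto simp: F_def indicator_def abs_mult)
  qed
  then have Fint: "integrable (train n) F"
    using Fm by (intro T.integrable_const_bound) auto
  have "(\<integral>S. F S \<partial>train n) = (\<integral>S. F S \<partial>PiM (insert i ?I) (\<lambda>_. D))"
    unfolding train_def training_law_def using ins by simp
  also have "\<dots> = (\<integral>S. (\<integral>z. F (S(i := z)) \<partial>D) \<partial>PiM ?I (\<lambda>_. D))"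
    using Fint unfolding train_def training_law_def using ins
    by (intro product_integral_insert) auto
  also have "\<dots> = (\<integral>S. 0 \<partial>PiM ?I (\<lambda>_. D))"
  proof (intro Bochner_Integration.integral_cong refl)
    fix S assume S: "S \<in> space (PiM ?I (\<lambda>_. D))"
    \<comment> \<open>The response \<open>0\<close> is arbitrary, as \<open>G\<close> ignores responses.\<close>
    define h where "h x = (indicator {S. G S} (S(i := (x, 0))) :: real)" for x
    have upd: "(\<lambda>x. S(i := (x, 0))) \<in> measurable (point_space {..<d}) (train n)"
      unfolding train_def training_law_def
    proof (rule measurable_fun_upd)
      show "{..<n} = ?I \<union> {i}" using i by auto
      show "(\<lambda>x. S) \<in> measurable (point_space {..<d}) (PiM ?I (\<lambda>_. D))" using S by simp
      have "(\<lambda>x. (x, 0 :: real)) \<in> measurable (point_space {..<d}) (point_space {..<d} \<Otimes>\<^sub>M borel)"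
        by measurable
      then show "(\<lambda>x. (x, 0)) \<in> measurable (point_space {..<d}) D"
        by (subst measurable_cong_sets[OF refl sets_D])
    qed
    have hm: "h \<in> borel_measurable (point_space {..<d})"
      unfolding h_def[abs_def] by (rule measurable_compose[OF upd indicator_measurable(1)[OF G]])
    have "F (S(i := z)) = residual (S i') * (h (fst z) * residual z)" for z
    proof -
      have "G (S(i := z)) = G (S(i := (fst z, 0)))"
        using G by (auto simp: depends_on_inputs_def)
      then show ?thesis using i by (simp add: F_def h_def indicator_def)
    qed
    then have "(\<integral>z. F (S(i := z)) \<partial>D) = residual (S i') * (\<integral>z. h (fst z) * residual z \<partial>D)"
      by simp
    also have "\<dots> = 0" using residual_orthogonal[OF hm, of 1] by (simp add: h_def indicator_def)
    finally show "(\<integral>z. F (S(i := z)) \<partial>D) = 0" .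
  qed
  finally show ?thesis by (simp add: F_def)
qed

text \<open>
  Only the diagonal terms of the squared sum survive, and each is at most \<open>4 * M\<^sup>2\<close>.
\<close>

lemma residual_mean_square:
  assumes G: "depends_on_inputs n G" and A: "A \<subseteq> {..<n}" "A \<noteq> {}"
  shows "(\<integral>\<^sup>+S. indicator {S. G S} S * ennreal (((\<Sum>i\<in>A. residual (S i)) / real (card A))\<^sup>2) \<partial>train n)
     \<le> ennreal (4 * M\<^sup>2 / real (card A)) * (\<integral>\<^sup>+S. indicator {S. G S} S \<partial>train n)"
proof -
  interpret T: prob_space "train n" by (rule prob_space_train)
  have finA: "finite A" using A finite_subset by auto
  then have cA: "real (card A) > 0" using A by (simp add: card_gt_0_iff)
  have resm [measurable]: "(\<lambda>S. residual (S l)) \<in> borel_measurable (train n)" if "l < n" for l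
    by (rule measurable_compose[OF measurable_sample measurable_residual]) fact
  note Gm [measurable] = indicator_measurable(1)[OF G]
  define F where "F i i' S = indicator {S. G S} S * residual (S i) * residual (S i')" for i i' and S :: sample
  have Fint: "integrable (train n) (F i i')" if "i \<in> A" "i' \<in> A" for i i'
  proof (rule T.integrable_const_bound[of _ "2 * M * (2 * M)"])
    have i: "i < n" "i' < n" using that A by auto
    show "F i i' \<in> borel_measurable (train n)" unfolding F_def[abs_def] using i by measurable
    have "AE S in train n. \<bar>residual (S i)\<bar> \<le> 2 * M \<and> \<bar>residual (S i')\<bar> \<le> 2 * M"
      using AE_train[OF residual_bounded, of n] i by auto
    then show "AE S in train n. norm (F i i' S) \<le> 2 * M * (2 * M)"
    proof eventually_elim
      fix S :: sample assume "\<bar>residual (S i)\<bar> \<le> 2 * M \<and> \<bar>residual (S i')\<bar> \<le> 2 * M"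
      then have "\<bar>residual (S i)\<bar> * \<bar>residual (S i')\<bar> \<le> 2 * M * (2 * M)"
        using M_pos by (intro mult_mono) auto
      then show "norm (F i i' S) \<le> 2 * M * (2 * M)"
        using M_pos by (auto simp: F_def indicator_def abs_mult)
    qed
  qed
  have Gint: "integrable (train n) (\<lambda>S. indicator {S. G S} S :: real)"
    by (intro T.integrable_const_bound[of _ 1] Gm) (auto simp: indicator_def)
  have expand: "indicator {S. G S} S * ((\<Sum>i\<in>A. residual (S i)) / real (card A))\<^sup>2 =
      (\<Sum>i\<in>A. \<Sum>i'\<in>A. F i i' S) / (real (card A))\<^sup>2" for S
  proof -
    have "(\<Sum>i\<in>A. residual (S i))\<^sup>2 = (\<Sum>i\<in>A. \<Sum>i'\<in>A. residual (S i) * residual (S i'))"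
      by (simp add: power2_eq_square sum_product)
    then show ?thesis
      by (simp add: F_def power_divide sum_distrib_left mult.assoc)
  qed
  have diag: "(\<integral>S. F i i S \<partial>train n) \<le> 4 * M\<^sup>2 * (\<integral>S. indicator {S. G S} S \<partial>train n)" if i: "i \<in> A" for i
  proof -
    have "(\<integral>S. F i i S \<partial>train n) \<le> (\<integral>S. 4 * M\<^sup>2 * indicator {S. G S} S \<partial>train n)"
    proof (rule integral_mono_AE[OF Fint[OF i i]])
      show "integrable (train n) (\<lambda>S. 4 * M\<^sup>2 * indicator {S. G S} S :: real)" using Gint by simp
      have "AE S in train n. \<bar>residual (S i)\<bar> \<le> 2 * M"
        using AE_train[OF residual_bounded, of n] i A by auto
      then show "AE S in train n. F i i S \<le> 4 * M\<^sup>2 * indicator {S. G S} S"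
      proof eventually_elim
        fix S :: sample assume "\<bar>residual (S i)\<bar> \<le> 2 * M"
        then have "(residual (S i))\<^sup>2 \<le> (2 * M)\<^sup>2" using M_pos by (intro abs_le_square_iff[THEN iffD1]) auto
        then show "F i i S \<le> 4 * M\<^sup>2 * indicator {S. G S} S"
          by (auto simp: F_def indicator_def power2_eq_square)
      qed
    qed
    then show ?thesis by simp
  qed
  have "(\<integral>S. indicator {S. G S} S * ((\<Sum>i\<in>A. residual (S i)) / real (card A))\<^sup>2 \<partial>train n) =
      (\<Sum>i\<in>A. \<Sum>i'\<in>A. \<integral>S. F i i' S \<partial>train n) / (real (card A))\<^sup>2"
    unfolding expand using Fint by (simp add: Bochner_Integration.integral_sum)
  also have "(\<Sum>i\<in>A. \<Sum>i'\<in>A. \<integral>S. F i i' S \<partial>train n) = (\<Sum>i\<in>A. \<integral>S. F i i S \<partial>train n)"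
  proof (intro sum.cong refl)
    fix i assume i: "i \<in> A"
    have "(\<Sum>i'\<in>A. \<integral>S. F i i' S \<partial>train n) = (\<Sum>i'\<in>A. if i' = i then \<integral>S. F i i S \<partial>train n else 0)"
      using residual_cross_term[OF G, of i] i A by (intro sum.cong refl) (auto simp: F_def)
    then show "(\<Sum>i'\<in>A. \<integral>S. F i i' S \<partial>train n) = (\<integral>S. F i i S \<partial>train n)"
      using i finA by simp
  qed
  also have "\<dots> / (real (card A))\<^sup>2 \<le>
      (\<Sum>i\<in>A. 4 * M\<^sup>2 * (\<integral>S. indicator {S. G S} S \<partial>train n)) / (real (card A))\<^sup>2"
    by (intro divide_right_mono sum_mono diag) auto
  also have "\<dots> = 4 * M\<^sup>2 / real (card A) * (\<integral>S. indicator {S. G S} S \<partial>train n)"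
    using cA by (simp add: power2_eq_square)
  finally have main: "(\<integral>S. indicator {S. G S} S * ((\<Sum>i\<in>A. residual (S i)) / real (card A))\<^sup>2 \<partial>train n) \<le>
      4 * M\<^sup>2 / real (card A) * (\<integral>S. indicator {S. G S} S \<partial>train n)" .
  have "integrable (train n) (\<lambda>S. indicator {S. G S} S * ((\<Sum>i\<in>A. residual (S i)) / real (card A))\<^sup>2)"
    unfolding expand using Fint by auto
  then have "(\<integral>\<^sup>+S. ennreal (indicator {S. G S} S * ((\<Sum>i\<in>A. residual (S i)) / real (card A))\<^sup>2) \<partial>train n) =
      ennreal (\<integral>S. indicator {S. G S} S * ((\<Sum>i\<in>A. residual (S i)) / real (card A))\<^sup>2 \<partial>train n)"
    by (intro nn_integral_eq_integral) auto
  moreover have "(\<integral>\<^sup>+S. ennreal (indicator {S. G S} S) \<partial>train n) = ennreal (\<integral>S. indicator {S. G S} S \<partial>train n)"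
    by (intro nn_integral_eq_integral Gint) auto
  ultimately show ?thesis
    using main cA by (simp add: ennreal_mult'[symmetric] ennreal_indicator[symmetric] ennreal_leI)
qed

definition cell_noise :: "nat \<Rightarrow> point \<Rightarrow> nat list \<Rightarrow> sample \<Rightarrow> ennreal" where
  "cell_noise n x js S = ennreal (((\<Sum>i\<in>cell_members n S x js. residual (S i)) /
     real (card (cell_members n S x js)))\<^sup>2)"

text \<open>
  The expected squared noise in the leaf that is eventually reached from the cell \<open>js\<close>. An empty signal
  set counts as stopped, because then the root is never split.
\<close>

definition noise_average ::
  "nat \<Rightarrow> nat \<Rightarrow> point \<Rightarrow> nat set \<Rightarrow> nat \<Rightarrow> nat list \<Rightarrow> sample \<Rightarrow> ennreal" where
  "noise_average n k x Q h js S =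
     leaf_average Q (\<lambda>js. card (cell_members n S x js) < 2 * k \<or> Q = {})
       (\<lambda>js. cell_noise n x js S) h js"

lemma measurable_cell_noise:
  assumes js: "js \<in> lists {..<d}"
  shows "cell_noise n x js \<in> borel_measurable (train n)"
proof -
  let ?\<Phi> = "\<lambda>A S. ennreal (((\<Sum>i\<in>A. residual (S i)) / real (card A))\<^sup>2)"
  have "?\<Phi> A \<in> borel_measurable (train n)" if A: "A \<in> Pow {..<n}" for A
  proof -
    have "(\<lambda>S. residual (S i)) \<in> borel_measurable (train n)" if "i \<in> A" for i
      using that A by (intro measurable_compose[OF measurable_sample measurable_residual]) auto
    then show ?thesis by measurable
  qed
  then show ?thesis
    unfolding cell_noise_def[abs_def]
    by (rule measurable_compose_countable'[OF _ measurable_cell_members[OF js]])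
      (auto intro: countable_finite)
qed

text \<open>
  The event is decomposed according to the set of examples in the cell.
\<close>

lemma cell_noise_integral:
  assumes js: "js \<in> lists {..<d}" and k: "k \<ge> 1" and G: "depends_on_inputs n G"
    and Gk: "\<And>S. S \<in> space (train n) \<Longrightarrow> G S \<Longrightarrow> k \<le> card (cell_members n S x js)"
  shows "(\<integral>\<^sup>+S. indicator {S. G S} S * cell_noise n x js S \<partial>train n)
     \<le> ennreal (4 * M\<^sup>2 / real k) * (\<integral>\<^sup>+S. indicator {S. G S} S \<partial>train n)"
    (is "?I G \<le> ?K * ?P G")
proof -
  let ?c = "\<lambda>S. cell_members n S x js"
  let ?\<Phi> = "\<lambda>A S. ennreal (((\<Sum>i\<in>A. residual (S i)) / real (card A))\<^sup>2)"
  have \<Phi>m: "?\<Phi> A \<in> borel_measurable (train n)" if "A \<in> Pow {..<n}" for A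
  proof -
    have "(\<lambda>S. residual (S i)) \<in> borel_measurable (train n)" if "i \<in> A" for i
      using that \<open>A \<in> Pow {..<n}\<close>
      by (intro measurable_compose[OF measurable_sample measurable_residual]) auto
    then show ?thesis by measurable
  qed
  have GA: "depends_on_inputs n (\<lambda>S. G S \<and> ?c S = A)" for A
    using depends_on_inputs_cell[OF js] by (intro depends_on_inputs_conj G)
  have decompose: "indicator {S. G S} S * h S = (\<Sum>A\<in>Pow {..<n}. indicator {S. G S \<and> ?c S = A} S * h S)"
    for S and h :: "sample \<Rightarrow> ennreal"
  proof -
    have "(\<Sum>A\<in>Pow {..<n}. indicator {S. G S \<and> ?c S = A} S * h S) =
        (\<Sum>A\<in>Pow {..<n}. if A = ?c S then indicator {S. G S} S * h S else 0)"
      by (intro sum.cong) (auto simp: indicator_def)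
    then show ?thesis using cell_members_subset by simp
  qed
  have "?I G = (\<integral>\<^sup>+S. (\<Sum>A\<in>Pow {..<n}. indicator {S. G S \<and> ?c S = A} S * ?\<Phi> A S) \<partial>train n)"
    unfolding cell_noise_def
    by (subst decompose, intro nn_integral_cong sum.cong refl) (auto simp: indicator_def)
  also have "\<dots> = (\<Sum>A\<in>Pow {..<n}. \<integral>\<^sup>+S. indicator {S. G S \<and> ?c S = A} S * ?\<Phi> A S \<partial>train n)"
    using \<Phi>m by (intro nn_integral_sum borel_measurable_times_ennreal indicator_measurable(2)[OF GA]) auto
  also have "\<dots> \<le> (\<Sum>A\<in>Pow {..<n}. ?K * ?P (\<lambda>S. G S \<and> ?c S = A))"
  proof (intro sum_mono)
    fix A assume A: "A \<in> Pow {..<n}"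
    show "(\<integral>\<^sup>+S. indicator {S. G S \<and> ?c S = A} S * ?\<Phi> A S \<partial>train n) \<le> ?K * ?P (\<lambda>S. G S \<and> ?c S = A)"
    proof (cases "k \<le> card A")
      case True
      then have "A \<noteq> {}" using k by auto
      then have "(\<integral>\<^sup>+S. indicator {S. G S \<and> ?c S = A} S * ?\<Phi> A S \<partial>train n) \<le>
          ennreal (4 * M\<^sup>2 / real (card A)) * ?P (\<lambda>S. G S \<and> ?c S = A)"
        using A by (intro residual_mean_square[OF GA]) auto
      also have "\<dots> \<le> ?K * ?P (\<lambda>S. G S \<and> ?c S = A)"
        using True k by (intro mult_right_mono ennreal_leI divide_left_mono) auto
      finally show ?thesis .
    next
      case False
      then have "indicator {S. G S \<and> ?c S = A} S * ?\<Phi> A S = 0" if "S \<in> space (train n)" for S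
        using Gk[OF that] by (auto simp: indicator_def)
      then have "(\<integral>\<^sup>+S. indicator {S. G S \<and> ?c S = A} S * ?\<Phi> A S \<partial>train n) = (\<integral>\<^sup>+S. 0 \<partial>train n)"
        by (intro nn_integral_cong) auto
      then show ?thesis by simp
    qed
  qed
  also have "\<dots> = ?K * (\<integral>\<^sup>+S. (\<Sum>A\<in>Pow {..<n}. indicator {S. G S \<and> ?c S = A} S * 1) \<partial>train n)"
    by (simp add: sum_distrib_left nn_integral_sum indicator_measurable(2)[OF GA])
  also have "\<dots> = ?K * ?P G" unfolding decompose[of _ "\<lambda>_. 1", symmetric] by simp
  finally show ?thesis .
qed

text \<open>
  The two events \<open>stopped\<close> and \<open>not stopped\<close> are determined by the inputs, so the bound for a single cell
  propagates through the recursion. A cell with at least \<open>2 * k\<close> examples is halved, which keeps at least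
  \<open>k\<close> of them; this is where distinct coordinates are needed.
\<close>

lemma noise_average_integral:
  assumes Q: "Q \<subseteq> {..<d}" and k: "k \<ge> 1" and js: "js \<in> lists {..<d}"
    and G: "depends_on_inputs n G"
    and Gk: "\<And>S. S \<in> space (train n) \<Longrightarrow> G S \<Longrightarrow> generic n d S \<and> k \<le> card (cell_members n S x js)"
  shows "noise_average n k x Q h js \<in> borel_measurable (train n) \<and>
     (\<integral>\<^sup>+S. indicator {S. G S} S * noise_average n k x Q h js S \<partial>train n)
     \<le> ennreal (4 * M\<^sup>2 / real k) * (\<integral>\<^sup>+S. indicator {S. G S} S \<partial>train n)"
    (is "_ \<and> ?I G h js \<le> ?K * ?P G")
  using js G Gk
proof (induction h arbitrary: js G)
  case 0
  then show ?case
    using measurable_cell_noise[of js n x] cell_noise_integral[of js k n G x] k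
    by (simp add: noise_average_def[abs_def])
next
  case (Suc h)
  let ?c = "\<lambda>S. cell_members n S x js"
  let ?stop = "\<lambda>S. card (?c S) < 2 * k \<or> Q = {}"
  define G1 where "G1 = (\<lambda>S. G S \<and> ?stop S)"
  define G2 where "G2 = (\<lambda>S. G S \<and> \<not> ?stop S)"
  have st: "depends_on_inputs n ?stop" "depends_on_inputs n (\<lambda>S. \<not> ?stop S)"
    using depends_on_inputs_cell[OF Suc.prems(1), of n "\<lambda>A. card A < 2 * k \<or> Q = {}" x]
      depends_on_inputs_cell[OF Suc.prems(1), of n "\<lambda>A. \<not> (card A < 2 * k \<or> Q = {})" x] by auto
  have G1: "depends_on_inputs n G1" and G2: "depends_on_inputs n G2"
    unfolding G1_def G2_def using st by (intro depends_on_inputs_conj Suc.prems(2); simp)+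
  have l: "js @ [j] \<in> lists {..<d}" if "j \<in> Q" for j using Suc.prems(1) Q that by auto
  have k2: "k \<le> card (cell_members n S x (js @ [j]))"
    if "S \<in> space (train n)" "G2 S" "j \<in> Q" for S j
  proof -
    have "card (?c S) div 2 \<le> card (descend S x (?c S) j)"
      using Suc.prems(3)[OF that(1)] that Q
      by (intro card_descend generic_inj) (auto simp: G2_def)
    moreover have "2 * k \<le> card (?c S)" using that by (auto simp: G2_def)
    ultimately show ?thesis by simp
  qed
  have IH: "noise_average n k x Q h (js @ [j]) \<in> borel_measurable (train n)"
    "?I G2 h (js @ [j]) \<le> ?K * ?P G2" if "j \<in> Q" for j
    using Suc.IH[OF l[OF that] G2] k2[OF _ _ that] Suc.prems(3) by (auto simp: G2_def)
  have base: "(\<integral>\<^sup>+S. indicator {S. G1 S} S * cell_noise n x js S \<partial>train n) \<le> ?K * ?P G1"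
    using Suc.prems(3) by (intro cell_noise_integral[OF Suc.prems(1) k G1]) (auto simp: G1_def)
  have rec: "noise_average n k x Q (Suc h) js S = indicator {S. ?stop S} S * cell_noise n x js S +
      indicator {S. \<not> ?stop S} S * ((\<Sum>j\<in>Q. noise_average n k x Q h (js @ [j]) S) / of_nat (card Q))" for S
    by (auto simp: noise_average_def indicator_def)
  have m: "noise_average n k x Q (Suc h) js \<in> borel_measurable (train n)"
    unfolding rec[abs_def] using IH(1) st
    by (intro borel_measurable_add borel_measurable_times_ennreal indicator_measurable(2)
        measurable_cell_noise[OF Suc.prems(1)] borel_measurable_divide_ennreal
        borel_measurable_sum borel_measurable_const) auto
  let ?s = "of_nat (card Q) :: ennreal"
  have A: "indicator {S. G S} S * noise_average n k x Q (Suc h) js S =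
      indicator {S. G1 S} S * cell_noise n x js S +
      (\<Sum>j\<in>Q. indicator {S. G2 S} S * noise_average n k x Q h (js @ [j]) S) / ?s" for S
    unfolding rec by (auto simp: indicator_def G1_def G2_def)
  have m2: "(\<lambda>S. indicator {S. G2 S} S * noise_average n k x Q h (js @ [j]) S) \<in> borel_measurable (train n)"
    if "j \<in> Q" for j
    by (rule borel_measurable_times_ennreal[OF indicator_measurable(2)[OF G2] IH(1)[OF that]])
  have E: "(\<integral>\<^sup>+S. (\<Sum>j\<in>Q. indicator {S. G2 S} S * noise_average n k x Q h (js @ [j]) S) / ?s \<partial>train n) =
      (\<Sum>j\<in>Q. ?I G2 h (js @ [j])) / ?s"
    using m2 by (subst nn_integral_divide) (auto simp: nn_integral_sum intro!: borel_measurable_sum)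
  have "?I G (Suc h) js = (\<integral>\<^sup>+S. indicator {S. G1 S} S * cell_noise n x js S \<partial>train n) +
      (\<Sum>j\<in>Q. ?I G2 h (js @ [j])) / ?s"
    unfolding A E[symmetric]
  proof (rule nn_integral_add)
    show "(\<lambda>S. indicator {S. G1 S} S * cell_noise n x js S) \<in> borel_measurable (train n)"
      by (rule borel_measurable_times_ennreal[OF indicator_measurable(2)[OF G1]
            measurable_cell_noise[OF Suc.prems(1)]])
    show "(\<lambda>S. (\<Sum>j\<in>Q. indicator {S. G2 S} S * noise_average n k x Q h (js @ [j]) S) / ?s)
        \<in> borel_measurable (train n)"
      by (intro borel_measurable_divide_ennreal borel_measurable_sum m2) simp_all
  qed
  also have "\<dots> \<le> ?K * ?P G1 + (\<Sum>j\<in>Q. ?K * ?P G2) / ?s"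
    by (intro add_mono base divide_right_mono_ennreal sum_mono IH(2))
  also have "(\<Sum>j\<in>Q. ?K * ?P G2) / ?s \<le> ?K * ?P G2"
  proof (cases "Q = {}")
    case False
    then have "card Q > 0" using Q by (simp add: card_gt_0_iff finite_subset)
    then show ?thesis by (simp add: mult.commute[of ?s] ennreal_mult_divide_eq)
  qed simp
  also have "?K * ?P G1 + ?K * ?P G2 = ?K * (\<integral>\<^sup>+S. indicator {S. G1 S} S + indicator {S. G2 S} S \<partial>train n)"
    by (subst nn_integral_add) (auto intro!: indicator_measurable(2) G1 G2 simp: distrib_left)
  also have "(\<integral>\<^sup>+S. indicator {S. G1 S} S + indicator {S. G2 S} S \<partial>train n) = ?P G"
    by (intro nn_integral_cong) (auto simp: indicator_def G1_def G2_def)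
  finally show ?case using m by (simp add: add_left_mono)
qed

end

section \<open>Uniform inputs with a sparse monotone signal\<close>

definition unit_law :: "real measure" where
  "unit_law = uniform_measure lborel {0..1}"

lemma prob_space_unit_law: "prob_space unit_law"
  unfolding unit_law_def by (intro prob_space_uniform_measure) auto

lemma sets_unit_law [measurable_cong, simp]: "sets unit_law = sets borel"
  by (simp add: unit_law_def)

lemma emeasure_unit_law: "A \<in> sets borel \<Longrightarrow> emeasure unit_law A = emeasure lborel ({0..1} \<inter> A)"
  unfolding unit_law_def by (subst emeasure_uniform_measure) (auto simp: divide_ennreal_def)

lemma measure_unit_law_Ioc:
  assumes "0 \<le> a" "a \<le> b" "b \<le> 1"
  shows "measure unit_law {a<..b} = b - a"
proof -
  have "{0..1} \<inter> {a<..b} = {a<..b}" using assms by auto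
  then show ?thesis using assms by (simp add: measure_def emeasure_unit_law)
qed

lemma emeasure_unit_law_singleton: "emeasure unit_law {c} = 0"
proof -
  have "emeasure lborel ({0..1} \<inter> {c}) \<le> emeasure lborel {c}" by (intro emeasure_mono) auto
  then show ?thesis by (simp add: emeasure_unit_law)
qed

lemma sets_point_space_PiM: "sets (point_space I) = sets (PiM I (\<lambda>_. unit_law))"
  unfolding point_space_def by (intro sets_PiM_cong) auto

lemma uniform_cube_eq_PiM:
  "uniform_measure (\<Pi>\<^sub>M j\<in>{..<d}. lborel) (cube d) = PiM {..<d} (\<lambda>_. unit_law)"
proof -
  interpret U: product_prob_space "\<lambda>_::nat. unit_law" "{..<d}"
    by (intro product_prob_spaceI prob_space_unit_law)
  interpret B: product_sigma_finite "\<lambda>_::nat. lborel :: real measure"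
    by standard
  have cube: "cube d \<in> sets (\<Pi>\<^sub>M j\<in>{..<d}. lborel)"
    unfolding cube_def by (intro sets_PiM_I_finite) auto
  have c1: "emeasure (\<Pi>\<^sub>M j\<in>{..<d}. lborel) (cube d) = 1"
    unfolding cube_def by (subst B.emeasure_PiM) auto
  show ?thesis
  proof (rule U.PiM_eqI)
    show "finite {..<d}" by simp
    have "sets (\<Pi>\<^sub>M j\<in>{..<d}. lborel) = sets (PiM {..<d} (\<lambda>_. unit_law))"
      by (intro sets_PiM_cong) auto
    then show "sets (uniform_measure (\<Pi>\<^sub>M j\<in>{..<d}. lborel) (cube d)) = sets (PiM {..<d} (\<lambda>_. unit_law))"
      by simp
    fix A assume A: "\<And>i. i \<in> {..<d} \<Longrightarrow> A i \<in> sets unit_law"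
    have AP: "Pi\<^sub>E {..<d} A \<in> sets (\<Pi>\<^sub>M j\<in>{..<d}. lborel)"
      using A by (intro sets_PiM_I_finite) auto
    have "emeasure (uniform_measure (\<Pi>\<^sub>M j\<in>{..<d}. lborel) (cube d)) (Pi\<^sub>E {..<d} A) =
        emeasure (\<Pi>\<^sub>M j\<in>{..<d}. lborel) (cube d \<inter> Pi\<^sub>E {..<d} A)"
      by (subst emeasure_uniform_measure[OF cube AP]) (simp add: c1 divide_ennreal_def)
    also have "cube d \<inter> Pi\<^sub>E {..<d} A = (\<Pi>\<^sub>E j\<in>{..<d}. {0..1} \<inter> A j)"
      unfolding cube_def by (simp add: PiE_Int)
    also have "emeasure (\<Pi>\<^sub>M j\<in>{..<d}. lborel) \<dots> = (\<Prod>j<d. emeasure lborel ({0..1} \<inter> A j))"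
      using A by (subst B.emeasure_PiM) auto
    also have "\<dots> = (\<Prod>j<d. emeasure unit_law (A j))"
      using A by (intro prod.cong) (auto simp: emeasure_unit_law)
    finally show "emeasure (uniform_measure (\<Pi>\<^sub>M j\<in>{..<d}. lborel) (cube d)) (Pi\<^sub>E {..<d} A) =
        (\<Prod>i\<in>{..<d}. emeasure unit_law (A i))" .
  qed
qed

definition volume :: "nat set \<Rightarrow> point \<Rightarrow> point \<Rightarrow> real" where
  "volume R a b = (\<Prod>j\<in>R. b j - a j)"

definition unit_box :: "nat set \<Rightarrow> point \<Rightarrow> point \<Rightarrow> bool" where
  "unit_box R a b \<longleftrightarrow> (\<forall>j\<in>R. 0 \<le> a j \<and> a j \<le> b j \<and> b j \<le> 1)"

lemma volume_nonneg: "unit_box R a b \<Longrightarrow> 0 \<le> volume R a b"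
  unfolding unit_box_def volume_def by (intro prod_nonneg) auto

lemma sets_Collect_in_box:
  assumes "finite R" "\<And>j. j \<in> R \<Longrightarrow> (\<lambda>z. g z j) \<in> borel_measurable N"
  shows "{z \<in> space N. in_box R a b (g z)} \<in> sets N"
  unfolding in_box_def
  by (intro sets.sets_Collect_finite_All sets.sets_Collect_conj borel_measurable_less
      borel_measurable_le borel_measurable_const assms)

lemma borel_measurable_in_box:
  assumes "finite R" "\<And>j. j \<in> R \<Longrightarrow> (\<lambda>z. g z j) \<in> borel_measurable N"
  shows "(\<lambda>z. indicator {z. in_box R a b (g z)} z :: real) \<in> borel_measurable N"
  using sets_Collect_in_box[of R g N, OF assms]
  by (subst borel_measurable_indicator_iff) (simp add: Int_def conj_commute)

lemma in_box_insert:
  assumes "j \<notin> R"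
  shows "in_box (insert j R) (a(j := c)) (b(j := e)) x \<longleftrightarrow> in_box R a b x \<and> c < x j \<and> x j \<le> e"
proof -
  have "(\<forall>i\<in>R. (a(j := c)) i < x i \<and> x i \<le> (b(j := e)) i) \<longleftrightarrow> (\<forall>i\<in>R. a i < x i \<and> x i \<le> b i)"
    using assms by (intro ball_cong) auto
  then show ?thesis by (auto simp: in_box_def)
qed

locale sparse_model = regression_model D d M f
  for D :: "(point \<times> real) measure" and d M f +
  fixes Q :: "nat set" and \<beta> L :: real and \<sigma> :: "nat \<Rightarrow> real"
  assumes uniform: "distr D (point_space {..<d}) fst = uniform_measure (\<Pi>\<^sub>M j\<in>{..<d}. lborel) (cube d)"
    and Q_subset: "Q \<subseteq> {..<d}"
    and indep: "independent_rvs D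
          (\<lambda>z. restrict (fst z) ({..<d} - Q)) (point_space ({..<d} - Q))
          (\<lambda>z. (snd z, restrict (fst z) Q)) (borel \<Otimes>\<^sub>M point_space Q)"
    and beta: "\<beta> > 0"
    and signs: "\<And>j. j \<in> Q \<Longrightarrow> \<sigma> j \<in> {-1, 1}"
    and monotone: "\<And>j. j \<in> Q \<Longrightarrow>
          \<exists>g_above g_below.
            cond_mean_version (uniform_measure D {z \<in> space D. fst z j > 1 / 2})
              (\<lambda>z. others d j (fst z)) (point_space ({..<d} - {j})) snd g_above \<and>
            cond_mean_version (uniform_measure D {z \<in> space D. fst z j \<le> 1 / 2})
              (\<lambda>z. others d j (fst z)) (point_space ({..<d} - {j})) snd g_below \<and>
            (\<forall>x\<in>cube d. \<sigma> j * (g_above (others d j x) - g_below (others d j x)) \<ge> \<beta>)"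
    and lipschitz: "\<And>x y. x \<in> cube d \<Longrightarrow> y \<in> cube d \<Longrightarrow>
          \<bar>f x - f y\<bar> \<le> L * L2_set (\<lambda>j. x j - y j) {..<d}"
begin

lemma finite_Q [simp]: "finite Q"
  using Q_subset finite_subset by blast

lemma law: "distr D (point_space {..<d}) fst = PiM {..<d} (\<lambda>_. unit_law)"
  using uniform uniform_cube_eq_PiM by simp

lemma space_D: "z \<in> space D \<Longrightarrow> fst z \<in> extensional {..<d}"
  using measurable_space[OF measurable_fst_D] by (auto simp: point_space_def space_PiM PiE_def)

lemma emeasure_rectangle:
  assumes "\<And>j. j < d \<Longrightarrow> A j \<in> sets borel"
  shows "emeasure D {z \<in> space D. \<forall>j<d. fst z j \<in> A j} = (\<Prod>j<d. emeasure unit_law (A j))"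
proof -
  interpret U: product_prob_space "\<lambda>_::nat. unit_law" "{..<d}"
    by (intro product_prob_spaceI prob_space_unit_law)
  have AP: "Pi\<^sub>E {..<d} A \<in> sets (point_space {..<d})"
    unfolding point_space_def using assms by (intro sets_PiM_I_finite) auto
  have "{z \<in> space D. \<forall>j<d. fst z j \<in> A j} = fst -` Pi\<^sub>E {..<d} A \<inter> space D"
    using space_D by (auto simp: PiE_def Pi_def)
  then have "emeasure D {z \<in> space D. \<forall>j<d. fst z j \<in> A j} =
      emeasure (distr D (point_space {..<d}) fst) (Pi\<^sub>E {..<d} A)"
    using emeasure_distr[OF measurable_fst_D AP] by simp
  also have "\<dots> = (\<Prod>j<d. emeasure unit_law (A j))"
    unfolding law using assms by (subst U.emeasure_PiM) auto
  finally show ?thesis .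
qed

lemma measurable_in_box [measurable]:
  assumes "R \<subseteq> {..<d}"
  shows "{z \<in> space D. in_box R a b (fst z)} \<in> sets D"
  using assms finite_subset[OF assms] by (intro sets_Collect_in_box measurable_fst_coordinate) auto

lemma prob_box:
  assumes R: "R \<subseteq> {..<d}" and ab: "unit_box R a b"
  shows "prob {z \<in> space D. in_box R a b (fst z)} = volume R a b"
proof -
  interpret U: prob_space unit_law by (rule prob_space_unit_law)
  define A where "A j = (if j \<in> R then {a j<..b j} else UNIV)" for j
  have "{z \<in> space D. in_box R a b (fst z)} = {z \<in> space D. \<forall>j<d. fst z j \<in> A j}"
    using R by (auto simp: in_box_def A_def)
  then have "prob {z \<in> space D. in_box R a b (fst z)} = enn2real (\<Prod>j<d. emeasure unit_law (A j))"
    unfolding measure_def by (subst emeasure_rectangle[symmetric]) (auto simp: A_def)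
  also have "\<dots> = (\<Prod>j<d. measure unit_law (A j))"
    unfolding U.emeasure_eq_measure by (subst prod_ennreal) (auto intro!: prod_nonneg enn2real_ennreal)
  also have "\<dots> = (\<Prod>j\<in>R. measure unit_law (A j))"
  proof (rule prod.mono_neutral_right)
    show "\<forall>i\<in>{..<d} - R. measure unit_law (A i) = 1"
      using U.prob_space by (auto simp: A_def unit_law_def)
  qed (use R in auto)
  also have "\<dots> = volume R a b"
    unfolding volume_def using ab
    by (intro prod.cong refl) (auto simp: A_def unit_box_def measure_unit_law_Ioc)
  finally show ?thesis .
qed

lemma AE_pos_cube: "AE z in D. fst z \<in> pos_cube d"
proof -
  have ub: "unit_box {..<d} (\<lambda>_. 0) (\<lambda>_. 1)" by (simp add: unit_box_def)
  have "prob {z \<in> space D. in_box {..<d} (\<lambda>_. 0) (\<lambda>_. 1) (fst z)} = 1"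
    by (subst prob_box[OF order_refl ub]) (simp add: volume_def)
  then have "AE z in D. z \<in> {z \<in> space D. in_box {..<d} (\<lambda>_. 0) (\<lambda>_. 1) (fst z)}"
    by (subst AE_in_set_eq_1) auto
  then show ?thesis
  proof eventually_elim
    fix z assume "z \<in> {z \<in> space D. in_box {..<d} (\<lambda>_. 0) (\<lambda>_. 1) (fst z)}"
    then show "fst z \<in> pos_cube d"
      using space_D[of z] by (auto simp: in_box_def pos_cube_def PiE_def Pi_def)
  qed
qed

lemma AE_coordinate_neq:
  assumes "j < d" shows "AE z in D. fst z j \<noteq> c"
proof -
  have [measurable]: "(\<lambda>z. fst z j) \<in> borel_measurable D" using assms by simp
  have "{z \<in> space D. \<not> fst z j \<noteq> c} = {z \<in> space D. \<forall>i<d. fst z i \<in> (if i = j then {c} else UNIV)}"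
    using assms by auto
  then have "emeasure D {z \<in> space D. \<not> fst z j \<noteq> c} = (\<Prod>i<d. emeasure unit_law (if i = j then {c} else UNIV))"
    by (subst emeasure_rectangle[symmetric]) auto
  also have "\<dots> = 0"
    using assms emeasure_unit_law_singleton by (intro prod_zero) auto
  finally show ?thesis by (subst AE_iff_measurable[OF _ refl]) auto
qed

text \<open>
  Given all other examples, coordinate \<open>j\<close> of example \<open>i\<close> has no atoms.
\<close>

lemma AE_distinct_coordinates:
  assumes i: "i < n" "i' < n" "i \<noteq> i'" and j: "j < d"
  shows "AE S in train n. fst (S i) j \<noteq> fst (S i') j"
proof -
  let ?I = "{..<n} - {i}"
  interpret product_prob_space "\<lambda>_::nat. D" ?I by (rule product_prob_space_D)
  have ins: "{..<n} = insert i ?I" using i by auto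
  define F where "F S = (indicator {S. fst (S i) j = fst (S i') j} S :: ennreal)" for S :: sample
  define c where "c = (\<lambda>S::sample. fst (S i) j)"
  define c' where "c' = (\<lambda>S::sample. fst (S i') j)"
  have [measurable]: "c \<in> borel_measurable (train n)" "c' \<in> borel_measurable (train n)"
    unfolding c_def c'_def using i j by auto
  have set: "{S \<in> space (train n). c S = c' S} \<in> sets (train n)" by measurable
  have Fm: "F \<in> borel_measurable (train n)"
    unfolding F_def[abs_def] using set
    by (subst borel_measurable_indicator_iff) (simp add: c_def c'_def Int_def conj_commute)
  have "(\<integral>\<^sup>+S. F S \<partial>train n) = (\<integral>\<^sup>+S. F S \<partial>PiM (insert i ?I) (\<lambda>_. D))"
    unfolding train_def training_law_def using ins by simp
  also have "\<dots> = (\<integral>\<^sup>+S. (\<integral>\<^sup>+z. F (S(i := z)) \<partial>D) \<partial>PiM ?I (\<lambda>_. D))"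
    using Fm unfolding train_def training_law_def using ins
    by (intro product_nn_integral_insert) auto
  also have "\<dots> = (\<integral>\<^sup>+S. 0 \<partial>PiM ?I (\<lambda>_. D))"
  proof (intro nn_integral_cong)
    fix S :: sample
    have "AE z in D. F (S(i := z)) = 0"
      using AE_coordinate_neq[OF j, of "fst (S i') j"]
      by eventually_elim (use i in \<open>auto simp: F_def indicator_def\<close>)
    then have "(\<integral>\<^sup>+z. F (S(i := z)) \<partial>D) = (\<integral>\<^sup>+z. 0 \<partial>D)" by (rule nn_integral_cong_AE)
    then show "(\<integral>\<^sup>+z. F (S(i := z)) \<partial>D) = 0" by simp
  qed
  finally have "(\<integral>\<^sup>+S. F S \<partial>train n) = 0" by simp
  then have "AE S in train n. F S = 0" using Fm by (subst (asm) nn_integral_0_iff_AE) auto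
  then show ?thesis by eventually_elim (auto simp: F_def indicator_def split: if_splits)
qed

lemma AE_generic: "AE S in train n. generic n d S"
proof -
  have "AE S in train n. \<forall>i\<in>{..<n}. \<forall>i'\<in>{..<n}. \<forall>j\<in>{..<d}. i \<noteq> i' \<longrightarrow> fst (S i) j \<noteq> fst (S i') j"
    using AE_distinct_coordinates by (intro AE_finite_allI) (auto intro: AE_I2)
  moreover have "AE S in train n. \<forall>i<n. fst (S i) \<in> pos_cube d" by (rule AE_train[OF AE_pos_cube])
  ultimately show ?thesis
  proof eventually_elim
    case (elim S)
    then show ?case unfolding generic_def inj_on_def by (auto; metis)
  qed
qed

section \<open>Mean responses over boxes\<close>

definition response :: "nat set \<Rightarrow> point \<Rightarrow> point \<Rightarrow> real" where
  "response R a b = (\<integral>z. snd z * indicator {z. in_box R a b (fst z)} z \<partial>D)"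

lemma box_indicator_measurable [measurable]:
  assumes "R \<subseteq> {..<d}"
  shows "(\<lambda>z. indicator {z. in_box R a b (fst z)} z :: real) \<in> borel_measurable D"
  using measurable_in_box[OF assms]
  by (subst borel_measurable_indicator_iff) (simp add: Int_def conj_commute)

lemma integral_box_indicator:
  assumes "R \<subseteq> {..<d}"
  shows "(\<integral>z. indicator {z. in_box R a b (fst z)} z \<partial>D) = prob {z \<in> space D. in_box R a b (fst z)}"
proof -
  have "(\<integral>z. indicator {z. in_box R a b (fst z)} z \<partial>D) =
      (\<integral>z. indicator {z \<in> space D. in_box R a b (fst z)} z \<partial>D)"
    by (intro Bochner_Integration.integral_cong) (auto simp: indicator_def)
  then show ?thesis
    using measurable_in_box[OF assms] Bochner_Integration.integral_indicator[of D "{z \<in> space D. in_box R a b (fst z)}"]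
    by (simp add: Int_def conj_commute)
qed

lemma integrable_response:
  assumes "R \<subseteq> {..<d}"
  shows "integrable D (\<lambda>z. snd z * indicator {z. in_box R a b (fst z)} z)"
proof (rule integrable_const_bound[of _ M])
  show "AE z in D. norm (snd z * indicator {z. in_box R a b (fst z)} z) \<le> M"
    using bounded by eventually_elim (use M_pos in \<open>auto simp: indicator_def\<close>)
qed (use box_indicator_measurable[OF assms] in measurable)

lemma integrable_box_indicator:
  assumes "R \<subseteq> {..<d}"
  shows "integrable D (\<lambda>z. indicator {z. in_box R a b (fst z)} z :: real)"
  using box_indicator_measurable[OF assms]
  by (intro integrable_const_bound[of _ 1]) (auto simp: indicator_def)

text \<open>
  The noise coordinates are independent of the response and the signal coordinates jointly, so their box
  only contributes its probability as a factor.
\<close>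

lemma noise_box:
  assumes R: "R \<subseteq> Q" and R': "R' \<subseteq> {..<d} - Q" and ub: "unit_box R' a b"
  shows "response (R \<union> R') a b = response R a b * volume R' a b"
proof -
  let ?N = "{..<d} - Q"
  define Z where "Z = (\<lambda>z::point \<times> real. restrict (fst z) ?N)"
  define Z' where "Z' = (\<lambda>z::point \<times> real. (snd z, restrict (fst z) Q))"
  define F where "F = vimage_algebra (space D) Z (point_space ?N)"
  define F' where "F' = vimage_algebra (space D) Z' (borel \<Otimes>\<^sub>M point_space Q)"
  have ind: "indep_set (sets F) (sets F')"
    using indep by (simp add: independent_rvs_def F_def F'_def Z_def Z'_def)
  have Zs: "Z \<in> space D \<rightarrow> space (point_space ?N)"
    by (auto simp: Z_def point_space_def space_PiM)
  have Zs': "Z' \<in> space D \<rightarrow> space (borel \<Otimes>\<^sub>M point_space Q)"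
    by (auto simp: Z'_def point_space_def space_PiM space_pair_measure)
  have ZF: "Z \<in> measurable F (point_space ?N)"
    unfolding F_def using Zs by (rule measurable_vimage_algebra1)
  have ZF': "Z' \<in> measurable F' (borel \<Otimes>\<^sub>M point_space Q)"
    unfolding F'_def using Zs' by (rule measurable_vimage_algebra1)
  define X where "X = (\<lambda>z::point \<times> real. indicator {z. in_box R' a b (fst z)} z :: real)"
  define Y where "Y = (\<lambda>z::point \<times> real. snd z * indicator {z. in_box R a b (fst z)} z)"
  have XF: "X \<in> borel_measurable F"
  proof -
    have "(\<lambda>y. y j) \<in> borel_measurable (point_space ?N)" if "j \<in> R'" for j
      unfolding point_space_def using that R' by (intro measurable_component_singleton) auto
    then have "(\<lambda>z. Z z j) \<in> borel_measurable F" if "j \<in> R'" for j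
      using measurable_compose[OF ZF] that by blast
    moreover have "(\<lambda>z. Z z j) = (\<lambda>z. fst z j)" if "j \<in> R'" for j
      using that R' by (auto simp: Z_def)
    ultimately have "(\<lambda>z. fst z j) \<in> borel_measurable F" if "j \<in> R'" for j
      using that by metis
    then show ?thesis
      unfolding X_def using finite_subset[OF R'] by (intro borel_measurable_in_box) auto
  qed
  have YF: "Y \<in> borel_measurable F'"
  proof -
    have c: "(\<lambda>y. snd y j) \<in> borel_measurable (borel \<Otimes>\<^sub>M point_space Q)" if "j \<in> R" for j
      using that R unfolding point_space_def
      by (intro measurable_compose[OF measurable_snd]) auto
    have "(\<lambda>z. snd (Z' z) j) \<in> borel_measurable F'" if "j \<in> R" for j
      by (rule measurable_compose[OF ZF' c[OF that]])
    moreover have "(\<lambda>z. snd (Z' z) j) = (\<lambda>z. fst z j)" if "j \<in> R" for j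
      using that R by (auto simp: Z'_def)
    ultimately have "(\<lambda>z. fst z j) \<in> borel_measurable F'" if "j \<in> R" for j
      using that by metis
    then have "(\<lambda>z. indicator {z. in_box R a b (fst z)} z :: real) \<in> borel_measurable F'"
      using finite_subset[OF R] by (intro borel_measurable_in_box) auto
    moreover have "(\<lambda>z. fst (Z' z)) \<in> borel_measurable F'"
      by (rule measurable_compose[OF ZF' measurable_fst])
    then have "snd \<in> borel_measurable F'" by (simp add: Z'_def)
    ultimately show ?thesis unfolding Y_def by measurable
  qed
  have Rd: "R \<subseteq> {..<d}" "R' \<subseteq> {..<d}" using R R' Q_subset by auto
  have Ym: "Y \<in> borel_measurable D" "integrable D Y"
    unfolding Y_def using integrable_response[OF Rd(1)] by auto
  have Xm: "X \<in> borel_measurable D" "integrable D X"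
    unfolding X_def using integrable_box_indicator[OF Rd(2)] by auto
  have spF: "space F = space D" "space F' = space D" by (simp_all add: F_def F'_def)
  have "indep_var borel X borel Y"
    unfolding indep_var_eq
  proof (intro conjI Xm(1) Ym(1))
    have sX: "sigma_sets (space D) {X -` A \<inter> space D | A. A \<in> sets borel} \<subseteq> sets F"
      using measurable_sets[OF XF] spF by (auto intro!: sets.sigma_sets_subset[of _ F, unfolded spF])
    have sY: "sigma_sets (space D) {Y -` A \<inter> space D | A. A \<in> sets borel} \<subseteq> sets F'"
      using measurable_sets[OF YF] spF by (auto intro!: sets.sigma_sets_subset[of _ F', unfolded spF])
    have ev: "sets F \<subseteq> events" "sets F' \<subseteq> events"
      using indep_sets_def ind unfolding indep_set_def indep_sets_def by (auto simp: UNIV_bool)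
    show "indep_set (sigma_sets (space D) {X -` A \<inter> space D | A. A \<in> sets borel})
        (sigma_sets (space D) {Y -` A \<inter> space D | A. A \<in> sets borel})"
      using sX sY ev indep_setD[OF ind] by (intro indep_setI) blast+
  qed
  then have "(\<integral>z. X z * Y z \<partial>D) = (\<integral>z. X z \<partial>D) * (\<integral>z. Y z \<partial>D)"
    using Xm Ym by (intro indep_var_lebesgue_integral) auto
  also have "(\<integral>z. X z \<partial>D) = volume R' a b"
    unfolding X_def using integral_box_indicator[OF Rd(2)] prob_box[OF Rd(2) ub] by simp
  also have "(\<integral>z. Y z \<partial>D) = response R a b" by (simp add: Y_def response_def)
  also have "(\<integral>z. X z * Y z \<partial>D) = response (R \<union> R') a b"
    unfolding response_def X_def Y_def
    by (intro Bochner_Integration.integral_cong) (auto simp: indicator_def in_box_def)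
  finally show ?thesis by simp
qed

lemma response_regression:
  assumes "R \<subseteq> {..<d}"
  shows "response R a b = (\<integral>z. f (fst z) * indicator {z. in_box R a b (fst z)} z \<partial>D)"
proof -
  define h where "h x = (indicator {x. in_box R a b x} x :: real)" for x
  have hm: "h \<in> borel_measurable (point_space {..<d})"
    unfolding h_def using assms finite_subset[OF assms]
    by (intro borel_measurable_in_box[where g = "\<lambda>x. x"] measurable_coordinate) auto
  have hz: "h (fst z) = indicator {z. in_box R a b (fst z)} z" for z :: "point \<times> real"
    by (simp add: h_def indicator_def)
  have int: "integrable D (\<lambda>z. h (fst z) * snd z)"
    using integrable_response[OF assms] by (simp add: hz mult.commute)
  show ?thesis
    using cond_mean_version_integral(2)[where P = D and Z = fst and W = snd and h = h,
        OF prob_space_axioms measurable_fst_D measurable_snd_D regression hm int]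
    by (simp add: hz response_def mult.commute)
qed

lemma others_law:
  assumes j: "j < d" and C: "C \<in> sets (point_space ({..<d} - {j}))" and A: "A \<in> sets borel"
  shows "emeasure D {z \<in> space D. others d j (fst z) \<in> C \<and> fst z j \<in> A} =
    emeasure (PiM ({..<d} - {j}) (\<lambda>_. unit_law)) C * emeasure unit_law A"
proof -
  let ?I = "{..<d} - {j}"
  interpret U: product_prob_space "\<lambda>_::nat. unit_law" ?I
    by (intro product_prob_spaceI prob_space_unit_law)
  have ins: "insert j ?I = {..<d}" using j by auto
  define E where "E = {x \<in> space (point_space {..<d}). restrict x ?I \<in> C \<and> x j \<in> A}"
  have E: "E \<in> sets (point_space {..<d})"
  proof -
    have "(\<lambda>x. restrict x ?I) \<in> measurable (point_space {..<d}) (point_space ?I)"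
      unfolding point_space_def by (rule measurable_restrict_subset) auto
    moreover have "(\<lambda>x. x j) \<in> borel_measurable (point_space {..<d})"
      using j by (rule measurable_coordinate)
    ultimately have "((\<lambda>x. restrict x ?I) -` C \<inter> space (point_space {..<d})) \<inter>
        ((\<lambda>x. x j) -` A \<inter> space (point_space {..<d})) \<in> sets (point_space {..<d})"
      using C A by (intro sets.Int measurable_sets) auto
    also have "((\<lambda>x. restrict x ?I) -` C \<inter> space (point_space {..<d})) \<inter>
        ((\<lambda>x. x j) -` A \<inter> space (point_space {..<d})) = E" by (auto simp: E_def)
    finally show ?thesis .
  qed
  have C': "C \<in> sets (PiM ?I (\<lambda>_. unit_law))" using C sets_point_space_PiM by blast
  have E': "E \<in> sets (PiM (insert j ?I) (\<lambda>_. unit_law))" using E sets_point_space_PiM ins by metis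
  have "{z \<in> space D. others d j (fst z) \<in> C \<and> fst z j \<in> A} = fst -` E \<inter> space D"
    using measurable_space[OF measurable_fst_D] by (auto simp: E_def others_def)
  then have "emeasure D {z \<in> space D. others d j (fst z) \<in> C \<and> fst z j \<in> A} =
      emeasure (PiM (insert j ?I) (\<lambda>_. unit_law)) E"
    using emeasure_distr[OF measurable_fst_D E] law ins by simp
  also have "\<dots> = (\<integral>\<^sup>+x. indicator E x \<partial>PiM (insert j ?I) (\<lambda>_. unit_law))"
    using E' by simp
  also have "\<dots> = (\<integral>\<^sup>+x. (\<integral>\<^sup>+y. indicator E (x(j := y)) \<partial>unit_law) \<partial>PiM ?I (\<lambda>_. unit_law))"
    using E' by (intro U.product_nn_integral_insert borel_measurable_indicator) auto
  also have "\<dots> = (\<integral>\<^sup>+x. (\<integral>\<^sup>+y. indicator C x * indicator A y \<partial>unit_law) \<partial>PiM ?I (\<lambda>_. unit_law))"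
  proof (intro nn_integral_cong)
    fix x y assume "x \<in> space (PiM ?I (\<lambda>_. unit_law))"
    then have x: "x \<in> extensional ?I" by (auto simp: space_PiM PiE_def)
    then have "restrict (x(j := y)) ?I = x" by (auto simp: extensional_def restrict_def fun_eq_iff)
    moreover have "x(j := y) \<in> space (point_space {..<d})"
      using x j by (auto simp: point_space_def space_PiM PiE_def extensional_def)
    ultimately show "indicator E (x(j := y)) = (indicator C x * indicator A y :: ennreal)"
      by (auto simp: E_def indicator_def)
  qed
  also have "\<dots> = emeasure (PiM ?I (\<lambda>_. unit_law)) C * emeasure unit_law A"
    using C' A by (simp add: nn_integral_cmult nn_integral_multc)
  finally show ?thesis .
qed

text \<open>
  Conditioning on the half \<open>A\<close> of coordinate \<open>j\<close> does not change the law of the other coordinates. Both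
  conditional means in the monotonicity assumption are therefore integrated against the same product
  law and can be compared pointwise.
\<close>

lemma half_response:
  assumes j: "j < d" and A: "A \<in> sets borel" "emeasure unit_law A = ennreal (1 / 2)"
    and R: "R \<subseteq> {..<d} - {j}"
    and g: "cond_mean_version (uniform_measure D {z \<in> space D. fst z j \<in> A})
              (\<lambda>z. others d j (fst z)) (point_space ({..<d} - {j})) snd g"
  shows "integrable (PiM ({..<d} - {j}) (\<lambda>_. unit_law)) (\<lambda>y. indicator {y. in_box R a b y} y * g y)"
    and "(\<integral>z. snd z * indicator {z. in_box R a b (fst z) \<and> fst z j \<in> A} z \<partial>D) =
      1 / 2 * (\<integral>y. indicator {y. in_box R a b y} y * g y \<partial>PiM ({..<d} - {j}) (\<lambda>_. unit_law))"
proof -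
  let ?I = "{..<d} - {j}"
  let ?\<nu> = "PiM ?I (\<lambda>_. unit_law)"
  define H where "H = {z \<in> space D. fst z j \<in> A}"
  define P' where "P' = uniform_measure D H"
  define Z where "Z = (\<lambda>z::point \<times> real. others d j (fst z))"
  have H: "H \<in> sets D"
    using measurable_sets[OF measurable_fst_coordinate[OF j] A(1)]
    by (simp add: H_def vimage_def Int_def conj_commute)
  interpret \<nu>: prob_space ?\<nu> by (intro prob_space_PiM prob_space_unit_law)
  have spI: "space ?\<nu> = space (point_space ?I)" by (rule sets_eq_imp_space_eq[OF sets_point_space_PiM[symmetric]])
  have Zm: "Z \<in> measurable D (point_space ?I)"
    unfolding Z_def others_def
    by (rule measurable_compose[OF measurable_fst_D], unfold point_space_def, rule measurable_restrict_subset) auto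
  have Hm: "emeasure D H = ennreal (1 / 2)"
  proof -
    have "H = {z \<in> space D. others d j (fst z) \<in> space (point_space ?I) \<and> fst z j \<in> A}"
      using measurable_space[OF Zm] by (auto simp: H_def Z_def)
    then show ?thesis
      using others_law[OF j sets.top A(1)] A(2) \<nu>.emeasure_space_1 spI by simp
  qed
  have P': "prob_space P'" unfolding P'_def by (rule prob_space_uniform_measure) (simp_all add: Hm)
  have mP: "measurable P' N = measurable D N" for N
    unfolding P'_def by (rule measurable_cong_sets) simp_all
  have distr: "distr P' (point_space ?I) Z = ?\<nu>"
  proof (rule measure_eqI)
    show "sets (distr P' (point_space ?I) Z) = sets ?\<nu>" using sets_point_space_PiM by simp
    fix C assume "C \<in> sets (distr P' (point_space ?I) Z)"
    then have C: "C \<in> sets (point_space ?I)" by simp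
    have "emeasure (distr P' (point_space ?I) Z) C = emeasure P' (Z -` C \<inter> space D)"
      using C Zm by (subst emeasure_distr) (simp_all add: mP, simp add: P'_def)
    also have "\<dots> = emeasure D (H \<inter> (Z -` C \<inter> space D)) / emeasure D H"
      unfolding P'_def using measurable_sets[OF Zm C] H by (subst emeasure_uniform_measure) auto
    also have "H \<inter> (Z -` C \<inter> space D) = {z \<in> space D. others d j (fst z) \<in> C \<and> fst z j \<in> A}"
      by (auto simp: H_def Z_def)
    also have "emeasure D \<dots> / emeasure D H = emeasure ?\<nu> C"
      unfolding others_law[OF j C A(1)] Hm A(2) by (rule ennreal_mult_divide_eq) auto
    finally show "emeasure (distr P' (point_space ?I) Z) C = emeasure ?\<nu> C" .
  qed
  define h where "h y = (indicator {y. in_box R a b y} y :: real)" for y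
  have hm: "h \<in> borel_measurable (point_space ?I)"
    unfolding h_def point_space_def using R finite_subset[OF R]
    by (intro borel_measurable_in_box[where g = "\<lambda>x. x"] measurable_component_singleton) auto
  have hZ: "h (Z z) = indicator {z. in_box R a b (fst z)} z" for z
  proof -
    have "in_box R a b (others d j (fst z)) = in_box R a b (fst z)"
      unfolding in_box_def others_def using R by (intro ball_cong) auto
    then show ?thesis by (simp add: h_def Z_def indicator_def)
  qed
  have hZm: "(\<lambda>z. h (Z z)) \<in> borel_measurable D" by (rule measurable_compose[OF Zm hm])
  have gm: "g \<in> borel_measurable (point_space ?I)" using g by (simp add: cond_mean_version_def)
  have dens: "P' = density D (\<lambda>z. ennreal (2 * indicator H z))"
  proof -
    have "indicator H z / ennreal (1 / 2) = ennreal (2 * indicator H z)" for z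
    proof (cases "z \<in> H")
      case True
      have "(1::ennreal) / ennreal (1 / 2) = ennreal (1 / (1 / 2))"
        by (subst divide_ennreal[symmetric]) auto
      then show ?thesis using True by simp
    qed simp
    then show ?thesis unfolding P'_def uniform_measure_def Hm by simp
  qed
  have int: "integrable P' (\<lambda>z. h (Z z) * snd z)"
  proof -
    interpret P': prob_space P' by fact
    have "AE z in P'. norm (h (Z z) * snd z) \<le> M"
      unfolding P'_def
    proof (rule AE_uniform_measureI[OF H])
      show "AE z in D. z \<in> H \<longrightarrow> norm (h (Z z) * snd z) \<le> M"
        using bounded by eventually_elim (use M_pos in \<open>auto simp: h_def indicator_def\<close>)
    qed
    then show ?thesis
      using hZm by (intro P'.integrable_const_bound[of _ M]) (auto simp: mP)
  qed
  have gP: "cond_mean_version P' Z (point_space ?I) snd g"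
    using g by (simp add: P'_def H_def Z_def[abs_def])
  have ZP: "Z \<in> measurable P' (point_space ?I)" "snd \<in> borel_measurable P'"
    using Zm by (simp_all add: mP)
  note c = cond_mean_version_integral[where W = snd and h = h, OF P' ZP gP hm int]
  have hgm: "(\<lambda>y. h y * g y) \<in> borel_measurable (point_space ?I)" using hm gm by simp
  show "integrable ?\<nu> (\<lambda>y. indicator {y. in_box R a b y} y * g y)"
    using c(1) integrable_distr_eq[OF ZP(1) hgm] unfolding distr h_def by simp
  have "(\<integral>y. h y * g y \<partial>?\<nu>) = (\<integral>z. h (Z z) * g (Z z) \<partial>P')"
    unfolding distr[symmetric] by (rule integral_distr[OF ZP(1) hgm])
  also have "\<dots> = (\<integral>z. h (Z z) * snd z \<partial>P')" by (rule c(2))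
  also have "\<dots> = (\<integral>z. (2 * indicator H z) *\<^sub>R (h (Z z) * snd z) \<partial>D)"
    unfolding dens using H hZm by (intro integral_density) auto
  also have "\<dots> = (\<integral>z. 2 * (snd z * indicator {z. in_box R a b (fst z) \<and> fst z j \<in> A} z) \<partial>D)"
    by (intro Bochner_Integration.integral_cong refl) (auto simp: hZ H_def indicator_def)
  finally show "(\<integral>z. snd z * indicator {z. in_box R a b (fst z) \<and> fst z j \<in> A} z \<partial>D) =
      1 / 2 * (\<integral>y. indicator {y. in_box R a b y} y * g y \<partial>?\<nu>)"
    by (simp add: h_def)
qed

lemma response_insert:
  assumes R: "insert j R \<subseteq> {..<d}" "R \<subseteq> {..<d}" "j \<notin> R" and A: "A \<in> sets borel"
    and ce: "\<And>t. 0 < t \<Longrightarrow> t \<le> 1 \<Longrightarrow> c < t \<and> t \<le> e \<longleftrightarrow> t \<in> A"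
  shows "response (insert j R) (a(j := c)) (b(j := e)) =
    (\<integral>z. snd z * indicator {z. in_box R a b (fst z) \<and> fst z j \<in> A} z \<partial>D)"
  unfolding response_def
proof (rule integral_cong_AE)
  have jd: "j < d" using R by auto
  show "(\<lambda>z. snd z * indicator {z. in_box (insert j R) (a(j := c)) (b(j := e)) (fst z)} z) \<in> borel_measurable D"
    using box_indicator_measurable[OF R(1)] by measurable
  have "{z \<in> space D. in_box R a b (fst z)} \<inter> ((\<lambda>z. fst z j) -` A \<inter> space D) \<in> sets D"
    using measurable_in_box[OF R(2)] measurable_sets[OF measurable_fst_coordinate[OF jd] A] by (rule sets.Int)
  then have "(\<lambda>z. indicator {z. in_box R a b (fst z) \<and> fst z j \<in> A} z :: real) \<in> borel_measurable D"
    by (subst borel_measurable_indicator_iff) (simp add: Int_def vimage_def conj_ac cong: conj_cong)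
  then show "(\<lambda>z. snd z * indicator {z. in_box R a b (fst z) \<and> fst z j \<in> A} z) \<in> borel_measurable D"
    by measurable
  show "AE z in D. snd z * indicator {z. in_box (insert j R) (a(j := c)) (b(j := e)) (fst z)} z =
      snd z * indicator {z. in_box R a b (fst z) \<and> fst z j \<in> A} z"
    using AE_pos_cube
  proof eventually_elim
    fix z :: "point \<times> real" assume "fst z \<in> pos_cube d"
    then have "in_box (insert j R) (a(j := c)) (b(j := e)) (fst z) \<longleftrightarrow> in_box R a b (fst z) \<and> fst z j \<in> A"
      using pos_cubeD[of "fst z" d j] jd ce[of "fst z j"] R(3) by (simp add: in_box_insert)
    then show "snd z * indicator {z. in_box (insert j R) (a(j := c)) (b(j := e)) (fst z)} z =
        snd z * indicator {z. in_box R a b (fst z) \<and> fst z j \<in> A} z"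
      by (simp add: indicator_def)
  qed
qed

text \<open>
  The monotonicity assumption integrated over a box that leaves coordinate \<open>j\<close> free.
\<close>

lemma signal_effect:
  assumes j: "j \<in> Q" and R: "R \<subseteq> {..<d} - {j}" and ub: "unit_box R a b"
  shows "\<beta> / 2 * volume R a b \<le> \<sigma> j *
    (response (insert j R) (a(j := 1 / 2)) (b(j := 1)) - response (insert j R) (a(j := 0)) (b(j := 1 / 2)))"
proof -
  let ?I = "{..<d} - {j}"
  let ?\<nu> = "PiM ?I (\<lambda>_. unit_law)"
  have jd: "j < d" using j Q_subset by auto
  have jR: "j \<notin> R" using R by auto
  obtain ga gb where g: "cond_mean_version (uniform_measure D {z \<in> space D. fst z j > 1 / 2})
              (\<lambda>z. others d j (fst z)) (point_space ?I) snd ga"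
      "cond_mean_version (uniform_measure D {z \<in> space D. fst z j \<le> 1 / 2})
              (\<lambda>z. others d j (fst z)) (point_space ?I) snd gb"
    and diff: "\<And>x. x \<in> cube d \<Longrightarrow> \<sigma> j * (ga (others d j x) - gb (others d j x)) \<ge> \<beta>"
    using monotone[OF j] by blast
  have "{0..1} \<inter> {1 / 2<..} = {1 / 2<..1 :: real}" "{0..1} \<inter> {..1 / 2} = {0..1 / 2 :: real}" by auto
  then have A: "emeasure unit_law {1 / 2<..} = ennreal (1 / 2)" "emeasure unit_law {..1 / 2} = ennreal (1 / 2)"
    by (simp_all add: emeasure_unit_law)
  have g': "cond_mean_version (uniform_measure D {z \<in> space D. fst z j \<in> {1 / 2<..}})
              (\<lambda>z. others d j (fst z)) (point_space ?I) snd ga"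
    "cond_mean_version (uniform_measure D {z \<in> space D. fst z j \<in> {..1 / 2}})
              (\<lambda>z. others d j (fst z)) (point_space ?I) snd gb"
    using g by simp_all
  note ha = half_response[OF jd _ A(1) R g'(1), of a b] and hb = half_response[OF jd _ A(2) R g'(2), of a b]
  define h where "h y = (indicator {y. in_box R a b y} y :: real)" for y
  have Rd: "insert j R \<subseteq> {..<d}" "R \<subseteq> {..<d}" using R jd by auto
  have ra: "response (insert j R) (a(j := 1 / 2)) (b(j := 1)) = 1 / 2 * (\<integral>y. h y * ga y \<partial>?\<nu>)"
    by (subst response_insert[OF Rd jR, of "{1 / 2<..}"]) (use ha(2) in \<open>auto simp: h_def\<close>)
  have rb: "response (insert j R) (a(j := 0)) (b(j := 1 / 2)) = 1 / 2 * (\<integral>y. h y * gb y \<partial>?\<nu>)"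
    by (subst response_insert[OF Rd jR, of "{..1 / 2}"]) (use hb(2) in \<open>auto simp: h_def\<close>)
  have int: "integrable ?\<nu> (\<lambda>y. h y * ga y)" "integrable ?\<nu> (\<lambda>y. h y * gb y)"
    using ha(1) hb(1) by (simp_all add: h_def)
  interpret \<nu>: prob_space ?\<nu> by (intro prob_space_PiM prob_space_unit_law)
  have spI: "space ?\<nu> = space (point_space ?I)" by (rule sets_eq_imp_space_eq[OF sets_point_space_PiM[symmetric]])
  define B where "B = {y \<in> space (point_space ?I). in_box R a b y}"
  have B: "B \<in> sets (point_space ?I)"
    unfolding B_def point_space_def using R finite_subset[OF R]
    by (intro sets_Collect_in_box[where g = "\<lambda>x. x"] measurable_component_singleton) auto
  then have B': "B \<in> sets ?\<nu>" using sets_point_space_PiM by blast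
  have vB: "\<nu>.prob B = volume R a b"
  proof -
    have "space D \<subseteq> {z. others d j (fst z) \<in> space (point_space ?I)}"
      by (auto simp: others_def point_space_def space_PiM)
    moreover have "in_box R a b (others d j x) = in_box R a b x" for x
      unfolding in_box_def others_def using R by (intro ball_cong) auto
    ultimately have "{z \<in> space D. others d j (fst z) \<in> B \<and> fst z j \<in> UNIV} = {z \<in> space D. in_box R a b (fst z)}"
      by (auto simp: B_def)
    moreover have "emeasure unit_law UNIV = 1"
      using prob_space.emeasure_space_1[OF prob_space_unit_law] by (simp add: unit_law_def)
    ultimately have "emeasure ?\<nu> B = emeasure D {z \<in> space D. in_box R a b (fst z)}"
      using others_law[OF jd B, of UNIV] by simp
    then show ?thesis using prob_box[OF Rd(2) ub] by (simp add: measure_def)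
  qed
  have unit: "AE y in ?\<nu>. \<forall>i\<in>?I. y i \<in> {0..1}"
  proof -
    interpret U: product_prob_space "\<lambda>_::nat. unit_law" ?I
      by (intro product_prob_spaceI prob_space_unit_law)
    have "AE y in unit_law. y \<in> {0..1}"
      unfolding unit_law_def by (rule AE_uniform_measureI) auto
    then have "AE y in ?\<nu>. y i \<in> {0..1}" if "i \<in> ?I" for i
      using that by (intro U.AE_component) auto
    then show ?thesis by (intro AE_finite_allI) auto
  qed
  have hB: "integrable ?\<nu> (\<lambda>y. \<beta> * indicator B y)"
    using B' by (intro integrable_mult_right integrable_real_indicator) (auto simp: \<nu>.emeasure_eq_measure)
  have "\<beta> * volume R a b = (\<integral>y. \<beta> * indicator B y \<partial>?\<nu>)" using B' vB by simp
  also have "\<dots> \<le> (\<integral>y. \<sigma> j * (h y * ga y - h y * gb y) \<partial>?\<nu>)"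
  proof (rule integral_mono_AE[OF hB])
    show "integrable ?\<nu> (\<lambda>y. \<sigma> j * (h y * ga y - h y * gb y))" using int by simp
    show "AE y in ?\<nu>. \<beta> * indicator B y \<le> \<sigma> j * (h y * ga y - h y * gb y)"
      using unit AE_space
    proof eventually_elim
      fix y assume y: "\<forall>i\<in>?I. y i \<in> {0..1}" "y \<in> space ?\<nu>"
      then have ext: "y \<in> extensional ?I" by (auto simp: space_PiM PiE_def)
      define x where "x = y(j := 1 / 2)"
      have "x \<in> cube d" using y ext jd by (auto simp: x_def cube_def PiE_def extensional_def)
      moreover have "others d j x = y"
        using ext by (auto simp: others_def x_def extensional_def restrict_def fun_eq_iff)
      ultimately have "\<beta> \<le> \<sigma> j * (ga y - gb y)" using diff[of x] by simp
      moreover have "h y = indicator B y" using y spI by (simp add: h_def B_def indicator_def)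
      ultimately show "\<beta> * indicator B y \<le> \<sigma> j * (h y * ga y - h y * gb y)"
        by (simp add: indicator_def)
    qed
  qed
  also have "\<dots> = \<sigma> j * ((\<integral>y. h y * ga y \<partial>?\<nu>) - (\<integral>y. h y * gb y \<partial>?\<nu>))"
    using int by simp
  finally show ?thesis unfolding ra rb by (simp add: field_simps)
qed

text \<open>
  A continuous function is the limit of its averages over shrinking boxes, here with the rate given by the
  Lipschitz condition.
\<close>

lemma response_near_value:
  assumes x: "x \<in> pos_cube d" and h: "h > 0" "\<And>j. j < d \<Longrightarrow> h \<le> x j"
  shows "\<bar>response {..<d} (\<lambda>j. x j - h) x - f x * h ^ d\<bar> \<le> \<bar>L\<bar> * (real d * h) * h ^ d"
proof -
  let ?B = "\<lambda>z::point \<times> real. indicator {z. in_box {..<d} (\<lambda>j. x j - h) x (fst z)} z :: real"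
  have ub: "unit_box {..<d} (\<lambda>j. x j - h) x"
    using h pos_cubeD[OF x] by (auto simp: unit_box_def)
  have vol: "volume {..<d} (\<lambda>j. x j - h) x = h ^ d" by (simp add: volume_def)
  have pB: "(\<integral>z. ?B z \<partial>D) = h ^ d"
    using integral_box_indicator[OF order_refl] prob_box[OF order_refl ub] vol by simp
  have iB: "integrable D ?B" by (rule integrable_box_indicator) simp
  have ifB: "integrable D (\<lambda>z. f (fst z) * ?B z)"
  proof (rule integrable_const_bound[of _ M])
    show "AE z in D. norm (f (fst z) * ?B z) \<le> M"
      using regression_bounded by eventually_elim (use M_pos in \<open>auto simp: indicator_def\<close>)
  qed (use box_indicator_measurable[OF order_refl] in measurable)
  define F where "F z = f (fst z) * ?B z - f x * ?B z" for z
  have iF: "integrable D F"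
    unfolding F_def by (rule Bochner_Integration.integrable_diff[OF ifB integrable_mult_right[OF iB]])
  have "response {..<d} (\<lambda>j. x j - h) x - f x * h ^ d = (\<integral>z. F z \<partial>D)"
  proof -
    have "(\<integral>z. F z \<partial>D) = (\<integral>z. f (fst z) * ?B z \<partial>D) - (\<integral>z. f x * ?B z \<partial>D)"
      unfolding F_def by (rule Bochner_Integration.integral_diff[OF ifB integrable_mult_right[OF iB]])
    also have "(\<integral>z. f x * ?B z \<partial>D) = f x * h ^ d"
      by (simp only: integral_mult_right_zero pB)
    finally show ?thesis by (simp only: response_regression[OF order_refl])
  qed
  then have "\<bar>response {..<d} (\<lambda>j. x j - h) x - f x * h ^ d\<bar> \<le> (\<integral>z. \<bar>F z\<bar> \<partial>D)"
    using integral_abs_bound[of D F] by simp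
  also have "\<dots> \<le> (\<integral>z. \<bar>L\<bar> * (real d * h) * ?B z \<partial>D)"
  proof (rule integral_mono_AE)
    show "AE z in D. \<bar>F z\<bar> \<le> \<bar>L\<bar> * (real d * h) * ?B z"
      using AE_pos_cube
    proof eventually_elim
      fix z :: "point \<times> real" assume z: "fst z \<in> pos_cube d"
      show "\<bar>F z\<bar> \<le> \<bar>L\<bar> * (real d * h) * ?B z"
      proof (cases "in_box {..<d} (\<lambda>j. x j - h) x (fst z)")
        case True
        have "L2_set (\<lambda>j. fst z j - x j) {..<d} \<le> (\<Sum>j<d. \<bar>fst z j - x j\<bar>)" by (rule L2_set_le_sum_abs)
        also have "\<dots> \<le> (\<Sum>j<d. h)"
        proof (rule sum_mono)
          fix j assume "j \<in> {..<d}"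
          then have "x j - h < fst z j" "fst z j \<le> x j" using True by (auto simp: in_box_def)
          then show "\<bar>fst z j - x j\<bar> \<le> h" by linarith
        qed
        finally have "L2_set (\<lambda>j. fst z j - x j) {..<d} \<le> real d * h" by simp
        then have "\<bar>L\<bar> * L2_set (\<lambda>j. fst z j - x j) {..<d} \<le> \<bar>L\<bar> * (real d * h)"
          by (intro mult_left_mono) auto
        moreover have "L * L2_set (\<lambda>j. fst z j - x j) {..<d} \<le> \<bar>L\<bar> * L2_set (\<lambda>j. fst z j - x j) {..<d}"
          by (intro mult_right_mono L2_set_nonneg) auto
        moreover have "\<bar>f (fst z) - f x\<bar> \<le> L * L2_set (\<lambda>j. fst z j - x j) {..<d}"
          using z x pos_cube_subset by (intro lipschitz) auto
        ultimately have "\<bar>f (fst z) - f x\<bar> \<le> \<bar>L\<bar> * (real d * h)" by linarith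
        then show ?thesis using True by (simp add: F_def)
      qed (simp add: F_def)
    qed
    show "integrable D (\<lambda>z. \<bar>F z\<bar>)" using iF by (rule integrable_abs)
    show "integrable D (\<lambda>z. \<bar>L\<bar> * (real d * h) * ?B z)" using iB by (rule integrable_mult_right)
  qed
  also have "\<dots> = \<bar>L\<bar> * (real d * h) * h ^ d" by (simp only: integral_mult_right_zero pB)
  finally show ?thesis .
qed

text \<open>
  Boxes around two points with the same signal coordinates have the same integrated response by
  \<open>noise_box\<close>. Shrinking the boxes turns this into equality of values, with no exceptional set, because the
  function is continuous.
\<close>

lemma regression_sparse:
  assumes x: "x \<in> pos_cube d" and y: "y \<in> pos_cube d" and eq: "\<And>j. j \<in> Q \<Longrightarrow> x j = y j"
  shows "f x = f y"
proof (rule ccontr)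
  assume ne: "f x \<noteq> f y"
  define m where "m = Min (insert 1 (x ` {..<d} \<union> y ` {..<d}))"
  have m: "m > 0" "\<And>j. j < d \<Longrightarrow> m \<le> x j \<and> m \<le> y j"
    unfolding m_def using pos_cubeD[OF x] pos_cubeD[OF y] by (auto intro!: Min_le)
  define C where "C = 2 * \<bar>L\<bar> * real d"
  have C: "C \<ge> 0" by (simp add: C_def)
  \<comment> \<open>Small enough for the boxes to stay in the cube and for the Lipschitz error \<open>C * h\<close> to be below the gap.\<close>
  define h where "h = min m (\<bar>f x - f y\<bar> / (C + 1))"
  have h: "h > 0" "h \<le> m" "h \<le> \<bar>f x - f y\<bar> / (C + 1)" using m ne C by (auto simp: h_def)
  \<comment> \<open>The noise sides contribute the same factor at both points.\<close>
  have R: "response {..<d} (\<lambda>j. w j - h) w = response Q (\<lambda>j. w j - h) w * h ^ card ({..<d} - Q)"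
    if "w = x \<or> w = y" for w
  proof -
    have ub: "unit_box ({..<d} - Q) (\<lambda>j. w j - h) w"
      using that h m pos_cubeD[OF x] pos_cubeD[OF y] by (fastforce simp: unit_box_def)
    have "Q \<union> ({..<d} - Q) = {..<d}" using Q_subset by auto
    then show ?thesis using noise_box[OF order_refl order_refl ub] by (simp add: volume_def)
  qed
  have "response Q (\<lambda>j. x j - h) x = response Q (\<lambda>j. y j - h) y"
    unfolding response_def using eq by (simp add: in_box_def)
  then have "response {..<d} (\<lambda>j. x j - h) x = response {..<d} (\<lambda>j. y j - h) y" using R by simp
  moreover have "\<bar>response {..<d} (\<lambda>j. x j - h) x - f x * h ^ d\<bar> \<le> \<bar>L\<bar> * (real d * h) * h ^ d"
    using h m by (intro response_near_value[OF x]) (auto intro: order_trans)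
  moreover have "\<bar>response {..<d} (\<lambda>j. y j - h) y - f y * h ^ d\<bar> \<le> \<bar>L\<bar> * (real d * h) * h ^ d"
    using h m by (intro response_near_value[OF y]) (auto intro: order_trans)
  ultimately have "\<bar>f x * h ^ d - f y * h ^ d\<bar> \<le> 2 * (\<bar>L\<bar> * (real d * h) * h ^ d)" by linarith
  then have "\<bar>f x - f y\<bar> * h ^ d \<le> (C * h) * h ^ d"
    using h by (simp add: C_def left_diff_distrib[symmetric] abs_mult mult.assoc)
  then have "\<bar>f x - f y\<bar> \<le> C * h" using h by simp
  also have "\<dots> < (C + 1) * h" using h by simp
  also have "\<dots> \<le> \<bar>f x - f y\<bar>" using h C by (simp add: field_simps)
  finally show False by simp
qed

lemma lipschitz_signal:
  assumes x: "x \<in> pos_cube d" and y: "y \<in> pos_cube d"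
  shows "\<bar>f x - f y\<bar> \<le> L * L2_set (\<lambda>j. x j - y j) Q"
proof -
  \<comment> \<open>Moving the noise coordinates of \<open>y\<close> to those of \<open>x\<close> does not change the value of the regression function.\<close>
  define y' where "y' = (\<lambda>j\<in>{..<d}. if j \<in> Q then y j else x j)"
  have y': "y' \<in> pos_cube d" using x y by (auto simp: y'_def pos_cube_def PiE_def Pi_def)
  have "f y = f y'" using Q_subset by (intro regression_sparse[OF y y']) (auto simp: y'_def)
  then have "\<bar>f x - f y\<bar> \<le> L * L2_set (\<lambda>j. x j - y' j) {..<d}"
    using lipschitz[of x y'] x y' pos_cube_subset by auto
  also have "L2_set (\<lambda>j. x j - y' j) {..<d} = L2_set (\<lambda>j. x j - y j) Q"
  proof -
    have "(\<Sum>j<d. (x j - y' j)\<^sup>2) = (\<Sum>j\<in>Q. (x j - y' j)\<^sup>2)"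
      using Q_subset by (intro sum.mono_neutral_right) (auto simp: y'_def)
    also have "\<dots> = (\<Sum>j\<in>Q. (x j - y j)\<^sup>2)"
      using Q_subset by (intro sum.cong) (auto simp: y'_def)
    finally show ?thesis by (simp add: L2_set_def)
  qed
  finally show ?thesis .
qed

end

section \<open>Concentration over boxes\<close>

text \<open>
  For negative \<open>x\<close> this is \<open>1 \<le> (1 - x) * (1 + x + x\<^sup>2) = 1 - x ^ 3\<close> together with \<open>1 - x \<le> exp (- x)\<close>.
\<close>

lemma exp_le_quadratic:
  fixes x :: real
  assumes "\<bar>x\<bar> \<le> 1"
  shows "exp x \<le> 1 + x + x\<^sup>2"
proof (cases "x \<ge> 0")
  case True
  then show ?thesis using assms exp_bound[of x] by simp
next
  case False
  then have "x\<^sup>2 * x \<le> 0" by (intro mult_nonneg_nonpos) auto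
  then have "1 \<le> (1 + x + x\<^sup>2) * (1 - x)" by (simp add: algebra_simps power2_eq_square)
  also have "\<dots> \<le> (1 + x + x\<^sup>2) * exp (- x)"
  proof (rule mult_left_mono)
    show "1 - x \<le> exp (- x)" using exp_ge_add_one_self[of "- x"] by simp
    show "0 \<le> 1 + x + x\<^sup>2" using assms by (simp add: abs_le_iff)
  qed
  finally have "exp x \<le> (1 + x + x\<^sup>2) * exp (- x) * exp x"
    by (metis exp_ge_zero mult_1 mult_right_mono)
  then show ?thesis by (simp add: mult.assoc exp_minus_inverse flip: exp_add)
qed

lemma volume_diff:
  assumes "finite R" and "\<And>j. j \<in> R \<Longrightarrow> \<bar>b j - a j\<bar> \<le> 1" "\<And>j. j \<in> R \<Longrightarrow> \<bar>b' j - a' j\<bar> \<le> 1"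
    and "\<And>j. j \<in> R \<Longrightarrow> \<bar>(b' j - a' j) - (b j - a j)\<bar> \<le> e"
  shows "\<bar>volume R a' b' - volume R a b\<bar> \<le> real (card R) * e"
proof -
  have "\<bar>volume R a' b' - volume R a b\<bar> \<le> (\<Sum>j\<in>R. \<bar>(b' j - a' j) - (b j - a j)\<bar>)"
    unfolding volume_def
    using norm_prod_diff[of R "\<lambda>j. b' j - a' j" "\<lambda>j. b j - a j"] assms by simp
  also have "\<dots> \<le> (\<Sum>j\<in>R. e)" by (intro sum_mono assms)
  finally show ?thesis by simp
qed

definition box_count :: "nat \<Rightarrow> nat set \<Rightarrow> point \<Rightarrow> point \<Rightarrow> sample \<Rightarrow> real" where
  "box_count n R a b S = (\<Sum>i<n. indicator {z. in_box R a b (fst z)} (S i))"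

definition box_sum :: "nat \<Rightarrow> nat set \<Rightarrow> point \<Rightarrow> point \<Rightarrow> sample \<Rightarrow> real" where
  "box_sum n R a b S = (\<Sum>i<n. snd (S i) * indicator {z. in_box R a b (fst z)} (S i))"

lemma box_count_card: "box_count n R a b S = real (card {i. i < n \<and> in_box R a b (fst (S i))})"
proof -
  have "{..<n} \<inter> {i. in_box R a b (fst (S i))} = {i. i < n \<and> in_box R a b (fst (S i))}" by auto
  then show ?thesis by (simp add: box_count_def indicator_def sum.If_cases)
qed

lemma box_sum_sum: "box_sum n R a b S = (\<Sum>i | i < n \<and> in_box R a b (fst (S i)). snd (S i))"
proof -
  have "{..<n} \<inter> {i. in_box R a b (fst (S i))} = {i. i < n \<and> in_box R a b (fst (S i))}" by auto
  then show ?thesis by (simp add: box_sum_def indicator_def if_distrib[of "(*) _"] sum.If_cases cong: if_cong)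
qed

lemma in_box_mono:
  "in_box R a b x \<Longrightarrow> (\<And>j. j \<in> R \<Longrightarrow> a' j \<le> a j \<and> b j \<le> b' j) \<Longrightarrow> in_box R a' b' x"
  unfolding in_box_def by force

context sparse_model
begin

text \<open>
  Deviations are measured relative to the expected count, but never below the leaf size \<open>k\<close>: boxes that
  hold fewer than \<open>k\<close> examples do not matter.
\<close>

definition concentrated :: "nat \<Rightarrow> nat \<Rightarrow> real \<Rightarrow> nat set \<Rightarrow> sample \<Rightarrow> bool" where
  "concentrated n k \<eta> R S \<longleftrightarrow> (\<forall>a b. unit_box R a b \<longrightarrow>
     \<bar>box_count n R a b S - n * volume R a b\<bar> \<le> \<eta> * max (n * volume R a b) k \<and>
     \<bar>box_sum n R a b S - n * response R a b\<bar> \<le> M * (\<eta> * max (n * volume R a b) k))"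

text \<open>
  The second moment of \<open>W\<close> is at most \<open>C\<^sup>2 * prob B\<close>. Keeping the probability of \<open>B\<close> in the exponent makes the tail
  bound below relative to the expected count.
\<close>

lemma exponential_moment:
  assumes W: "W \<in> borel_measurable D" and B: "B \<in> sets D" and C: "C > 0"
    and bd: "AE z in D. \<bar>W z\<bar> \<le> C * indicator B z" and l: "0 \<le> l" "l * C \<le> 1"
  shows "integrable D (\<lambda>z. exp (l * W z))"
    and "(\<integral>z. exp (l * W z) \<partial>D) \<le> exp (l * (\<integral>z. W z \<partial>D) + l\<^sup>2 * C\<^sup>2 * prob B)"
proof -
  have iW: "integrable D W"
  proof (rule integrable_const_bound[OF _ W])
    show "AE z in D. norm (W z) \<le> C"
      using bd
    proof eventually_elim
      fix z assume "\<bar>W z\<bar> \<le> C * indicator B z"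
      then show "norm (W z) \<le> C" using C by (cases "z \<in> B") auto
    qed
  qed
  have iB: "integrable D (\<lambda>z. indicator B z :: real)"
    using B by (intro integrable_real_indicator) (auto simp: emeasure_eq_measure)
  have ae: "AE z in D. exp (l * W z) \<le> 1 + l * W z + l\<^sup>2 * C\<^sup>2 * indicator B z"
    using bd
  proof eventually_elim
    fix z assume z: "\<bar>W z\<bar> \<le> C * indicator B z"
    have "\<bar>W z\<bar> \<le> C" using z C by (cases "z \<in> B") auto
    then have "\<bar>l * W z\<bar> \<le> 1"
      using l by (simp add: abs_mult) (meson mult_left_mono order_trans)
    then have "exp (l * W z) \<le> 1 + l * W z + (l * W z)\<^sup>2" by (rule exp_le_quadratic)
    also have "(l * W z)\<^sup>2 \<le> l\<^sup>2 * C\<^sup>2 * indicator B z"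
    proof -
      have "(W z)\<^sup>2 \<le> (C * indicator B z)\<^sup>2" using z by (intro abs_le_square_iff[THEN iffD1]) auto
      then have "l\<^sup>2 * (W z)\<^sup>2 \<le> l\<^sup>2 * (C * indicator B z)\<^sup>2" by (intro mult_left_mono) auto
      then show ?thesis by (auto simp: power_mult_distrib indicator_def)
    qed
    finally show "exp (l * W z) \<le> 1 + l * W z + l\<^sup>2 * C\<^sup>2 * indicator B z" by simp
  qed
  have i1: "integrable D (\<lambda>z. 1 + l * W z + l\<^sup>2 * C\<^sup>2 * indicator B z)" using iW iB by simp
  show i2: "integrable D (\<lambda>z. exp (l * W z))"
    using W ae by (intro Bochner_Integration.integrable_bound[OF i1]) (auto elim!: eventually_mono)
  have "(\<integral>z. exp (l * W z) \<partial>D) \<le> (\<integral>z. 1 + l * W z + l\<^sup>2 * C\<^sup>2 * indicator B z \<partial>D)"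
    by (rule integral_mono_AE[OF i2 i1 ae])
  also have "\<dots> = 1 + (l * (\<integral>z. W z \<partial>D) + l\<^sup>2 * C\<^sup>2 * prob B)"
    using iW iB B prob_space by (simp add: sets.Int_space_eq2)
  also have "\<dots> \<le> exp (l * (\<integral>z. W z \<partial>D) + l\<^sup>2 * C\<^sup>2 * prob B)" by (rule exp_ge_add_one_self)
  finally show "(\<integral>z. exp (l * W z) \<partial>D) \<le> exp (l * (\<integral>z. W z \<partial>D) + l\<^sup>2 * C\<^sup>2 * prob B)" .
qed

lemma measurable_sum_train:
  fixes W :: "point \<times> real \<Rightarrow> real"
  assumes "W \<in> borel_measurable D"
  shows "(\<lambda>S. \<Sum>i<n. W (S i)) \<in> borel_measurable (train n)"
proof (rule borel_measurable_sum)
  fix i assume "i \<in> {..<n}"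
  then show "(\<lambda>S. W (S i)) \<in> borel_measurable (train n)"
    by (intro measurable_compose[OF measurable_sample assms]) simp
qed

text \<open>
  The exponent \<open>l = \<delta> / (2 * C)\<close> minimises \<open>l\<^sup>2 * C\<^sup>2 * K - l * C * \<delta> * K\<close>.
\<close>

lemma upper_tail:
  fixes W :: "point \<times> real \<Rightarrow> real"
  assumes W: "W \<in> borel_measurable D" and B: "B \<in> sets D" and C: "C > 0"
    and bd: "AE z in D. \<bar>W z\<bar> \<le> C * indicator B z"
    and K: "n * prob B \<le> K" "K > 0" and \<delta>: "0 < \<delta>" "\<delta> \<le> 2"
  shows "measure (train n) {S \<in> space (train n). (\<Sum>i<n. W (S i)) \<ge> n * (\<integral>z. W z \<partial>D) + C * (\<delta> * K)}
     \<le> exp (- (\<delta>\<^sup>2 * K / 4))"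
proof -
  interpret T: prob_space "train n" by (rule prob_space_train)
  interpret PP: product_prob_space "\<lambda>_::nat. D" "{..<n}" by (rule product_prob_space_D)
  define l where "l = \<delta> / (2 * C)"
  have l: "0 < l" "l * C \<le> 1" "l * C = \<delta> / 2" using \<delta> C by (auto simp: l_def)
  note em = exponential_moment[OF W B C bd less_imp_le[OF l(1)] l(2)]
  define m where "m = (\<integral>z. W z \<partial>D)"
  define t where "t = n * m + C * (\<delta> * K)"
  have eq: "exp (l * (\<Sum>i<n. W (S i))) = (\<Prod>i<n. exp (l * W (S i)))" for S :: sample
    by (simp add: sum_distrib_left exp_sum)
  have int: "integrable (train n) (\<lambda>S. exp (l * (\<Sum>i<n. W (S i))))"
    unfolding eq train_def training_law_def using em(1) by (intro PP.product_integrable_prod) auto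
  have "(\<integral>S. exp (l * (\<Sum>i<n. W (S i))) \<partial>train n) = (\<Prod>i<n. \<integral>z. exp (l * W z) \<partial>D)"
    unfolding eq train_def training_law_def using em(1) by (intro PP.product_integral_prod) auto
  also have "\<dots> \<le> exp (l * m + l\<^sup>2 * C\<^sup>2 * prob B) ^ n"
    using em(2) by (simp add: m_def power_mono integral_nonneg_AE)
  also have "\<dots> = exp (n * (l * m) + (l * C)\<^sup>2 * (n * prob B))"
    by (simp add: exp_of_nat_mult[symmetric] algebra_simps power_mult_distrib)
  also have "\<dots> \<le> exp (n * (l * m) + (l * C)\<^sup>2 * K)"
    using K by (simp add: mult_left_mono)
  finally have E: "(\<integral>S. exp (l * (\<Sum>i<n. W (S i))) \<partial>train n) \<le> exp (n * (l * m) + (l * C)\<^sup>2 * K)" .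
  have "{S \<in> space (train n). (\<Sum>i<n. W (S i)) \<ge> t} =
      {S \<in> space (train n). exp (l * (\<Sum>i<n. W (S i))) \<ge> exp (l * t)}"
    using l by auto
  then have "T.prob {S \<in> space (train n). (\<Sum>i<n. W (S i)) \<ge> t} \<le>
      (\<integral>S. exp (l * (\<Sum>i<n. W (S i))) \<partial>train n) / exp (l * t)"
    using integral_Markov_inequality_measure[OF int sets.top, of "exp (l * t)"] by simp
  also have "\<dots> \<le> exp (n * (l * m) + (l * C)\<^sup>2 * K) / exp (l * t)"
    by (intro divide_right_mono E) simp
  also have "\<dots> = exp (n * (l * m) + (l * C)\<^sup>2 * K - l * t)" by (rule exp_diff[symmetric])
  also have "n * (l * m) + (l * C)\<^sup>2 * K - l * t = - (\<delta>\<^sup>2 * K / 4)"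
  proof -
    have "l * t = n * (l * m) + (l * C) * (\<delta> * K)" by (simp add: t_def algebra_simps)
    then show ?thesis unfolding l(3) by (simp add: power2_eq_square field_simps)
  qed
  finally show ?thesis by (simp add: t_def m_def)
qed

lemma two_sided_tail:
  fixes W :: "point \<times> real \<Rightarrow> real"
  assumes W: "W \<in> borel_measurable D" and B: "B \<in> sets D" and C: "C > 0"
    and bd: "AE z in D. \<bar>W z\<bar> \<le> C * indicator B z"
    and K: "n * prob B \<le> K" "K > 0" and \<delta>: "0 < \<delta>" "\<delta> \<le> 2"
  shows "measure (train n) {S \<in> space (train n). C * (\<delta> * K) < \<bar>(\<Sum>i<n. W (S i)) - n * (\<integral>z. W z \<partial>D)\<bar>}
     \<le> 2 * exp (- (\<delta>\<^sup>2 * K / 4))"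
proof -
  interpret T: prob_space "train n" by (rule prob_space_train)
  let ?U = "{S \<in> space (train n). (\<Sum>i<n. W (S i)) \<ge> n * (\<integral>z. W z \<partial>D) + C * (\<delta> * K)}"
  let ?V = "{S \<in> space (train n). (\<Sum>i<n. - W (S i)) \<ge> n * (\<integral>z. - W z \<partial>D) + C * (\<delta> * K)}"
  have m: "?U \<in> T.events" "?V \<in> T.events"
    using measurable_sum_train[OF W, of n] measurable_sum_train[of "\<lambda>z. - W z" n] W by measurable
  have "T.prob {S \<in> space (train n). C * (\<delta> * K) < \<bar>(\<Sum>i<n. W (S i)) - n * (\<integral>z. W z \<partial>D)\<bar>}
      \<le> T.prob (?U \<union> ?V)"
    by (intro T.finite_measure_mono sets.Un m) (auto simp: abs_if sum_negf split: if_splits)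
  also have "\<dots> \<le> T.prob ?U + T.prob ?V" by (rule measure_Un_le[OF m])
  also have "\<dots> \<le> exp (- (\<delta>\<^sup>2 * K / 4)) + exp (- (\<delta>\<^sup>2 * K / 4))"
    using W bd by (intro add_mono upper_tail[OF _ B C _ K \<delta>]) auto
  finally show ?thesis by simp
qed

definition grid_point :: "nat \<Rightarrow> (nat \<Rightarrow> nat) \<Rightarrow> point" where
  "grid_point n u j = real (u j) / real n"

definition deviant :: "nat \<Rightarrow> nat \<Rightarrow> real \<Rightarrow> nat set \<Rightarrow> point \<Rightarrow> point \<Rightarrow> sample set" where
  "deviant n k \<delta> R a b =
     {S \<in> space (train n). \<delta> * max (n * volume R a b) k < \<bar>box_count n R a b S - n * volume R a b\<bar>} \<union>
     {S \<in> space (train n). M * (\<delta> * max (n * volume R a b) k) < \<bar>box_sum n R a b S - n * response R a b\<bar>}"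

lemma deviant_prob:
  assumes R: "R \<subseteq> {..<d}" and ub: "unit_box R a b" and k: "k \<ge> 1" and \<delta>: "0 < \<delta>" "\<delta> \<le> 2"
  shows "deviant n k \<delta> R a b \<in> sets (train n)"
    and "measure (train n) (deviant n k \<delta> R a b) \<le> 4 * exp (- (\<delta>\<^sup>2 * k / 4))"
proof -
  interpret T: prob_space "train n" by (rule prob_space_train)
  define B where "B = {z \<in> space D. in_box R a b (fst z)}"
  define K where "K = max (n * volume R a b) k"
  have B: "B \<in> sets D" and pB: "prob B = volume R a b"
    using measurable_in_box[OF R] prob_box[OF R ub] by (auto simp: B_def)
  have K: "n * prob B \<le> K" "K > 0" "k \<le> K" using k by (auto simp: K_def pB)
  let ?W1 = "\<lambda>z::point \<times> real. indicator {z. in_box R a b (fst z)} z :: real"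
  let ?W2 = "\<lambda>z::point \<times> real. snd z * indicator {z. in_box R a b (fst z)} z"
  have m1: "?W1 \<in> borel_measurable D" by (rule box_indicator_measurable[OF R])
  then have m2: "?W2 \<in> borel_measurable D" by measurable
  have b1: "AE z in D. \<bar>?W1 z\<bar> \<le> 1 * indicator B z"
    by (rule AE_I2) (auto simp: B_def indicator_def)
  have b2: "AE z in D. \<bar>?W2 z\<bar> \<le> M * indicator B z"
    using bounded AE_space by eventually_elim (auto simp: B_def indicator_def)
  have e1: "(\<integral>z. ?W1 z \<partial>D) = volume R a b"
    using integral_box_indicator[OF R, of a b] pB by (simp add: B_def)
  have eq: "deviant n k \<delta> R a b =
      {S \<in> space (train n). 1 * (\<delta> * K) < \<bar>(\<Sum>i<n. ?W1 (S i)) - n * (\<integral>z. ?W1 z \<partial>D)\<bar>} \<union>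
      {S \<in> space (train n). M * (\<delta> * K) < \<bar>(\<Sum>i<n. ?W2 (S i)) - n * (\<integral>z. ?W2 z \<partial>D)\<bar>}" (is "_ = ?U \<union> ?V")
    unfolding e1 deviant_def K_def box_count_def box_sum_def response_def by simp
  have m: "?U \<in> T.events" "?V \<in> T.events"
    using measurable_sum_train[OF m1, of n] measurable_sum_train[OF m2, of n] by measurable
  show "deviant n k \<delta> R a b \<in> sets (train n)" unfolding eq by (rule sets.Un[OF m])
  have "T.prob (?U \<union> ?V) \<le> T.prob ?U + T.prob ?V" by (rule measure_Un_le[OF m])
  also have "\<dots> \<le> 2 * exp (- (\<delta>\<^sup>2 * K / 4)) + 2 * exp (- (\<delta>\<^sup>2 * K / 4))"
    by (intro add_mono two_sided_tail[OF m1 B _ b1 K(1,2) \<delta>] two_sided_tail[OF m2 B M_pos b2 K(1,2) \<delta>]) simp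
  also have "\<dots> \<le> 4 * exp (- (\<delta>\<^sup>2 * k / 4))"
    using K(3) by (simp add: mult_left_mono)
  finally show "T.prob (deviant n k \<delta> R a b) \<le> 4 * exp (- (\<delta>\<^sup>2 * k / 4))" unfolding eq .
qed

definition grid_boxes :: "nat \<Rightarrow> nat set \<Rightarrow> ((nat \<Rightarrow> nat) \<times> (nat \<Rightarrow> nat)) set" where
  "grid_boxes n R = {(u, v). u \<in> R \<rightarrow>\<^sub>E {..n} \<and> v \<in> R \<rightarrow>\<^sub>E {..n} \<and> (\<forall>j\<in>R. u j \<le> v j)}"

definition grid_deviant :: "nat \<Rightarrow> nat \<Rightarrow> real \<Rightarrow> nat set \<Rightarrow> sample set" where
  "grid_deviant n k \<delta> R = (\<Union>(u, v)\<in>grid_boxes n R. deviant n k \<delta> R (grid_point n u) (grid_point n v))"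

lemma grid_boxes_finite:
  assumes "finite R"
  shows "finite (grid_boxes n R)" "card (grid_boxes n R) \<le> (n + 1) ^ (2 * card R)"
proof -
  let ?P = "(R \<rightarrow>\<^sub>E {..n}) \<times> (R \<rightarrow>\<^sub>E {..n})"
  have sub: "grid_boxes n R \<subseteq> ?P" by (auto simp: grid_boxes_def)
  have fin: "finite ?P" using assms by (intro finite_cartesian_product finite_PiE) auto
  show "finite (grid_boxes n R)" using sub fin finite_subset by blast
  have "card (grid_boxes n R) \<le> card ?P" by (rule card_mono[OF fin sub])
  also have "\<dots> = (n + 1) ^ (2 * card R)"
    using assms by (simp add: card_cartesian_product card_PiE mult_2 power_add)
  finally show "card (grid_boxes n R) \<le> (n + 1) ^ (2 * card R)" .
qed

lemma grid_point_unit_box: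
  assumes "n \<ge> 1" "(u, v) \<in> grid_boxes n R"
  shows "unit_box R (grid_point n u) (grid_point n v)"
  using assms by (auto simp: unit_box_def grid_point_def grid_boxes_def PiE_def Pi_def divide_right_mono)

lemma grid_deviant_prob:
  assumes n: "n \<ge> 1" and R: "R \<subseteq> {..<d}" and k: "k \<ge> 1" and \<delta>: "0 < \<delta>" "\<delta> \<le> 2"
  shows "grid_deviant n k \<delta> R \<in> sets (train n)"
    and "measure (train n) (grid_deviant n k \<delta> R) \<le>
      real (n + 1) ^ (2 * card R) * (4 * exp (- (\<delta>\<^sup>2 * k / 4)))"
proof -
  interpret T: prob_space "train n" by (rule prob_space_train)
  have finR: "finite R" using R finite_subset by auto
  let ?D = "\<lambda>(u, v). deviant n k \<delta> R (grid_point n u) (grid_point n v)"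
  have D: "?D p \<in> sets (train n)" "T.prob (?D p) \<le> 4 * exp (- (\<delta>\<^sup>2 * k / 4))" if "p \<in> grid_boxes n R" for p
    using deviant_prob[OF R grid_point_unit_box[OF n] k \<delta>] that by (cases p; simp)+
  show "grid_deviant n k \<delta> R \<in> sets (train n)"
    unfolding grid_deviant_def using D(1) grid_boxes_finite(1)[OF finR] by (intro sets.finite_UN) auto
  have "T.prob (grid_deviant n k \<delta> R) \<le> (\<Sum>p\<in>grid_boxes n R. T.prob (?D p))"
    unfolding grid_deviant_def using D(1) grid_boxes_finite(1)[OF finR]
    by (intro T.finite_measure_subadditive_finite) auto
  also have "\<dots> \<le> (\<Sum>p\<in>grid_boxes n R. 4 * exp (- (\<delta>\<^sup>2 * k / 4)))" by (intro sum_mono D)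
  also have "\<dots> = real (card (grid_boxes n R)) * (4 * exp (- (\<delta>\<^sup>2 * k / 4)))" by simp
  also have "\<dots> \<le> real ((n + 1) ^ (2 * card R)) * (4 * exp (- (\<delta>\<^sup>2 * k / 4)))"
    by (intro mult_right_mono of_nat_mono grid_boxes_finite(2)[OF finR]) auto
  finally show "T.prob (grid_deviant n k \<delta> R) \<le>
      real (n + 1) ^ (2 * card R) * (4 * exp (- (\<delta>\<^sup>2 * k / 4)))" by simp
qed

lemma response_diff:
  assumes R: "R \<subseteq> {..<d}" and ub: "unit_box R a b" "unit_box R a' b'"
    and sub: "\<And>j. j \<in> R \<Longrightarrow> a' j \<le> a j \<and> b j \<le> b' j"
  shows "\<bar>response R a' b' - response R a b\<bar> \<le> M * (volume R a' b' - volume R a b)"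
proof -
  let ?I = "\<lambda>a b (z::point \<times> real). indicator {z. in_box R a b (fst z)} z :: real"
  have i: "integrable D (?I a b)" "integrable D (?I a' b')"
    "integrable D (\<lambda>z. snd z * ?I a b z)" "integrable D (\<lambda>z. snd z * ?I a' b' z)"
    using integrable_box_indicator[OF R] integrable_response[OF R] by auto
  have v: "(\<integral>z. ?I a b z \<partial>D) = volume R a b" "(\<integral>z. ?I a' b' z \<partial>D) = volume R a' b'"
    using integral_box_indicator[OF R] prob_box[OF R] ub by auto
  have "\<bar>response R a' b' - response R a b\<bar> = \<bar>\<integral>z. snd z * ?I a' b' z - snd z * ?I a b z \<partial>D\<bar>"
    unfolding response_def using i by simp
  also have "\<dots> \<le> (\<integral>z. \<bar>snd z * ?I a' b' z - snd z * ?I a b z\<bar> \<partial>D)" by (rule integral_abs_bound)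
  also have "\<dots> \<le> (\<integral>z. M * (?I a' b' z - ?I a b z) \<partial>D)"
  proof (rule integral_mono_AE)
    show "AE z in D. \<bar>snd z * ?I a' b' z - snd z * ?I a b z\<bar> \<le> M * (?I a' b' z - ?I a b z)"
      using bounded
    proof eventually_elim
      fix z :: "point \<times> real" assume z: "snd z \<in> {- M..M}"
      have "in_box R a b (fst z) \<Longrightarrow> in_box R a' b' (fst z)" by (rule in_box_mono) (use sub in auto)
      then show "\<bar>snd z * ?I a' b' z - snd z * ?I a b z\<bar> \<le> M * (?I a' b' z - ?I a b z)"
        using z by (auto simp: indicator_def)
    qed
  qed (use i in auto)
  also have "\<dots> = M * (volume R a' b' - volume R a b)"
    using i v by simp
  finally show ?thesis .
qed

lemma box_sum_diff:
  assumes Y: "\<And>i. i < n \<Longrightarrow> \<bar>snd (S i)\<bar> \<le> M"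
    and sub: "\<And>j. j \<in> R \<Longrightarrow> a' j \<le> a j \<and> b j \<le> b' j"
  shows "\<bar>box_sum n R a' b' S - box_sum n R a b S\<bar> \<le> M * (box_count n R a' b' S - box_count n R a b S)"
    and "box_count n R a b S \<le> box_count n R a' b' S"
proof -
  let ?I = "\<lambda>a b (z::point \<times> real). indicator {z. in_box R a b (fst z)} z :: real"
  have mono: "?I a b z \<le> ?I a' b' z" for z
    using in_box_mono[OF _ sub, where x = "fst z"] by (auto simp: indicator_def)
  show "box_count n R a b S \<le> box_count n R a' b' S"
    unfolding box_count_def by (intro sum_mono mono)
  have "\<bar>box_sum n R a' b' S - box_sum n R a b S\<bar> = \<bar>\<Sum>i<n. snd (S i) * (?I a' b' (S i) - ?I a b (S i))\<bar>"
    by (simp add: box_sum_def sum_subtractf right_diff_distrib)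
  also have "\<dots> \<le> (\<Sum>i<n. \<bar>snd (S i) * (?I a' b' (S i) - ?I a b (S i))\<bar>)" by (rule sum_abs)
  also have "\<dots> \<le> (\<Sum>i<n. M * (?I a' b' (S i) - ?I a b (S i)))"
  proof (rule sum_mono)
    fix i assume "i \<in> {..<n}"
    then show "\<bar>snd (S i) * (?I a' b' (S i) - ?I a b (S i))\<bar> \<le> M * (?I a' b' (S i) - ?I a b (S i))"
      using Y[of i] mono[of "S i"] by (simp add: abs_mult mult_right_mono)
  qed
  also have "\<dots> = M * (box_count n R a' b' S - box_count n R a b S)"
    by (simp add: box_count_def sum_subtractf sum_distrib_left right_diff_distrib)
  finally show "\<bar>box_sum n R a' b' S - box_sum n R a b S\<bar> \<le> M * (box_count n R a' b' S - box_count n R a b S)" .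
qed

text \<open>
  An interval lies between two intervals with end points in the grid of mesh \<open>1 / n\<close>. If no such interval
  fits inside, the inner one is degenerate, hence empty as a half-open interval.
\<close>

lemma grid_sandwich:
  assumes n: "n \<ge> 1" and ab: "0 \<le> a" "a \<le> b" "b \<le> (1::real)"
  obtains uo vo ui vi :: nat where "uo \<le> vo" "vo \<le> n" "ui \<le> vi" "vi \<le> n"
    "real uo / n \<le> a" "b \<le> real vo / n" "\<bar>(real vo / n - real uo / n) - (b - a)\<bar> \<le> 2 / n"
    "a \<le> real ui / n" "ui = vi \<or> real vi / n \<le> b" "\<bar>(real vi / n - real ui / n) - (b - a)\<bar> \<le> 2 / n"
proof -
  have n0: "real n > 0" using n by simp
  define uo where "uo = nat \<lfloor>n * a\<rfloor>"
  define vo where "vo = nat \<lceil>n * b\<rceil>"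
  define ui where "ui = nat \<lceil>n * a\<rceil>"
  define vi where "vi = max ui (nat \<lfloor>n * b\<rfloor>)"
  have na: "0 \<le> n * a" "n * a \<le> n * b" "n * b \<le> n" using n0 ab by (simp_all add: mult_left_mono mult_left_le)
  have r: "real uo = of_int \<lfloor>n * a\<rfloor>" "real vo = of_int \<lceil>n * b\<rceil>" "real ui = of_int \<lceil>n * a\<rceil>"
    "real (nat \<lfloor>n * b\<rfloor>) = of_int \<lfloor>n * b\<rfloor>"
    using na unfolding uo_def vo_def ui_def by (simp_all add: of_nat_nat)
  have uo: "real uo \<le> n * a" "n * a - 1 \<le> real uo"
    and vo: "n * b \<le> real vo" "real vo \<le> n * b + 1"
    and ui: "n * a \<le> real ui" "real ui \<le> n * a + 1"
    and bi: "real (nat \<lfloor>n * b\<rfloor>) \<le> n * b" "n * b - 1 \<le> real (nat \<lfloor>n * b\<rfloor>)"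
    unfolding r by linarith+
  have vo_n: "vo \<le> n" unfolding vo_def using na by (simp add: ceiling_le_iff nat_le_iff)
  have ui_n: "ui \<le> n" unfolding ui_def using na by (simp add: ceiling_le_iff nat_le_iff)
  have "real (nat \<lfloor>n * b\<rfloor>) \<le> n" using bi na by linarith
  then have vi_n: "vi \<le> n" unfolding vi_def using ui_n by simp
  have "real uo \<le> real vo" using uo vo na by linarith
  then have uv: "uo \<le> vo" by simp
  have vi: "real vi \<le> n * b \<or> vi = ui" unfolding vi_def using bi by (auto simp: max_def)
  have w1: "\<bar>(real vo - real uo) - (n * b - n * a)\<bar> \<le> 2" using uo vo by linarith
  have w2: "\<bar>(real vi - real ui) - (n * b - n * a)\<bar> \<le> 2"
  proof (cases "ui \<le> nat \<lfloor>n * b\<rfloor>")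
    case True
    then have "real vi = real (nat \<lfloor>n * b\<rfloor>)" by (simp add: vi_def)
    then show ?thesis using ui bi na by linarith
  next
    case False
    then have "real vi = real ui" "real (nat \<lfloor>n * b\<rfloor>) + 1 \<le> real ui" by (simp_all add: vi_def)
    then show ?thesis using ui bi na by linarith
  qed
  have scale: "\<bar>(x / n - y / n) - (b - a)\<bar> \<le> 2 / n" if "\<bar>(x - y) - (n * b - n * a)\<bar> \<le> 2" for x y :: real
  proof -
    have "(x / n - y / n) - (b - a) = ((x - y) - (n * b - n * a)) / n"
      using n0 by (simp add: field_simps)
    then show ?thesis using that n0 by (simp add: divide_right_mono)
  qed
  show ?thesis
  proof (rule that[of uo vo ui vi])
    show "real uo / n \<le> a" "b \<le> real vo / n" "a \<le> real ui / n"
      using uo vo ui n0 by (simp_all add: field_simps)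
    show "ui = vi \<or> real vi / n \<le> b" using vi n0 by (auto simp: field_simps)
  qed (use uv vo_n vi_n scale[OF w1] scale[OF w2] in \<open>simp_all add: vi_def\<close>)
qed

text \<open>
  Counts are monotone in the box, so an arbitrary box is squeezed between its inner and outer grid boxes.
  Their volumes differ from its own by at most \<open>2 * card R / n\<close>, which is absorbed by the deviation \<open>\<delta> * k\<close>.
  Response sums are not monotone, but they change by at most \<open>M\<close> times the change of the count. The
  factor \<open>9\<close> collects these errors.
\<close>

lemma concentratedI:
  assumes n: "n \<ge> 1" and k: "k \<ge> 1" and R: "R \<subseteq> {..<d}" and \<delta>: "0 < \<delta>" "\<delta> \<le> 1"
    and small: "2 * real (card R) \<le> \<delta> * k"
    and Y: "\<And>i. i < n \<Longrightarrow> \<bar>snd (S i)\<bar> \<le> M"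
    and S: "S \<in> space (train n)" "S \<notin> grid_deviant n k \<delta> R"
  shows "concentrated n k (9 * \<delta>) R S"
  unfolding concentrated_def
proof (intro allI impI)
  fix a b assume ub: "unit_box R a b"
  have finR: "finite R" using R finite_subset by auto
  have n0: "real n > 0" using n by simp
  define good where "good j uo vo ui vi \<longleftrightarrow> uo \<le> vo \<and> vo \<le> n \<and> ui \<le> vi \<and> vi \<le> n \<and>
    real uo / n \<le> a j \<and> b j \<le> real vo / n \<and> \<bar>(real vo / n - real uo / n) - (b j - a j)\<bar> \<le> 2 / n \<and>
    a j \<le> real ui / n \<and> (ui = vi \<or> real vi / n \<le> b j) \<and>
    \<bar>(real vi / n - real ui / n) - (b j - a j)\<bar> \<le> 2 / n" for j uo vo ui vi
  have "\<forall>j\<in>R. \<exists>p. good j (fst p) (fst (snd p)) (fst (snd (snd p))) (snd (snd (snd p)))"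
  proof
    fix j assume "j \<in> R"
    then have ab: "0 \<le> a j" "a j \<le> b j" "b j \<le> 1" using ub by (auto simp: unit_box_def)
    show "\<exists>p. good j (fst p) (fst (snd p)) (fst (snd (snd p))) (snd (snd (snd p)))"
    proof (rule grid_sandwich[OF n ab])
      fix uo vo ui vi
      assume "uo \<le> vo" "vo \<le> n" "ui \<le> vi" "vi \<le> n"
        "real uo / n \<le> a j" "b j \<le> real vo / n" "\<bar>(real vo / n - real uo / n) - (b j - a j)\<bar> \<le> 2 / n"
        "a j \<le> real ui / n" "ui = vi \<or> real vi / n \<le> b j" "\<bar>(real vi / n - real ui / n) - (b j - a j)\<bar> \<le> 2 / n"
      then show ?thesis by (intro exI[of _ "(uo, vo, ui, vi)"]) (simp add: good_def)
    qed
  qed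
  from bchoice[OF this] obtain p where
    p: "\<And>j. j \<in> R \<Longrightarrow> good j (fst (p j)) (fst (snd (p j))) (fst (snd (snd (p j)))) (snd (snd (snd (p j))))"
    by blast
  define uo where "uo = (\<lambda>j\<in>R. fst (p j))"
  define vo where "vo = (\<lambda>j\<in>R. fst (snd (p j)))"
  define ui where "ui = (\<lambda>j\<in>R. fst (snd (snd (p j))))"
  define vi where "vi = (\<lambda>j\<in>R. snd (snd (snd (p j))))"
  let ?ao = "grid_point n uo" and ?bo = "grid_point n vo" and ?ai = "grid_point n ui" and ?bi = "grid_point n vi"
  have q: "uo j \<le> vo j \<and> vo j \<le> n \<and> ui j \<le> vi j \<and> vi j \<le> n \<and>
     ?ao j \<le> a j \<and> b j \<le> ?bo j \<and> \<bar>(?bo j - ?ao j) - (b j - a j)\<bar> \<le> 2 / n \<and>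
     a j \<le> ?ai j \<and> (?ai j = ?bi j \<or> ?bi j \<le> b j) \<and> \<bar>(?bi j - ?ai j) - (b j - a j)\<bar> \<le> 2 / n" if "j \<in> R" for j
    using p[OF that] that unfolding good_def uo_def vo_def ui_def vi_def grid_point_def
    by (simp only: restrict_apply if_True) force
  have o: "(uo, vo) \<in> grid_boxes n R" and i: "(ui, vi) \<in> grid_boxes n R"
    unfolding grid_boxes_def using q
    by (auto simp: uo_def vo_def ui_def vi_def PiE_def Pi_def extensional_def intro: order_trans)
  have ubo: "unit_box R ?ao ?bo" and ubi: "unit_box R ?ai ?bi"
    using grid_point_unit_box[OF n] o i by auto
  have dev: "\<bar>box_count n R a' b' S - n * volume R a' b'\<bar> \<le> \<delta> * max (n * volume R a' b') k"
    "\<bar>box_sum n R a' b' S - n * response R a' b'\<bar> \<le> M * (\<delta> * max (n * volume R a' b') k)"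
    if "(u, v) \<in> grid_boxes n R" "a' = grid_point n u" "b' = grid_point n v" for u v a' b'
    using S that by (auto simp: grid_deviant_def deviant_def not_less)
  define r where "r = 2 * real (card R)"
  define v where "v = n * volume R a b"
  define K where "K = max v k"
  have side: "\<bar>b' j - a' j\<bar> \<le> 1" if "unit_box R a' b'" "j \<in> R" for a' b' j
    using that unfolding unit_box_def by fastforce
  have vd: "\<bar>n * volume R a' b' - v\<bar> \<le> r"
    if "unit_box R a' b'" "\<And>j. j \<in> R \<Longrightarrow> \<bar>(b' j - a' j) - (b j - a j)\<bar> \<le> 2 / n" for a' b'
  proof -
    have "\<bar>volume R a' b' - volume R a b\<bar> \<le> real (card R) * (2 / n)"
      using that side[OF ub] side[OF that(1)] by (intro volume_diff finR) auto
    then have "n * \<bar>volume R a' b' - volume R a b\<bar> \<le> n * (real (card R) * (2 / n))"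
      by (intro mult_left_mono) auto
    moreover have "\<bar>n * volume R a' b' - v\<bar> = n * \<bar>volume R a' b' - volume R a b\<bar>"
      unfolding v_def right_diff_distrib[symmetric] by (simp add: abs_mult)
    ultimately show ?thesis using n0 by (simp add: r_def)
  qed
  have vo: "\<bar>n * volume R ?ao ?bo - v\<bar> \<le> r" and vi: "\<bar>n * volume R ?ai ?bi - v\<bar> \<le> r"
    using q by (auto intro!: vd ubo ubi)
  have r: "0 \<le> r" "r \<le> \<delta> * K"
  proof -
    have "\<delta> * k \<le> \<delta> * K" using \<delta> by (intro mult_left_mono) (auto simp: K_def)
    then show "r \<le> \<delta> * K" using small by (simp add: r_def)
  qed (simp add: r_def)
  have K0: "0 \<le> K" by (simp add: K_def max_def)
  have dK: "\<delta> * K \<le> K" using \<delta> K0 by (simp add: mult_left_le_one_le)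
  have dr: "\<delta> * r \<le> r" using \<delta> r by (simp add: mult_left_le_one_le)
  have mx: "\<delta> * max (n * volume R a' b') k \<le> \<delta> * K + r" if "\<bar>n * volume R a' b' - v\<bar> \<le> r" for a' b'
  proof -
    have "max (n * volume R a' b') k \<le> K + r" using that r by (auto simp: K_def)
    then have "\<delta> * max (n * volume R a' b') k \<le> \<delta> * (K + r)" using \<delta> by (intro mult_left_mono) auto
    then show ?thesis using dr by (simp add: distrib_left)
  qed
  have so: "?ao j \<le> a j \<and> b j \<le> ?bo j" if "j \<in> R" for j using q[OF that] by auto
  have cnt_o: "box_count n R a b S \<le> box_count n R ?ao ?bo S"
    by (rule box_sum_diff(2)) (fact Y, fact so)
  have cnt_i: "box_count n R ?ai ?bi S \<le> box_count n R a b S"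
    unfolding box_count_def
  proof (rule sum_mono)
    fix l
    have "in_box R ?ai ?bi (fst (S l)) \<Longrightarrow> in_box R a b (fst (S l))"
      unfolding in_box_def using q by fastforce
    then show "indicator {z. in_box R ?ai ?bi (fst z)} (S l) \<le> (indicator {z. in_box R a b (fst z)} (S l) :: real)"
      by (auto simp: indicator_def)
  qed
  have co: "\<bar>box_count n R ?ao ?bo S - n * volume R ?ao ?bo\<bar> \<le> \<delta> * K + r"
    using dev(1)[OF o refl refl] mx[OF vo] by linarith
  have ci: "\<bar>box_count n R ?ai ?bi S - n * volume R ?ai ?bi\<bar> \<le> \<delta> * K + r"
    using dev(1)[OF i refl refl] mx[OF vi] by linarith
  have c: "\<bar>box_count n R a b S - v\<bar> \<le> 3 * (\<delta> * K)"
    using co ci vo vi cnt_o cnt_i r by linarith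
  have c_diff: "box_count n R ?ao ?bo S - box_count n R a b S \<le> 6 * (\<delta> * K)"
    using co vo c r by linarith
  have s1: "\<bar>box_sum n R ?ao ?bo S - box_sum n R a b S\<bar> \<le> M * (6 * (\<delta> * K))"
  proof -
    have "\<bar>box_sum n R ?ao ?bo S - box_sum n R a b S\<bar> \<le>
        M * (box_count n R ?ao ?bo S - box_count n R a b S)"
      by (rule box_sum_diff(1)) (fact Y, fact so)
    also have "\<dots> \<le> M * (6 * (\<delta> * K))"
      by (rule mult_left_mono[OF c_diff]) (use M_pos in simp)
    finally show ?thesis .
  qed
  have s2: "\<bar>box_sum n R ?ao ?bo S - n * response R ?ao ?bo\<bar> \<le> M * (2 * (\<delta> * K))"
  proof -
    have "M * (\<delta> * max (n * volume R ?ao ?bo) k) \<le> M * (2 * (\<delta> * K))"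
      using mx[OF vo] r M_pos by (intro mult_left_mono) auto
    then show ?thesis using dev(2)[OF o refl refl] by linarith
  qed
  have s3: "\<bar>n * response R ?ao ?bo - n * response R a b\<bar> \<le> M * (\<delta> * K)"
  proof -
    have "n * \<bar>response R ?ao ?bo - response R a b\<bar> \<le> n * (M * (volume R ?ao ?bo - volume R a b))"
      using so by (intro mult_left_mono response_diff[OF R ub ubo]) auto
    also have "\<dots> = M * (n * volume R ?ao ?bo - v)" by (simp add: v_def algebra_simps)
    also have "\<dots> \<le> M * (\<delta> * K)" using vo r M_pos by (intro mult_left_mono) auto
    finally show ?thesis
      unfolding right_diff_distrib[symmetric] by (simp add: abs_mult)
  qed
  have "\<bar>box_sum n R a b S - n * response R a b\<bar> \<le> M * (6 * (\<delta> * K)) + M * (2 * (\<delta> * K)) + M * (\<delta> * K)"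
    using s1 s2 s3 by linarith
  also have "\<dots> = M * (9 * \<delta> * K)" by (simp add: algebra_simps)
  finally have "\<bar>box_sum n R a b S - n * response R a b\<bar> \<le> M * (9 * \<delta> * K)" .
  moreover have "3 * (\<delta> * K) \<le> 9 * \<delta> * K" using \<delta> K0 by simp
  ultimately show "\<bar>box_count n R a b S - n * volume R a b\<bar> \<le> 9 * \<delta> * max (n * volume R a b) k \<and>
      \<bar>box_sum n R a b S - n * response R a b\<bar> \<le> M * (9 * \<delta> * max (n * volume R a b) k)"
    using c unfolding v_def[symmetric] K_def[symmetric] by linarith
qed

end

section \<open>Concentrated samples split exactly along the signal\<close>

lemma volume_insert:
  assumes "finite R" "j \<notin> R"
  shows "volume (insert j R) (a(j := c)) (b(j := e)) = volume R a b * (e - c)"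
proof -
  have "(\<Prod>i\<in>R. (b(j := e)) i - (a(j := c)) i) = (\<Prod>i\<in>R. b i - a i)"
    using assms(2) by (intro prod.cong refl) auto
  then show ?thesis using assms by (simp add: volume_def mult.commute)
qed

lemma unit_box_insert:
  assumes "unit_box R a b" "0 \<le> c" "c \<le> e" "e \<le> 1"
  shows "unit_box (insert j R) (a(j := c)) (b(j := e))"
  using assms by (auto simp: unit_box_def)

lemma ratio_close:
  fixes T N r e c v :: real
  assumes "0 < c" "0 < v" "c * v \<le> N" "\<bar>T - r * N\<bar> \<le> e * v" "0 \<le> e"
  shows "\<bar>T / N - r\<bar> \<le> e / c"
proof -
  have N: "N > 0" using assms by (meson less_le_trans mult_pos_pos)
  have "T / N - r = (T - r * N) / N" using N by (simp add: field_simps)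
  then have "\<bar>T / N - r\<bar> = \<bar>T - r * N\<bar> / N" using N by (simp add: abs_mult)
  also have "\<dots> \<le> e * v / N" using assms N by (intro divide_right_mono) auto
  also have "\<dots> \<le> e * v / (c * v)" using assms N by (intro divide_left_mono) auto
  also have "\<dots> = e / c" using assms by simp
  finally show ?thesis .
qed

lemma split_gain_le:
  "split_gain S I j \<theta> \<le> (split_effect S I j \<theta>)\<^sup>2"
proof -
  let ?m = "real (card (below S I j \<theta>))" and ?p = "real (card (above S I j \<theta>))"
  have "4 * ?m * ?p \<le> (?m + ?p)\<^sup>2"
    using zero_le_power2[of "?m - ?p"] by (simp add: power2_eq_square algebra_simps)
  then have "4 * ?m * ?p / (?m + ?p)\<^sup>2 \<le> 1" by (auto simp: divide_le_eq_1)
  then have "4 * ?m * ?p / (?m + ?p)\<^sup>2 * (split_effect S I j \<theta>)\<^sup>2 \<le> 1 * (split_effect S I j \<theta>)\<^sup>2"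
    by (intro mult_right_mono) auto
  then show ?thesis by (simp add: split_gain_def Let_def)
qed

lemma split_gain_ge:
  assumes "card I \<ge> 2" "card (below S I j \<theta>) = (card I + 1) div 2" "card (above S I j \<theta>) = card I div 2"
  shows "split_gain S I j \<theta> \<ge> 2 / 3 * (split_effect S I j \<theta>)\<^sup>2"
proof -
  let ?m = "real (card (below S I j \<theta>))" and ?p = "real (card (above S I j \<theta>))"
  define c where "c = real (card I)"
  have c: "c \<ge> 2" using assms(1) by (simp add: c_def)
  have "(card I + 1) div 2 + card I div 2 = card I" by linarith
  then have sum: "?m + ?p = c" unfolding assms(2,3) c_def by (metis of_nat_add)
  have "card I \<le> 2 * ((card I + 1) div 2)" by linarith
  then have m: "c / 2 \<le> ?m" unfolding assms(2) c_def by linarith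
  have "card I \<le> 3 * (card I div 2)" using assms(1) by linarith
  then have p: "c / 3 \<le> ?p" unfolding assms(3) c_def by linarith
  have "4 * (c / 2 * (c / 3)) \<le> 4 * (?m * ?p)" using m p c by (intro mult_left_mono mult_mono) auto
  then have "2 / 3 * c\<^sup>2 \<le> 4 * ?m * ?p" by (simp add: power2_eq_square)
  then have "2 / 3 \<le> 4 * ?m * ?p / c\<^sup>2" using c by (simp add: field_simps)
  then have "2 / 3 * (split_effect S I j \<theta>)\<^sup>2 \<le> 4 * ?m * ?p / (?m + ?p)\<^sup>2 * (split_effect S I j \<theta>)\<^sup>2"
    unfolding sum by (intro mult_right_mono) auto
  then show ?thesis by (simp add: split_gain_def Let_def)
qed

context sparse_model
begin

lemma response_cong:
  assumes "\<And>j. j \<in> R \<Longrightarrow> a j = a' j \<and> b j = b' j"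
  shows "response R a b = response R a' b'"
proof -
  have "in_box R a b x = in_box R a' b' x" for x
    unfolding in_box_def using assms by (intro ball_cong) auto
  then show ?thesis by (simp add: response_def)
qed

lemma response_bound:
  assumes R: "R \<subseteq> {..<d}" and ub: "unit_box R a b"
  shows "\<bar>response R a b\<bar> \<le> M * volume R a b"
proof -
  let ?I = "\<lambda>z::point \<times> real. indicator {z. in_box R a b (fst z)} z :: real"
  have i: "integrable D ?I" "integrable D (\<lambda>z. snd z * ?I z)"
    using integrable_box_indicator[OF R] integrable_response[OF R] by auto
  have v: "(\<integral>z. ?I z \<partial>D) = volume R a b"
    using integral_box_indicator[OF R] prob_box[OF R ub] by auto
  have "\<bar>response R a b\<bar> \<le> (\<integral>z. \<bar>snd z * ?I z\<bar> \<partial>D)"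
    unfolding response_def by (rule integral_abs_bound)
  also have "\<dots> \<le> (\<integral>z. M * ?I z \<partial>D)"
  proof (rule integral_mono_AE)
    show "AE z in D. \<bar>snd z * ?I z\<bar> \<le> M * ?I z"
      using bounded by eventually_elim (auto simp: indicator_def)
    show "integrable D (\<lambda>z. \<bar>snd z * ?I z\<bar>)" using i(2) by (rule integrable_abs)
    show "integrable D (\<lambda>z. M * ?I z)" using i(1) by (rule integrable_mult_right)
  qed
  also have "\<dots> = M * volume R a b" by (simp only: integral_mult_right_zero v)
  finally show ?thesis .
qed

end

text \<open>
  \<open>\<eta>\<close> is the accuracy that decides which splits pass the check, \<open>\<epsilon>\<close> the accuracy that controls the
  sides of the cells.
\<close>

locale concentrated_sample = sparse_model D d M f Q \<beta> L \<sigma>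
  for D d M f Q \<beta> L \<sigma> +
  fixes n k :: nat and S :: sample and \<eta> \<epsilon> :: real
  assumes k_pos: "k \<ge> 1"
    and gen: "generic n d S"
    and concQ: "concentrated n k \<epsilon> Q S"
    and concI: "\<And>j. j < d \<Longrightarrow> concentrated n k \<eta> (insert j Q) S"
    and \<eta>: "\<eta> \<le> 1 / 10" "1 \<le> \<eta> * k" and \<epsilon>: "\<epsilon> \<le> 1 / 10" "1 \<le> \<epsilon> * k"
begin

lemma eta_pos: "\<eta> > 0" "\<epsilon> > 0"
proof -
  have k: "real k > 0" using k_pos by simp
  have "0 < \<eta> * real k" "0 < \<epsilon> * real k" using \<eta>(2) \<epsilon>(2) by linarith+
  then show "\<eta> > 0" "\<epsilon> > 0" using zero_less_mult_pos2[OF _ k] by blast+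
qed

lemma box_count_insert_full:
  assumes "j \<notin> R" "j < d"
  shows "box_count n (insert j R) (a(j := 0)) (b(j := 1)) S = box_count n R a b S"
proof -
  have "in_box (insert j R) (a(j := 0)) (b(j := 1)) (fst (S i)) = in_box R a b (fst (S i))" if "i < n" for i
    using gen that assms pos_cubeD[of "fst (S i)" d j] by (auto simp: in_box_insert generic_def)
  then have "{i. i < n \<and> in_box (insert j R) (a(j := 0)) (b(j := 1)) (fst (S i))} =
      {i. i < n \<and> in_box R a b (fst (S i))}" by blast
  then show ?thesis unfolding box_count_card by (rule arg_cong)
qed

text \<open>
  If the expected count \<open>v\<close> were below \<open>k\<close>, the deviation would be at most \<open>k / 10\<close> and the count would stay
  below \<open>2 * k\<close>. Hence deviations are relative at every node that can be split.
\<close>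

lemma mass_close:
  fixes m v e :: real
  assumes c: "\<bar>m - v\<bar> \<le> e * max v k" and m: "2 * real k \<le> m" and e: "0 < e" "e \<le> 1 / 10"
  shows "k \<le> v" "\<bar>m - v\<bar> \<le> e * v"
proof -
  have k: "real k > 0" using k_pos by simp
  show "k \<le> v"
  proof (rule ccontr)
    assume "\<not> k \<le> v"
    then have "\<bar>m - v\<bar> \<le> e * k" "v < k" using c by (auto simp: max_def)
    moreover have "e * real k \<le> 1 * real k" using e by (intro mult_right_mono) auto
    ultimately show False using m k by linarith
  qed
  then show "\<bar>m - v\<bar> \<le> e * v" using c by (simp add: max_def split: if_splits)
qed

definition good_cell :: "nat set \<Rightarrow> point \<Rightarrow> point \<Rightarrow> bool" where
  "good_cell I a b \<longleftrightarrow> I = {i. i < n \<and> in_box Q a b (fst (S i))} \<and> unit_box Q a b \<and> 2 * k \<le> card I"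

lemma good_cell_cell:
  assumes "x \<in> pos_cube d" "js \<in> lists Q" "2 * k \<le> card (cell_members n S x js)"
  shows "good_cell (cell_members n S x js) (cell_lower n S x js) (cell_upper n S x js)"
proof -
  have "cell_members n S x js \<noteq> {}" using assms(3) k_pos by auto
  note c = cell_box[OF gen assms(1) Q_subset assms(2) this]
  have "unit_box Q (cell_lower n S x js) (cell_upper n S x js)"
    using c Q_subset unfolding unit_box_def in_box_def by (meson le_less_trans less_imp_le lessThan_iff less_le_trans subsetD)
  then show ?thesis using c assms(3) by (simp add: good_cell_def)
qed

lemma good_cell_facts:
  assumes g: "good_cell I a b" and j: "j < d"
  defines "\<theta> \<equiv> split_point S I j"
  shows "finite I" "card I \<ge> 2" "inj_on (\<lambda>i. fst (S i) j) I" "0 < \<theta>" "\<theta> \<le> 1"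
    "card (below S I j \<theta>) = (card I + 1) div 2" "card (above S I j \<theta>) = card I div 2"
proof -
  have I: "I \<subseteq> {..<n}" using g by (auto simp: good_cell_def)
  show fin: "finite I" using I finite_subset by auto
  show c2: "card I \<ge> 2" using g k_pos by (auto simp: good_cell_def)
  show inj: "inj_on (\<lambda>i. fst (S i) j) I"
    using gen j I unfolding generic_def by (meson inj_on_subset)
  have "I \<noteq> {}" using c2 by auto
  moreover have "0 < fst (S i) j \<and> fst (S i) j \<le> 1" if "i \<in> I" for i
    using that I gen j pos_cubeD[of "fst (S i)" d j] by (auto simp: generic_def)
  ultimately show "0 < \<theta>" "\<theta> \<le> 1"
    unfolding \<theta>_def split_point_def
    using median_between[OF fin, of 0 "\<lambda>i. fst (S i) j" 1] by simp_all
  show "card (below S I j \<theta>) = (card I + 1) div 2" "card (above S I j \<theta>) = card I div 2"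
    unfolding \<theta>_def by (rule card_median_halves[OF fin inj])+
qed

lemma halves_bounds:
  assumes "card I \<ge> 2" "card B = (card I + 1) div 2" "card A = card I div 2"
  shows "real (card I) / 2 \<le> real (card B)" "2 * real (card B) \<le> real (card I) + 1"
    "real (card I) \<le> 2 * real (card A) + 1" "real (card A) \<le> real (card I) / 2"
    "real (card I) / 3 \<le> real (card A)"
proof -
  have *: "card I \<le> 2 * card B" "2 * card B \<le> card I + 1" "card I \<le> 2 * card A + 1" "2 * card A \<le> card I"
    "card I \<le> 3 * card A" using assms by linarith+
  show "real (card I) / 2 \<le> real (card B)" using *(1) by linarith
  have "real (2 * card B) \<le> real (card I + 1)" using *(2) by (simp only: of_nat_le_iff)
  then show "2 * real (card B) \<le> real (card I) + 1" by simp
  have "real (card I) \<le> real (2 * card A + 1)" using *(3) by (simp only: of_nat_le_iff)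
  then show "real (card I) \<le> 2 * real (card A) + 1" by simp
  show "real (card A) \<le> real (card I) / 2" using *(4) by linarith
  show "real (card I) / 3 \<le> real (card A)" using *(5) by linarith
qed

text \<open>
  Both sides of a split are boxes. The set \<open>R\<close> is \<open>Q\<close> without \<open>j\<close>; for a noise variable this is \<open>Q\<close> itself.
\<close>

lemma split_effect_boxes:
  assumes "I = {i. i < n \<and> in_box Q a b (fst (S i))}" and j: "j < d" "j \<notin> R" "Q \<subseteq> insert j R" "R \<subseteq> Q"
    and full: "j \<in> Q \<Longrightarrow> a j = 0 \<and> b j = 1"
  shows "real (card (below S I j \<theta>)) = box_count n (insert j R) (a(j := 0)) (b(j := \<theta>)) S"
    "real (card (above S I j \<theta>)) = box_count n (insert j R) (a(j := \<theta>)) (b(j := 1)) S"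
    "split_effect S I j \<theta> =
      box_sum n (insert j R) (a(j := \<theta>)) (b(j := 1)) S / real (card (above S I j \<theta>)) -
      box_sum n (insert j R) (a(j := 0)) (b(j := \<theta>)) S / real (card (below S I j \<theta>))"
proof -
  have X: "0 < fst (S i) j \<and> fst (S i) j \<le> 1" if "i < n" for i
    using that gen j pos_cubeD[of "fst (S i)" d j] by (auto simp: generic_def)
  have Q: "in_box Q a b (fst (S i)) \<longleftrightarrow> in_box R a b (fst (S i))" if "i < n" for i
  proof (cases "j \<in> Q")
    case True
    then have "Q = insert j R" using j by auto
    then show ?thesis using X[OF that] full[OF True] by (simp add: in_box_def)
  next
    case False
    then have "Q = R" using j by auto
    then show ?thesis by simp
  qed
  have b: "below S I j \<theta> = {i. i < n \<and> in_box (insert j R) (a(j := 0)) (b(j := \<theta>)) (fst (S i))}"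
    unfolding in_box_insert[OF j(2)] below_def assms(1) using Q X by auto
  have a: "above S I j \<theta> = {i. i < n \<and> in_box (insert j R) (a(j := \<theta>)) (b(j := 1)) (fst (S i))}"
    unfolding in_box_insert[OF j(2)] above_def assms(1) using Q X by auto
  show "real (card (below S I j \<theta>)) = box_count n (insert j R) (a(j := 0)) (b(j := \<theta>)) S"
    "real (card (above S I j \<theta>)) = box_count n (insert j R) (a(j := \<theta>)) (b(j := 1)) S"
    unfolding box_count_card a b by simp_all
  show "split_effect S I j \<theta> =
      box_sum n (insert j R) (a(j := \<theta>)) (b(j := 1)) S / real (card (above S I j \<theta>)) -
      box_sum n (insert j R) (a(j := 0)) (b(j := \<theta>)) S / real (card (below S I j \<theta>))"
    unfolding split_effect_def box_sum_sum a b by simp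
qed

lemma slab_close:
  fixes v c e :: real
  assumes conc: "concentrated n k \<eta> (insert j R) S" and R: "finite R" "j \<notin> R" and ub: "unit_box R a b"
    and v: "v = n * volume R a b" "k \<le> v" and c: "0 \<le> c" "c \<le> e" "e \<le> 1"
  shows "\<bar>box_count n (insert j R) (a(j := c)) (b(j := e)) S - v * (e - c)\<bar> \<le> \<eta> * v"
    "\<bar>box_sum n (insert j R) (a(j := c)) (b(j := e)) S - n * response (insert j R) (a(j := c)) (b(j := e))\<bar> \<le> M * (\<eta> * v)"
proof -
  have vol: "n * volume (insert j R) (a(j := c)) (b(j := e)) = v * (e - c)"
    by (simp add: volume_insert[OF R] v(1))
  have "v * (e - c) \<le> v * 1" using c v(2) by (intro mult_left_mono) auto
  then have mx: "max (v * (e - c)) k \<le> v" using v(2) by simp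
  then have mx': "\<eta> * max (v * (e - c)) k \<le> \<eta> * v" using eta_pos by (intro mult_left_mono) auto
  have mx2: "M * (\<eta> * max (v * (e - c)) k) \<le> M * (\<eta> * v)"
    by (rule mult_left_mono[OF mx']) (use M_pos in simp)
  note h = conc[unfolded concentrated_def, rule_format, OF unit_box_insert[OF ub c, of j], unfolded vol]
  show "\<bar>box_count n (insert j R) (a(j := c)) (b(j := e)) S - v * (e - c)\<bar> \<le> \<eta> * v"
    using h mx' by linarith
  show "\<bar>box_sum n (insert j R) (a(j := c)) (b(j := e)) S - n * response (insert j R) (a(j := c)) (b(j := e))\<bar> \<le> M * (\<eta> * v)"
    using h mx2 by linarith
qed

text \<open>
  Along a noise variable both sides of the split have the same mean response \<open>r\<close>, and both empirical means
  are within a multiple of \<open>M * \<eta>\<close> of it.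
\<close>

lemma noise_effect:
  assumes g: "good_cell I a b" and j: "j < d" "j \<notin> Q"
  shows "\<bar>split_effect S I j (split_point S I j)\<bar> \<le> 12 * M * \<eta>"
proof -
  define \<theta> where "\<theta> = split_point S I j"
  note f = good_cell_facts[OF g j(1), folded \<theta>_def]
  have I: "I = {i. i < n \<and> in_box Q a b (fst (S i))}" and ub: "unit_box Q a b" and c2: "2 * k \<le> card I"
    using g by (auto simp: good_cell_def)
  define v where "v = n * volume Q a b"
  have cI: "real (card I) = box_count n Q a b S" by (simp add: box_count_card I)
  have "\<bar>real (card I) - v\<bar> \<le> \<eta> * max v k"
    using concI[OF j(1), unfolded concentrated_def, rule_format, OF unit_box_insert[OF ub, of 0 1 j]] j
    unfolding volume_insert[OF finite_Q j(2)] box_count_insert_full[OF j(2,1)] cI v_def by simp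
  moreover have "2 * real k \<le> real (card I)" using c2 by linarith
  ultimately have kv: "k \<le> v" and m: "\<bar>real (card I) - v\<bar> \<le> \<eta> * v"
    using mass_close[of "real (card I)" v \<eta>] \<eta> eta_pos by auto
  have v0: "v > 0" using kv k_pos by linarith
  have QQ: "Q \<subseteq> insert j Q" by auto
  note e = split_effect_boxes[OF I j(1,2) QQ order_refl, of \<theta>]
  have e': "real (card (below S I j \<theta>)) = box_count n (insert j Q) (a(j := 0)) (b(j := \<theta>)) S"
    "real (card (above S I j \<theta>)) = box_count n (insert j Q) (a(j := \<theta>)) (b(j := 1)) S"
    "split_effect S I j \<theta> =
      box_sum n (insert j Q) (a(j := \<theta>)) (b(j := 1)) S / real (card (above S I j \<theta>)) -
      box_sum n (insert j Q) (a(j := 0)) (b(j := \<theta>)) S / real (card (below S I j \<theta>))"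
    by (rule e; use j in simp)+
  define r where "r = response Q a b / volume Q a b"
  have vol0: "volume Q a b > 0" using v0 volume_nonneg[OF ub] by (cases "volume Q a b = 0") (auto simp: v_def)
  have rv: "r * v = n * response Q a b" using vol0 by (simp add: r_def v_def)
  have rM: "\<bar>r\<bar> \<le> M" using response_bound[OF Q_subset ub] vol0 by (simp add: r_def abs_divide pos_divide_le_eq)
  have resp: "n * response (insert j Q) (a(j := c)) (b(j := e)) = r * (v * (e - c))"
    if "0 \<le> c" "c \<le> e" "e \<le> 1" for c e
  proof -
    have "unit_box {j} (a(j := c)) (b(j := e))" using that by (simp add: unit_box_def)
    then have "response (Q \<union> {j}) (a(j := c)) (b(j := e)) =
        response Q (a(j := c)) (b(j := e)) * volume {j} (a(j := c)) (b(j := e))"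
      using j by (intro noise_box) auto
    also have "response Q (a(j := c)) (b(j := e)) = response Q a b"
      using j by (intro response_cong) auto
    finally have e: "response (Q \<union> {j}) (a(j := c)) (b(j := e)) =
        response Q a b * volume {j} (a(j := c)) (b(j := e))" .
    have "volume {j} (a(j := c)) (b(j := e)) = e - c" by (simp add: volume_def)
    moreover have "Q \<union> {j} = insert j Q" by simp
    ultimately have "response (insert j Q) (a(j := c)) (b(j := e)) = response Q a b * (e - c)"
      using e by metis
    then show ?thesis using rv by (metis mult.assoc)
  qed
  have T: "\<bar>box_sum n (insert j Q) (a(j := c)) (b(j := e)) S -
      r * box_count n (insert j Q) (a(j := c)) (b(j := e)) S\<bar> \<le> 2 * M * \<eta> * v"
    if ce: "0 \<le> c" "c \<le> e" "e \<le> 1" for c e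
  proof -
    note s = slab_close[OF concI[OF j(1)] finite_Q j(2) ub v_def kv ce]
    have "\<bar>r * box_count n (insert j Q) (a(j := c)) (b(j := e)) S - r * (v * (e - c))\<bar> \<le> M * (\<eta> * v)"
      unfolding right_diff_distrib[symmetric] abs_mult
      using s(1) rM M_pos by (intro mult_mono) auto
    then show ?thesis using s(2) unfolding resp[OF ce] by (simp add: algebra_simps)
  qed
  note hb = halves_bounds[OF f(2) f(6) f(7)]
  have "\<eta> * v \<le> 1 / 10 * v" using \<eta> v0 by (intro mult_right_mono) auto
  \<comment> \<open>The lower half has at least half of the examples, the upper one at least a third.\<close>
  then have mv: "9 / 10 * v \<le> real (card I)" using m by linarith
  have N: "45 / 100 * v \<le> real (card (below S I j \<theta>))" "3 / 10 * v \<le> real (card (above S I j \<theta>))"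
    using hb mv by linarith+
  have e0: "0 \<le> 2 * M * \<eta>" using M_pos eta_pos by simp
  have "\<bar>box_sum n (insert j Q) (a(j := \<theta>)) (b(j := 1)) S / real (card (above S I j \<theta>)) - r\<bar> \<le> 2 * M * \<eta> / (3 / 10)"
    using N(2) v0 e0 T[of \<theta> 1] f(4,5) unfolding e'(2) by (intro ratio_close[of _ v]) auto
  moreover have "\<bar>box_sum n (insert j Q) (a(j := 0)) (b(j := \<theta>)) S / real (card (below S I j \<theta>)) - r\<bar> \<le> 2 * M * \<eta> / (45 / 100)"
    using N(1) v0 e0 T[of 0 \<theta>] f(4,5) unfolding e'(1) by (intro ratio_close[of _ v]) auto
  moreover have "\<bar>u - w\<bar> \<le> p + p'" if "\<bar>u - r\<bar> \<le> p" "\<bar>w - r\<bar> \<le> p'" for u w p p'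
    using that by linarith
  ultimately have "\<bar>split_effect S I j \<theta>\<bar> \<le> 2 * M * \<eta> / (3 / 10) + 2 * M * \<eta> / (45 / 100)"
    unfolding e'(3) by blast
  also have "\<dots> \<le> 12 * M * \<eta>" using e0 by simp
  finally show ?thesis by (simp add: \<theta>_def)
qed

text \<open>
  If \<open>j\<close> has not been split before, the node is unrestricted in \<open>j\<close> and its median is within \<open>2 * \<eta>\<close> of
  \<open>1 / 2\<close>. The two sides of the split are then compared with the two halves of the box, whose mean
  responses differ by at least \<open>\<beta>\<close>.
\<close>

lemma signal_effect_large:
  assumes g: "good_cell I a b" and j: "j \<in> Q" and full: "a j = 0" "b j = 1"
  shows "\<beta> - 24 * M * \<eta> \<le> \<bar>split_effect S I j (split_point S I j)\<bar>"
proof -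
  define \<theta> where "\<theta> = split_point S I j"
  have jd: "j < d" using j Q_subset by auto
  note f = good_cell_facts[OF g jd, folded \<theta>_def]
  \<comment> \<open>Boxes over \<open>Q\<close> are described by their restriction to \<open>R\<close> and an interval for coordinate \<open>j\<close>.\<close>
  define R where "R = Q - {j}"
  have R: "finite R" "j \<notin> R" "insert j R = Q" "R \<subseteq> Q" "R \<subseteq> {..<d} - {j}"
    using j Q_subset by (auto simp: R_def)
  have I: "I = {i. i < n \<and> in_box Q a b (fst (S i))}" and ub: "unit_box Q a b" and c2: "2 * k \<le> card I"
    using g by (auto simp: good_cell_def)
  have ubR: "unit_box R a b" using ub R by (auto simp: unit_box_def)
  have conc: "concentrated n k \<eta> (insert j R) S" using concI[OF jd] j R(3) by (simp add: insert_absorb)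
  define v where "v = n * volume R a b"
  have ab: "a(j := 0) = a" "b(j := 1) = b" using full by auto
  have vQ: "n * volume Q a b = v"
    using volume_insert[OF R(1,2), of a 0 b 1] unfolding ab R(3) by (simp add: v_def)
  have cI: "real (card I) = box_count n Q a b S" by (simp add: box_count_card I)
  have "\<bar>real (card I) - v\<bar> \<le> \<eta> * max v k"
    using conc[unfolded concentrated_def, rule_format, of a b] ub unfolding R(3) vQ cI by simp
  moreover have "2 * real k \<le> real (card I)" using c2 by linarith
  ultimately have kv: "k \<le> v" and m: "\<bar>real (card I) - v\<bar> \<le> \<eta> * v"
    using mass_close[of "real (card I)" v \<eta>] \<eta> eta_pos by auto
  have v0: "v > 0" using kv k_pos by linarith
  have e: "real (card (below S I j \<theta>)) = box_count n (insert j R) (a(j := 0)) (b(j := \<theta>)) S"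
    "real (card (above S I j \<theta>)) = box_count n (insert j R) (a(j := \<theta>)) (b(j := 1)) S"
    "split_effect S I j \<theta> =
      box_sum n (insert j R) (a(j := \<theta>)) (b(j := 1)) S / real (card (above S I j \<theta>)) -
      box_sum n (insert j R) (a(j := 0)) (b(j := \<theta>)) S / real (card (below S I j \<theta>))"
    using split_effect_boxes[OF I jd R(2) _ R(4), of \<theta>] R(3) full by auto
  define Tm where "Tm = box_sum n (insert j R) (a(j := 0)) (b(j := \<theta>)) S"
  define Tp where "Tp = box_sum n (insert j R) (a(j := \<theta>)) (b(j := 1)) S"
  define Nm where "Nm = real (card (below S I j \<theta>))"
  define Np where "Np = real (card (above S I j \<theta>))"
  define resp where "resp c e = n * response (insert j R) (a(j := c)) (b(j := e))" for c e
  define mI where "mI = real (card I)"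
  note hb = halves_bounds[OF f(2) f(6) f(7), folded Nm_def Np_def mI_def] and m = m[folded mI_def]
  have \<eta>v: "1 \<le> \<eta> * v" "\<eta> * v \<le> v / 10"
  proof -
    have "\<eta> * k \<le> \<eta> * v" using kv eta_pos by (intro mult_left_mono) auto
    then show "1 \<le> \<eta> * v" using \<eta> by linarith
    show "\<eta> * v \<le> v / 10" using \<eta> v0 mult_right_mono[of \<eta> "1 / 10" v] by simp
  qed
  have s1: "\<bar>Nm - v * \<theta>\<bar> \<le> \<eta> * v" "\<bar>Tm - resp 0 \<theta>\<bar> \<le> M * (\<eta> * v)"
    using slab_close[OF conc R(1,2) ubR v_def kv, of 0 \<theta>] f(4,5)
    unfolding Nm_def e(1) Tm_def resp_def by auto
  have s2: "\<bar>Tp - resp \<theta> 1\<bar> \<le> M * (\<eta> * v)"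
    using slab_close[OF conc R(1,2) ubR v_def kv, of \<theta> 1] f(4,5)
    unfolding Tp_def resp_def by auto
  have th: "\<bar>v * (\<theta> - 1 / 2)\<bar> \<le> 2 * (\<eta> * v)"
  proof -
    have eq: "v * (\<theta> - 1 / 2) = v * \<theta> - v / 2" by (simp add: algebra_simps)
    have a: "v * \<theta> \<le> Nm + \<eta> * v" "Nm \<le> v * \<theta> + \<eta> * v" using s1(1) by linarith+
    have b: "mI \<le> v + \<eta> * v" "v \<le> mI + \<eta> * v" using m by linarith+
    have "v * \<theta> - v / 2 \<le> 2 * (\<eta> * v)" using a(1) b(1) hb(2) \<eta>v(1) by linarith
    moreover have "- (2 * (\<eta> * v)) \<le> v * \<theta> - v / 2" using a(2) b(2) hb(1) \<eta>v(1) by linarith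
    ultimately show ?thesis unfolding eq by (simp add: abs_le_iff)
  qed
  have half: "\<bar>resp 0 \<theta> - resp 0 (1 / 2)\<bar> \<le> M * (2 * (\<eta> * v))" "\<bar>resp \<theta> 1 - resp (1 / 2) 1\<bar> \<le> M * (2 * (\<eta> * v))"
  proof -
    have D: "\<bar>resp c e - resp c' e'\<bar> \<le> M * (v * ((e - c) - (e' - c')))"
      if "0 \<le> c" "c \<le> c'" "c' \<le> e'" "e' \<le> e" "e \<le> 1" for c c' e e'
    proof -
      have "\<bar>response (insert j R) (a(j := c)) (b(j := e)) - response (insert j R) (a(j := c')) (b(j := e'))\<bar> \<le>
          M * (volume (insert j R) (a(j := c)) (b(j := e)) - volume (insert j R) (a(j := c')) (b(j := e')))"
        using that R(3) Q_subset by (intro response_diff unit_box_insert ubR) auto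
      then have "n * \<bar>response (insert j R) (a(j := c)) (b(j := e)) - response (insert j R) (a(j := c')) (b(j := e'))\<bar> \<le>
          n * (M * (volume (insert j R) (a(j := c)) (b(j := e)) - volume (insert j R) (a(j := c')) (b(j := e'))))"
        by (rule mult_left_mono) simp
      also have "\<dots> = M * (v * ((e - c) - (e' - c')))"
        by (simp add: volume_insert[OF R(1,2)] v_def algebra_simps)
      finally show ?thesis
        unfolding resp_def right_diff_distrib[symmetric] by (simp add: abs_mult)
    qed
    have X: "M * \<bar>v * (\<theta> - 1 / 2)\<bar> \<le> M * (2 * (\<eta> * v))" using th M_pos by (intro mult_left_mono) auto
    have "\<bar>resp 0 \<theta> - resp 0 (1 / 2)\<bar> \<le> M * \<bar>v * (\<theta> - 1 / 2)\<bar> \<and> \<bar>resp \<theta> 1 - resp (1 / 2) 1\<bar> \<le> M * \<bar>v * (\<theta> - 1 / 2)\<bar>"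
    proof (cases "\<theta> \<le> 1 / 2")
      case True
      then have "v * (1 / 2 - \<theta>) = \<bar>v * (\<theta> - 1 / 2)\<bar>" using v0 by (simp add: abs_mult)
      then show ?thesis
        using D[of 0 0 \<theta> "1 / 2"] D[of \<theta> "1 / 2" 1 1] True f(4) by (simp add: abs_minus_commute)
    next
      case False
      then have "v * (\<theta> - 1 / 2) = \<bar>v * (\<theta> - 1 / 2)\<bar>" using v0 by simp
      then show ?thesis
        using D[of 0 0 "1 / 2" \<theta>] D[of "1 / 2" \<theta> 1 1] False f(5) by (simp add: abs_minus_commute)
    qed
    then show "\<bar>resp 0 \<theta> - resp 0 (1 / 2)\<bar> \<le> M * (2 * (\<eta> * v))" "\<bar>resp \<theta> 1 - resp (1 / 2) 1\<bar> \<le> M * (2 * (\<eta> * v))"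
      using X by linarith+
  qed
  define rm where "rm = resp 0 (1 / 2) / (v / 2)"
  define rp where "rp = resp (1 / 2) 1 / (v / 2)"
  have bnd: "\<bar>resp c e / (v / 2)\<bar> \<le> M" if "0 \<le> c" "c \<le> e" "e \<le> 1" "e - c = 1 / 2" for c e
  proof -
    have "\<bar>response (insert j R) (a(j := c)) (b(j := e))\<bar> \<le> M * volume (insert j R) (a(j := c)) (b(j := e))"
      using that R(3) Q_subset by (intro response_bound unit_box_insert ubR) auto
    then have "n * \<bar>response (insert j R) (a(j := c)) (b(j := e))\<bar> \<le> n * (M * volume (insert j R) (a(j := c)) (b(j := e)))"
      by (intro mult_left_mono) auto
    also have "\<dots> = M * (v / 2)" using that(4) by (simp add: volume_insert[OF R(1,2)] v_def)
    finally have "\<bar>resp c e\<bar> \<le> M * (v / 2)" by (simp add: resp_def abs_mult)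
    then show ?thesis using v0 by (simp add: abs_divide pos_divide_le_eq)
  qed
  have rM: "\<bar>rm\<bar> \<le> M" "\<bar>rp\<bar> \<le> M" unfolding rm_def rp_def
    by (rule bnd; simp)+
  have rv: "resp 0 (1 / 2) = rm * (v / 2)" "resp (1 / 2) 1 = rp * (v / 2)"
    using v0 by (simp_all add: rm_def rp_def)
  have Nc: "\<bar>v / 2 - Nm\<bar> \<le> \<eta> * v" "\<bar>v / 2 - Np\<bar> \<le> \<eta> * v" using hb m \<eta>v by linarith+
  have close: "\<bar>T - r * N\<bar> \<le> 4 * M * \<eta> * v"
    if "\<bar>T - x\<bar> \<le> M * (\<eta> * v)" "\<bar>x - r * (v / 2)\<bar> \<le> M * (2 * (\<eta> * v))" "\<bar>r\<bar> \<le> M" "\<bar>v / 2 - N\<bar> \<le> \<eta> * v"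
    for T x r N
  proof -
    have "\<bar>r * (v / 2) - r * N\<bar> \<le> M * (\<eta> * v)"
      unfolding right_diff_distrib[symmetric] abs_mult using that M_pos by (intro mult_mono) auto
    then have "\<bar>T - r * N\<bar> \<le> M * (\<eta> * v) + M * (2 * (\<eta> * v)) + M * (\<eta> * v)" using that by linarith
    then show ?thesis by (simp add: algebra_simps)
  qed
  have N: "1 / 3 * v \<le> Nm" "1 / 3 * v \<le> Np" using Nc \<eta>v by linarith+
  have e0: "0 \<le> 4 * M * \<eta>" using M_pos eta_pos by simp
  have r1: "\<bar>Tm / Nm - rm\<bar> \<le> 4 * M * \<eta> / (1 / 3)"
    using N v0 e0 close[OF s1(2) half(1)[unfolded rv] rM(1) Nc(1)] by (intro ratio_close[of _ v]) auto
  have r2: "\<bar>Tp / Np - rp\<bar> \<le> 4 * M * \<eta> / (1 / 3)"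
    using N v0 e0 close[OF s2 half(2)[unfolded rv] rM(2) Nc(2)] by (intro ratio_close[of _ v]) auto
  have "\<beta> / 2 * volume R a b \<le> \<sigma> j *
    (response (insert j R) (a(j := 1 / 2)) (b(j := 1)) - response (insert j R) (a(j := 0)) (b(j := 1 / 2)))"
    by (rule signal_effect[OF j R(5) ubR])
  then have "n * (\<beta> / 2 * volume R a b) \<le> n * (\<sigma> j *
    (response (insert j R) (a(j := 1 / 2)) (b(j := 1)) - response (insert j R) (a(j := 0)) (b(j := 1 / 2))))"
    by (intro mult_left_mono) auto
  then have "\<beta> * (v / 2) \<le> \<sigma> j * (resp (1 / 2) 1 - resp 0 (1 / 2))"
    by (simp add: resp_def v_def algebra_simps)
  also have "\<dots> = (\<sigma> j * (rp - rm)) * (v / 2)" unfolding rv by (simp add: algebra_simps)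
  finally have "\<beta> \<le> \<sigma> j * (rp - rm)" using v0 by simp
  moreover have "\<bar>\<sigma> j\<bar> = 1" using signs[OF j] by auto
  ultimately have "\<beta> \<le> \<bar>rp - rm\<bar>" by (metis abs_ge_self abs_mult mult_1 order_trans)
  moreover have "split_effect S I j \<theta> = Tp / Np - Tm / Nm" unfolding e(3) Tm_def Tp_def Nm_def Np_def by simp
  ultimately show ?thesis using r1 r2 unfolding \<theta>_def[symmetric] by simp
qed

text \<open>
  Half of the examples means nearly half of the volume, and cutting along \<open>j\<close> changes the volume in
  proportion to side \<open>j\<close>.
\<close>

lemma child_side:
  assumes x: "x \<in> pos_cube d" and js: "js \<in> lists Q" and c: "2 * k \<le> card (cell_members n S x js)" and j: "j \<in> Q"
  shows "side n S x (js @ [j]) j \<le> (1 + 6 * \<epsilon>) / 2 * side n S x js j"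
    and "i \<noteq> j \<Longrightarrow> side n S x (js @ [j]) i = side n S x js i"
    and "0 \<le> side n S x (js @ [j]) j" "side n S x (js @ [j]) j \<le> side n S x js j"
proof -
  let ?I = "cell_members n S x js" and ?a = "cell_lower n S x js" and ?b = "cell_upper n S x js"
  let ?I' = "cell_members n S x (js @ [j])" and ?a' = "cell_lower n S x (js @ [j])" and ?b' = "cell_upper n S x (js @ [j])"
  define \<theta> where "\<theta> = split_point S ?I j"
  have jd: "j < d" using j Q_subset by auto
  have g: "good_cell ?I ?a ?b" by (rule good_cell_cell[OF x js c])
  note f = good_cell_facts[OF g jd, folded \<theta>_def]
  have upd: "?a' = (if x j \<le> \<theta> then ?a else ?a(j := \<theta>))" "?b' = (if x j \<le> \<theta> then ?b(j := \<theta>) else ?b)"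
    by (simp_all add: cell_bounds_simps \<theta>_def Let_def)
  show "i \<noteq> j \<Longrightarrow> side n S x (js @ [j]) i = side n S x js i"
    by (auto simp: side_def upd)
  have cd: "card ?I div 2 \<le> card ?I'" "card ?I' \<le> (card ?I + 1) div 2"
    using card_descend[OF f(1) f(3), of x] by simp_all
  then have kI': "k \<le> card ?I'" using c by linarith
  then have ne': "?I' \<noteq> {}" using k_pos by auto
  have js': "js @ [j] \<in> lists Q" using js j by simp
  note cb = cell_box[OF gen x Q_subset js' ne']
  have ne: "?I \<noteq> {}" using f(2) by auto
  note cb0 = cell_box[OF gen x Q_subset js ne]
  have sd: "0 \<le> side n S x (js @ [j]) i" if "i < d" for i
  proof -
    have "?a' i < x i" "x i \<le> ?b' i" using cb that by (auto simp: in_box_def)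
    then show ?thesis by (simp add: side_def)
  qed
  show "0 \<le> side n S x (js @ [j]) j" by (rule sd[OF jd])
  have "?a j \<le> \<theta>" "\<theta> \<le> ?b j"
  proof -
    have "?a j < median ?I (\<lambda>i. fst (S i) j)" "median ?I (\<lambda>i. fst (S i) j) \<le> ?b j"
      using j cb0 by (intro median_between[OF f(1) ne]; auto simp: in_box_def)+
    then show "?a j \<le> \<theta>" "\<theta> \<le> ?b j" by (auto simp: \<theta>_def split_point_def)
  qed
  then show "side n S x (js @ [j]) j \<le> side n S x js j" by (auto simp: side_def upd)
  define R where "R = Q - {j}"
  have R: "finite R" "j \<notin> R" "insert j R = Q" using j by (auto simp: R_def)
  define w where "w = n * volume R ?a ?b"
  have vol: "n * volume Q ?a ?b = w * side n S x js j" "n * volume Q ?a' ?b' = w * side n S x (js @ [j]) j"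
  proof -
    have "volume Q u t = volume R u t * (t j - u j)" for u t :: point
      unfolding volume_def R(3)[symmetric] using R(1,2) by (simp add: mult.commute)
    moreover have "volume R ?a' ?b' = volume R ?a ?b"
      unfolding volume_def using R(2) by (intro prod.cong refl) (auto simp: upd)
    ultimately show "n * volume Q ?a ?b = w * side n S x js j" "n * volume Q ?a' ?b' = w * side n S x (js @ [j]) j"
      by (simp_all add: w_def side_def)
  qed
  define v where "v = n * volume Q ?a ?b"
  define v' where "v' = n * volume Q ?a' ?b'"
  define m where "m = real (card ?I)"
  define m' where "m' = real (card ?I')"
  have ub: "unit_box Q ?a ?b" using g by (simp add: good_cell_def)
  have ub': "unit_box Q ?a' ?b'"
    unfolding unit_box_def
  proof
    fix i assume "i \<in> Q"
    then have "i < d" using Q_subset by auto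
    then show "0 \<le> ?a' i \<and> ?a' i \<le> ?b' i \<and> ?b' i \<le> 1" using cb sd[of i] by (simp add: side_def)
  qed
  have "m = box_count n Q ?a ?b S" "m' = box_count n Q ?a' ?b' S"
    unfolding m_def m'_def box_count_card using cb cb0 by auto
  then have cm: "\<bar>m - v\<bar> \<le> \<epsilon> * max v k" and cm': "\<bar>m' - v'\<bar> \<le> \<epsilon> * max v' k"
    using concQ ub ub' unfolding concentrated_def v_def v'_def by auto
  have "2 * real k \<le> m" using c unfolding m_def by linarith
  then have kv: "k \<le> v" and m: "\<bar>m - v\<bar> \<le> \<epsilon> * v"
    using mass_close[OF cm] \<epsilon> eta_pos by auto
  have km': "real k \<le> m'" using kI' by (simp add: m'_def)
  have v0: "v > 0" using kv k_pos by linarith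
  have \<epsilon>v: "1 \<le> \<epsilon> * v"
  proof -
    have "\<epsilon> * k \<le> \<epsilon> * v" using kv eta_pos by (intro mult_left_mono) auto
    then show "1 \<le> \<epsilon> * v" using \<epsilon> by linarith
  qed
  have "2 * card ?I' \<le> card ?I + 1" using cd(2) by linarith
  then have m'_m: "2 * m' \<le> m + 1" unfolding m_def m'_def by linarith
  have v'm': "(1 - \<epsilon>) * v' \<le> m'"
  proof (cases "k \<le> v'")
    case True
    then have "\<bar>m' - v'\<bar> \<le> \<epsilon> * v'" using cm' by (simp add: max_def split: if_splits)
    then show ?thesis by (simp add: algebra_simps)
  next
    case False
    have "v' \<ge> 0" unfolding v'_def using volume_nonneg[OF ub'] by simp
    then have "(1 - \<epsilon>) * v' \<le> 1 * v'" using eta_pos by (intro mult_right_mono) auto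
    then show ?thesis using False km' by simp
  qed
  \<comment> \<open>One \<open>\<epsilon> * v\<close> is the deviation of the count of the parent, the other covers the rounding of its half.\<close>
  have "(1 - \<epsilon>) * v' \<le> (1 + 2 * \<epsilon>) / 2 * v"
  proof -
    have "2 * ((1 - \<epsilon>) * v') \<le> v + \<epsilon> * v + \<epsilon> * v" using v'm' m'_m m \<epsilon>v by linarith
    then show ?thesis by (simp add: algebra_simps)
  qed
  also have "\<dots> \<le> (1 - \<epsilon>) * ((1 + 6 * \<epsilon>) / 2) * v"
  proof (rule mult_right_mono)
    have "\<epsilon> * \<epsilon> \<le> \<epsilon> * (1 / 10)" using eta_pos \<epsilon> by (intro mult_left_mono) auto
    then have "1 + 2 * \<epsilon> \<le> 1 + 5 * \<epsilon> - 6 * (\<epsilon> * \<epsilon>)" using eta_pos by linarith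
    then show "(1 + 2 * \<epsilon>) / 2 \<le> (1 - \<epsilon>) * ((1 + 6 * \<epsilon>) / 2)" using eta_pos by (simp add: field_simps)
  qed (use v0 in simp)
  finally have "(1 - \<epsilon>) * v' \<le> (1 - \<epsilon>) * ((1 + 6 * \<epsilon>) / 2 * v)" by (simp add: mult.assoc)
  then have "v' \<le> (1 + 6 * \<epsilon>) / 2 * v" using \<epsilon> by simp
  then have "w * side n S x (js @ [j]) j \<le> w * ((1 + 6 * \<epsilon>) / 2 * side n S x js j)"
    using vol by (simp add: v_def v'_def mult.left_commute)
  moreover have "w > 0"
  proof -
    have "unit_box R ?a ?b" using ub by (auto simp: unit_box_def R_def)
    then have "w \<ge> 0" using volume_nonneg by (simp add: w_def)
    moreover have "w \<noteq> 0" using v0 vol(1) by (auto simp: v_def)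
    ultimately show ?thesis by simp
  qed
  ultimately show "side n S x (js @ [j]) j \<le> (1 + 6 * \<epsilon>) / 2 * side n S x js j" by simp
qed

lemma passes_check_iff_signal:
  assumes thr: "144 * (M * \<eta>)\<^sup>2 < split_threshold (1 / 2) M n d k" "split_threshold (1 / 2) M n d k \<le> \<beta>\<^sup>2 / 6"
    and small: "48 * M * \<eta> \<le> \<beta>"
    and x: "x \<in> pos_cube d" and js: "js \<in> lists Q" and c: "2 * k \<le> card (cell_members n S x js)"
  shows "j < d \<Longrightarrow> j \<notin> Q \<Longrightarrow> \<not> passes_check M n d k S (cell_members n S x js) j"
    and "j \<in> Q \<Longrightarrow> j \<notin> set js \<Longrightarrow> passes_check M n d k S (cell_members n S x js) j"
proof -
  let ?I = "cell_members n S x js"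
  have g: "good_cell ?I (cell_lower n S x js) (cell_upper n S x js)" by (rule good_cell_cell[OF x js c])
  show "\<not> passes_check M n d k S ?I j" if j: "j < d" "j \<notin> Q"
  proof -
    have "(split_effect S ?I j (split_point S ?I j))\<^sup>2 \<le> (12 * M * \<eta>)\<^sup>2"
      using noise_effect[OF g j] M_pos eta_pos by (intro abs_le_square_iff[THEN iffD1]) auto
    then have "split_gain S ?I j (split_point S ?I j) \<le> 144 * (M * \<eta>)\<^sup>2"
      using split_gain_le[of S ?I j "split_point S ?I j"] by (simp add: power_mult_distrib)
    then show ?thesis using thr(1) by (simp add: passes_check_def)
  qed
  show "passes_check M n d k S ?I j" if j: "j \<in> Q" "j \<notin> set js"
  proof -
    have jd: "j < d" using j Q_subset by auto
    have "?I \<noteq> {}" using c k_pos by auto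
    then have full: "cell_lower n S x js j = 0" "cell_upper n S x js j = 1"
      using cell_box[OF gen x Q_subset js] j by auto
    have "\<beta> / 2 \<le> \<bar>split_effect S ?I j (split_point S ?I j)\<bar>"
      using signal_effect_large[OF g j(1) full] small by linarith
    then have "(\<beta> / 2)\<^sup>2 \<le> (split_effect S ?I j (split_point S ?I j))\<^sup>2"
      using beta by (subst power2_abs[symmetric], intro power_mono) auto
    then have "\<beta>\<^sup>2 / 6 \<le> 2 / 3 * (split_effect S ?I j (split_point S ?I j))\<^sup>2" by (simp add: power_divide)
    also have "\<dots> \<le> split_gain S ?I j (split_point S ?I j)"
      using good_cell_facts[OF g jd] by (intro split_gain_ge) auto
    finally show ?thesis using thr(2) by (simp add: passes_check_def)
  qed
qed

end

section \<open>Error of the tree grown on a concentrated sample\<close>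

lemma grown_leaf_nonempty:
  "grown S Q I T \<Longrightarrow> foldl (descend S x) I (path_vars T x) \<noteq> {}"
proof (induction T arbitrary: I)
  case (Split j \<theta> l r)
  then show ?case by (cases "x j \<le> \<theta>") (auto simp: descend_def)
qed simp

text \<open>
  Averaged over the split variable, one of \<open>card Q\<close> squared sides shrinks by the factor \<open>c\<close>. The bound is
  stated with \<open>q\<close> because a smaller signal set contracts faster.
\<close>

lemma contraction_sum:
  fixes w :: "nat \<Rightarrow> real" and w' :: "nat \<Rightarrow> nat \<Rightarrow> real"
  assumes Q: "finite Q" "Q \<noteq> {}" "card Q \<le> q" and c: "0 \<le> c" "c \<le> 1"
    and w: "\<And>i. i \<in> Q \<Longrightarrow> 0 \<le> w i"
    and same: "\<And>i j. i \<in> Q \<Longrightarrow> j \<in> Q \<Longrightarrow> i \<noteq> j \<Longrightarrow> w' j i = w i"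
    and shrink: "\<And>j. j \<in> Q \<Longrightarrow> w' j j \<le> c * w j"
  shows "(\<Sum>j\<in>Q. \<Sum>i\<in>Q. w' j i) \<le> real (card Q) * (1 - (1 - c) / real q) * (\<Sum>i\<in>Q. w i)"
proof -
  let ?W = "\<Sum>i\<in>Q. w i"
  have s: "card Q > 0" using Q by (simp add: card_gt_0_iff)
  have W: "?W \<ge> 0" by (intro sum_nonneg w)
  have "(\<Sum>i\<in>Q. w' j i) \<le> ?W - (1 - c) * w j" if j: "j \<in> Q" for j
  proof -
    have "(\<Sum>i\<in>Q. w' j i) = w' j j + (\<Sum>i\<in>Q - {j}. w' j i)" by (rule sum.remove[OF Q(1) j])
    also have "(\<Sum>i\<in>Q - {j}. w' j i) = (\<Sum>i\<in>Q - {j}. w i)" using j same by (intro sum.cong) auto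
    also have "\<dots> = ?W - w j" using sum.remove[OF Q(1) j, of w] by simp
    finally show ?thesis using shrink[OF j] by (simp add: algebra_simps)
  qed
  then have "(\<Sum>j\<in>Q. \<Sum>i\<in>Q. w' j i) \<le> (\<Sum>j\<in>Q. ?W - (1 - c) * w j)" by (rule sum_mono)
  also have "\<dots> = real (card Q) * ?W - (1 - c) * ?W" by (simp add: sum_subtractf sum_distrib_left)
  also have "\<dots> \<le> real (card Q) * ?W - real (card Q) * ((1 - c) / real q) * ?W"
  proof -
    have "real (card Q) * (1 - c) / real q \<le> real q * (1 - c) / real q"
      using Q(3) c by (intro divide_right_mono mult_right_mono) auto
    then have "real (card Q) * ((1 - c) / real q) \<le> (1 - c)" using Q(3) s by simp
    from mult_right_mono[OF this W] show ?thesis by linarith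
  qed
  also have "\<dots> = real (card Q) * (1 - (1 - c) / real q) * ?W" by (simp add: algebra_simps)
  finally show ?thesis .
qed

context sparse_model
begin

lemma predict_bounded:
  assumes "\<And>i. i < n \<Longrightarrow> \<bar>snd (S i)\<bar> \<le> M"
  shows "\<bar>predict n d S T x\<bar> \<le> M"
proof -
  let ?I = "members n d S T (leaf_of T x)"
  have "\<bar>\<Sum>i\<in>?I. snd (S i)\<bar> \<le> (\<Sum>i\<in>?I. M)"
    using assms by (intro order_trans[OF sum_abs] sum_mono) (auto simp: members_def)
  then have "\<bar>\<Sum>i\<in>?I. snd (S i)\<bar> \<le> real (card ?I) * M" by simp
  then show ?thesis
    using M_pos by (cases "card ?I = 0") (auto simp: predict_def Let_def abs_divide pos_divide_le_eq mult.commute)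
qed

end

context concentrated_sample
begin

text \<open>
  Both \<open>x\<close> and the examples in its cell lie in the same box, and the regression function only sees the
  signal coordinates.
\<close>

lemma leaf_bias:
  assumes x: "x \<in> pos_cube d" and js: "js \<in> lists Q" and ne: "cell_members n S x js \<noteq> {}"
  shows "((\<Sum>i\<in>cell_members n S x js. f (fst (S i))) / real (card (cell_members n S x js)) - f x)\<^sup>2
     \<le> L\<^sup>2 * (\<Sum>j\<in>Q. (side n S x js j)\<^sup>2)"
proof -
  let ?I = "cell_members n S x js"
  note cb = cell_box[OF gen x Q_subset js ne]
  define B where "B = L\<^sup>2 * (\<Sum>j\<in>Q. (side n S x js j)\<^sup>2)"
  have B0: "B \<ge> 0" unfolding B_def by (intro mult_nonneg_nonneg sum_nonneg) auto
  have pt: "\<bar>f (fst (S i)) - f x\<bar> \<le> sqrt B" if i: "i \<in> ?I" for i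
  proof -
    have iQ: "i < n" "in_box Q (cell_lower n S x js) (cell_upper n S x js) (fst (S i))" using i cb by auto
    then have X: "fst (S i) \<in> pos_cube d" using gen by (auto simp: generic_def)
    have "\<bar>f (fst (S i)) - f x\<bar> \<le> L * L2_set (\<lambda>j. fst (S i) j - x j) Q" by (rule lipschitz_signal[OF X x])
    then have "(f (fst (S i)) - f x)\<^sup>2 \<le> (L * L2_set (\<lambda>j. fst (S i) j - x j) Q)\<^sup>2"
      by (intro abs_le_square_iff[THEN iffD1]) auto
    also have "\<dots> = L\<^sup>2 * (\<Sum>j\<in>Q. (fst (S i) j - x j)\<^sup>2)"
      by (simp add: power_mult_distrib L2_set_def sum_nonneg)
    also have "\<dots> \<le> B"
      unfolding B_def
    proof (intro mult_left_mono sum_mono)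
      fix j assume j: "j \<in> Q"
      then have "cell_lower n S x js j < x j" "x j \<le> cell_upper n S x js j" using cb Q_subset by (auto simp: in_box_def)
      moreover have "cell_lower n S x js j < fst (S i) j" "fst (S i) j \<le> cell_upper n S x js j"
        using iQ(2) j by (auto simp: in_box_def)
      ultimately have "\<bar>fst (S i) j - x j\<bar> \<le> \<bar>side n S x js j\<bar>" unfolding side_def by linarith
      then show "(fst (S i) j - x j)\<^sup>2 \<le> (side n S x js j)\<^sup>2" by (rule abs_le_square_iff[THEN iffD1])
    qed simp
    finally have "sqrt ((f (fst (S i)) - f x)\<^sup>2) \<le> sqrt B" by (rule real_sqrt_le_mono)
    then show ?thesis by simp
  qed
  have c: "real (card ?I) > 0" using ne by (simp add: card_gt_0_iff)
  have "(\<Sum>i\<in>?I. f (fst (S i))) / real (card ?I) - f x = (\<Sum>i\<in>?I. f (fst (S i)) - f x) / real (card ?I)"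
    using c ne by (simp add: sum_subtractf diff_divide_distrib)
  also have "\<bar>\<dots>\<bar> \<le> (\<Sum>i\<in>?I. sqrt B) / real (card ?I)"
    using c pt by (simp only: abs_divide abs_of_nat)
      (intro divide_right_mono order_trans[OF sum_abs] sum_mono, auto)
  also have "\<dots> = sqrt B" using c ne by simp
  finally have "\<bar>(\<Sum>i\<in>?I. f (fst (S i))) / real (card ?I) - f x\<bar> \<le> sqrt B" .
  then have "((\<Sum>i\<in>?I. f (fst (S i))) / real (card ?I) - f x)\<^sup>2 \<le> (sqrt B)\<^sup>2"
    by (subst power2_abs[symmetric], intro power_mono) auto
  then show ?thesis using B0 by (simp add: B_def)
qed

text \<open>
  The potential is twice the sum of the two functions described above. The bias part carries the factor
  \<open>\<rho> ^ (t - length js)\<close>, so that it does not increase on average for lists shorter than \<open>t\<close>, and equals the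
  sum of squared sides at leaves, which have depth at least \<open>t\<close>.
\<close>

lemma tree_error_bound:
  assumes thr: "144 * (M * \<eta>)\<^sup>2 < split_threshold (1 / 2) M n d k" "split_threshold (1 / 2) M n d k \<le> \<beta>\<^sup>2 / 6"
    and small: "48 * M * \<eta> \<le> \<beta>"
    and q: "card Q \<le> q" "q \<ge> 1" and d: "d \<ge> 1" and t: "2 ^ t * k \<le> n"
    and Y: "\<And>i. i < n \<Longrightarrow> \<bar>snd (S i)\<bar> \<le> M"
    and sel: "valid_selection_rule M n d k D sel" and S: "S \<in> space (train n)"
    and x: "x \<in> pos_cube d"
    and \<rho>: "\<rho> = 1 - (1 - ((1 + 6 * \<epsilon>) / 2)\<^sup>2) / real q"
  shows "(\<integral>\<^sup>+J. ennreal ((predict n d S (final_tree M n d k sel S J) x - f x)\<^sup>2) \<partial>candidate_law d) \<le>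
     2 * noise_average n k x Q n [] S + ennreal (2 * L\<^sup>2 * real q * \<rho> ^ t)"
proof -
  have n1: "n \<ge> 1" using t k_pos by (cases n) auto
  interpret G: good_sample M n d k S Q sel
  proof
    show "\<And>J t. J \<in> UNIV \<rightarrow> {..<d} \<Longrightarrow> \<not> stopped M n d k S (tree_at M n d k sel S J t) \<Longrightarrow>
          sel S (map J [0..<t]) \<in> leaves (tree_at M n d k sel S J t) \<and>
          2 * k \<le> card (members n d S (tree_at M n d k sel S J t) (sel S (map J [0..<t])))"
      using sel S by (auto simp: valid_selection_rule_def train_def Let_def)
  qed (use n1 k_pos d Q_subset gen passes_check_iff_signal[OF thr small] in auto)
  define c where "c = ((1 + 6 * \<epsilon>) / 2)\<^sup>2"
  have c: "0 \<le> c" "c \<le> 1"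
  proof -
    have "((1 + 6 * \<epsilon>) / 2)\<^sup>2 \<le> 1\<^sup>2" using \<epsilon> eta_pos by (intro power_mono) auto
    then show "0 \<le> c" "c \<le> 1" by (simp_all add: c_def)
  qed
  have \<rho>c: "\<rho> = 1 - (1 - c) / real q" by (simp add: \<rho> c_def)
  have \<rho>01: "0 \<le> \<rho>" "\<rho> \<le> 1" using c q by (simp_all add: \<rho>c)
  define W where "W js = (\<Sum>i\<in>Q. (side n S x js i)\<^sup>2)" for js
  have W0: "W js \<ge> 0" for js unfolding W_def by (intro sum_nonneg) auto
  define V where "V js = 2 * noise_average n k x Q (n - length js) js S +
      ennreal (2 * L\<^sup>2 * W js * \<rho> ^ (t - length js))" for js
  have stepW: "(\<Sum>j\<in>Q. W (js @ [j])) \<le> real (card Q) * \<rho> * W js"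
    if js: "js \<in> lists Q" and cc: "2 * k \<le> card (cell_members n S x js)" and ne: "Q \<noteq> {}" for js
    unfolding W_def \<rho>c
  proof (rule contraction_sum[OF finite_Q ne q(1) c])
    fix j assume j: "j \<in> Q"
    note cs = child_side[OF x js cc j]
    show "(side n S x (js @ [j]) j)\<^sup>2 \<le> c * (side n S x js j)\<^sup>2"
      using power_mono[OF cs(1) cs(3), of 2] by (simp only: c_def power_mult_distrib)
    show "(side n S x (js @ [j]) i)\<^sup>2 = (side n S x js i)\<^sup>2" if "i \<in> Q" "i \<noteq> j" for i
      using cs(2)[OF that(2)] by simp
  qed simp
  have step: "(\<Sum>j\<in>Q. V (js @ [j])) \<le> of_nat (card Q) * V js"
    if js: "js \<in> lists Q" and cc: "2 * k \<le> card (cell_members n S x js)" for js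
  proof (cases "Q = {}")
    case False
    then have s: "card Q > 0" by (simp add: card_gt_0_iff)
    have jsd: "js \<in> lists {..<d}" using js Q_subset by auto
    have "card (cell_members n S x js) + length js \<le> n"
      using cc k_pos by (intro card_cell_plus_length[OF gen jsd]) linarith
    then have "length js < n" using cc k_pos by linarith
    then have h: "n - length js = Suc (n - length (js @ [j]))" for j by simp
    have A: "(\<Sum>j\<in>Q. noise_average n k x Q (n - length (js @ [j])) (js @ [j]) S) =
        of_nat (card Q) * noise_average n k x Q (n - length js) js S"
    proof -
      have "noise_average n k x Q (n - length js) js S =
          (\<Sum>j\<in>Q. noise_average n k x Q (n - Suc (length js)) (js @ [j]) S) / of_nat (card Q)"
        unfolding noise_average_def h[of undefined] using cc False by simp
      moreover have "X * of_nat (card Q) / of_nat (card Q) = X" for X :: ennreal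
        using s by (intro ennreal_mult_divide_eq) auto
      ultimately show ?thesis by (simp add: ennreal_times_divide mult.commute[of "of_nat (card Q)"])
    qed
    have B: "(\<Sum>j\<in>Q. 2 * L\<^sup>2 * W (js @ [j]) * \<rho> ^ (t - length (js @ [j]))) \<le>
        real (card Q) * (2 * L\<^sup>2 * W js * \<rho> ^ (t - length js))"
    proof -
      let ?r = "\<rho> ^ (t - Suc (length js))"
      have r: "0 \<le> ?r" "\<rho> * ?r \<le> \<rho> ^ (t - length js)"
      proof -
        show "0 \<le> ?r" using \<rho>01 by simp
        show "\<rho> * ?r \<le> \<rho> ^ (t - length js)"
        proof (cases "length js < t")
          case True
          then have "t - length js = Suc (t - Suc (length js))" by simp
          then show ?thesis by simp
        qed (use \<rho>01 in simp)
      qed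
      have "(\<Sum>j\<in>Q. 2 * L\<^sup>2 * W (js @ [j]) * \<rho> ^ (t - length (js @ [j]))) = 2 * L\<^sup>2 * ?r * (\<Sum>j\<in>Q. W (js @ [j]))"
        by (simp add: sum_distrib_left mult.assoc mult.commute mult.left_commute)
      also have "\<dots> \<le> 2 * L\<^sup>2 * ?r * (real (card Q) * \<rho> * W js)"
        using stepW[OF js cc False] r by (intro mult_left_mono) auto
      also have "\<dots> = (real (card Q) * (2 * L\<^sup>2 * W js)) * (\<rho> * ?r)" by (simp add: algebra_simps)
      also have "\<dots> \<le> (real (card Q) * (2 * L\<^sup>2 * W js)) * \<rho> ^ (t - length js)"
        using r W0[of js] by (intro mult_left_mono) auto
      finally show ?thesis by (simp add: mult.assoc)
    qed
    have "(\<Sum>j\<in>Q. V (js @ [j])) =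
        2 * (\<Sum>j\<in>Q. noise_average n k x Q (n - length (js @ [j])) (js @ [j]) S) +
        ennreal (\<Sum>j\<in>Q. 2 * L\<^sup>2 * W (js @ [j]) * \<rho> ^ (t - length (js @ [j])))"
      unfolding V_def using \<rho>01 W0 by (simp add: sum.distrib sum_distrib_left sum_ennreal)
    also have "\<dots> \<le> 2 * (of_nat (card Q) * noise_average n k x Q (n - length js) js S) +
        ennreal (real (card Q) * (2 * L\<^sup>2 * W js * \<rho> ^ (t - length js)))"
      unfolding A by (intro add_mono order_refl ennreal_leI B)
    also have "ennreal (real (card Q) * (2 * L\<^sup>2 * W js * \<rho> ^ (t - length js))) =
        of_nat (card Q) * ennreal (2 * L\<^sup>2 * W js * \<rho> ^ (t - length js))"
      by (simp add: ennreal_mult' ennreal_of_nat_eq_real_of_nat)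
    finally show ?thesis by (simp add: V_def distrib_left mult.left_commute)
  qed simp
  have leaf: "ennreal ((predict n d S T x - f x)\<^sup>2) \<le> V (path_vars T x)"
    if T: "grown S Q {..<n} T" and st: "stopped M n d k S T" for T
  proof -
    define js where "js = path_vars T x"
    let ?I = "cell_members n S x js"
    have js: "js \<in> lists Q" unfolding js_def by (rule G.path_vars_in_lists[OF T])
    have ne: "?I \<noteq> {}" using grown_leaf_nonempty[OF T, of x] by (simp add: js_def cell_members_def)
    have stop: "card ?I < 2 * k \<or> Q = {}" using G.stopped_cell[OF T st, of x] by (auto simp: js_def)
    have noise: "noise_average n k x Q h js S = cell_noise n x js S" for h
      unfolding noise_average_def using stop by (rule leaf_average_stop)
    have long: "t - length js = 0 \<or> Q = {}"
    proof (cases "Q = {}")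
      case False
      have jsd: "js \<in> lists {..<d}" using js Q_subset by auto
      have "n + 1 \<le> (card ?I + 1) * 2 ^ length js" by (rule card_cell_lower[OF gen jsd])
      also have "\<dots> \<le> (2 * k) * 2 ^ length js" using stop False by (intro mult_right_mono) auto
      also have "\<dots> = k * 2 ^ Suc (length js)" by simp
      finally have "2 ^ t * k < k * 2 ^ Suc (length js)" using t by linarith
      then have "(2::nat) ^ t < 2 ^ Suc (length js)" by (simp add: mult.commute)
      then have "t < Suc (length js)" by (rule power_less_imp_less_exp[rotated]) simp
      then show ?thesis by simp
    qed simp
    have "members n d S T (leaf_of T x) = ?I" using G.members_leaf_of[OF T, of x] by (simp add: js_def)
    then have eq: "predict n d S T x - f x = (\<Sum>i\<in>?I. residual (S i)) / real (card ?I) +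
        ((\<Sum>i\<in>?I. f (fst (S i))) / real (card ?I) - f x)" (is "_ = ?u + ?w")
      by (simp add: predict_def Let_def residual_def sum_subtractf diff_divide_distrib)
    have sq: "(u + w)\<^sup>2 \<le> 2 * u\<^sup>2 + 2 * w\<^sup>2" for u w :: real
      using zero_le_power2[of "u - w"] by (simp add: power2_sum power2_diff)
    have "(predict n d S T x - f x)\<^sup>2 \<le> 2 * ?u\<^sup>2 + 2 * ?w\<^sup>2" unfolding eq by (rule sq)
    also have "\<dots> \<le> 2 * ?u\<^sup>2 + 2 * (L\<^sup>2 * W js)"
      using leaf_bias[OF x js ne] by (simp add: W_def)
    also have "L\<^sup>2 * W js = L\<^sup>2 * W js * \<rho> ^ (t - length js)" using long by (auto simp: W_def)
    finally have "ennreal ((predict n d S T x - f x)\<^sup>2) \<le>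
        ennreal (2 * ?u\<^sup>2 + 2 * (L\<^sup>2 * W js * \<rho> ^ (t - length js)))" by (rule ennreal_leI)
    also have "\<dots> = ennreal (2 * ?u\<^sup>2) + ennreal (2 * (L\<^sup>2 * W js * \<rho> ^ (t - length js)))"
      using W0[of js] \<rho>01 by (intro ennreal_plus) auto
    also have "ennreal (2 * ?u\<^sup>2) = 2 * cell_noise n x js S"
      by (simp add: cell_noise_def ennreal_mult')
    also have "2 * cell_noise n x js S + ennreal (2 * (L\<^sup>2 * W js * \<rho> ^ (t - length js))) = V js"
      unfolding V_def noise by (simp add: mult.assoc)
    finally show ?thesis by (simp add: js_def)
  qed
  have bounded_error: "ennreal ((predict n d S T x - f x)\<^sup>2) \<le> ennreal ((M + \<bar>f x\<bar>)\<^sup>2)" for T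
  proof (rule ennreal_leI)
    have "\<bar>predict n d S T x\<bar> \<le> M" by (rule predict_bounded) (rule Y)
    then have "\<bar>predict n d S T x - f x\<bar> \<le> \<bar>M + \<bar>f x\<bar>\<bar>" using M_pos by linarith
    then show "(predict n d S T x - f x)\<^sup>2 \<le> (M + \<bar>f x\<bar>)\<^sup>2" by (rule abs_le_square_iff[THEN iffD1])
  qed
  have "(\<integral>\<^sup>+J. ennreal ((predict n d S (final_tree M n d k sel S J) x - f x)\<^sup>2) \<partial>candidate_law d) \<le> V []"
    by (rule G.expected_value_bound[OF step leaf bounded_error])
  also have "\<dots> \<le> 2 * noise_average n k x Q n [] S + ennreal (2 * L\<^sup>2 * real q * \<rho> ^ t)"
  proof -
    have "W [] = real (card Q)" by (simp add: W_def side_def cell_bounds_simps)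
    then have "2 * L\<^sup>2 * W [] * \<rho> ^ t \<le> 2 * L\<^sup>2 * real q * \<rho> ^ t"
      using q \<rho>01 by (intro mult_right_mono mult_left_mono) auto
    then show ?thesis unfolding V_def by (simp add: add_left_mono ennreal_leI)
  qed
  finally show ?thesis .
qed

end

section \<open>Expected error at a fixed sample size\<close>

context sparse_model
begin

lemma depends_on_inputs_generic: "depends_on_inputs n (generic n d)"
  unfolding depends_on_inputs_def
proof (intro conjI allI impI)
  have ext: "fst (S i) \<in> extensional {..<d}" if "S \<in> space (train n)" "i < n" for S i
    using measurable_space[OF measurable_sample that(1)] that space_D by auto
  have "{S \<in> space (train n). generic n d S} = {S \<in> space (train n).
      (\<forall>i\<in>{..<n}. \<forall>j\<in>{..<d}. 0 < fst (S i) j \<and> fst (S i) j \<le> 1) \<and>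
      (\<forall>i\<in>{..<n}. \<forall>i'\<in>{..<n}. \<forall>j\<in>{..<d}. i = i' \<or> fst (S i) j \<noteq> fst (S i') j)}"
  proof (intro Collect_cong conj_cong refl)
    fix S assume S: "S \<in> space (train n)"
    have "(\<forall>i<n. fst (S i) \<in> pos_cube d) \<longleftrightarrow> (\<forall>i\<in>{..<n}. \<forall>j\<in>{..<d}. 0 < fst (S i) j \<and> fst (S i) j \<le> 1)"
    proof -
      have "fst (S i) \<in> pos_cube d \<longleftrightarrow> (\<forall>j\<in>{..<d}. 0 < fst (S i) j \<and> fst (S i) j \<le> 1)" if "i < n" for i
        using ext[OF S that] unfolding pos_cube_def PiE_def Pi_def by (simp add: Ball_def)
      then show ?thesis by (simp only: Ball_def lessThan_iff) blast
    qed
    moreover have "(\<forall>j<d. inj_on (\<lambda>i. fst (S i) j) {..<n}) \<longleftrightarrow>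
        (\<forall>i\<in>{..<n}. \<forall>i'\<in>{..<n}. \<forall>j\<in>{..<d}. i = i' \<or> fst (S i) j \<noteq> fst (S i') j)"
      unfolding inj_on_def by blast
    ultimately show "generic n d S \<longleftrightarrow>
      (\<forall>i\<in>{..<n}. \<forall>j\<in>{..<d}. 0 < fst (S i) j \<and> fst (S i) j \<le> 1) \<and>
      (\<forall>i\<in>{..<n}. \<forall>i'\<in>{..<n}. \<forall>j\<in>{..<d}. i = i' \<or> fst (S i) j \<noteq> fst (S i') j)"
      unfolding generic_def by (rule arg_cong2[where f = "(\<and>)"])
  qed
  also have "\<dots> \<in> sets (train n)"
  proof -
    have m: "(\<lambda>S. fst (S i) j) \<in> borel_measurable (train n)" if "i \<in> {..<n}" "j \<in> {..<d}" for i j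
      using that by (intro measurable_sample_coordinate) auto
    have unit: "{S \<in> space (train n). 0 < fst (S i) j \<and> fst (S i) j \<le> 1} \<in> sets (train n)"
      if "i \<in> {..<n}" "j \<in> {..<d}" for i j
      by (intro sets.sets_Collect_conj borel_measurable_less borel_measurable_le m that borel_measurable_const)
    have neq: "{S \<in> space (train n). i = i' \<or> fst (S i) j \<noteq> fst (S i') j} \<in> sets (train n)"
      if "i \<in> {..<n}" "i' \<in> {..<n}" "j \<in> {..<d}" for i i' j
      by (intro sets.sets_Collect_disj borel_measurable_neq m that sets.sets_Collect_const)
    show ?thesis
      by (intro sets.sets_Collect_conj sets.sets_Collect_finite_All[where S = "{..<n}"]
          sets.sets_Collect_finite_All[where S = "{..<d}"] unit neq finite_lessThan)
  qed
  finally show "{S \<in> space (train n). generic n d S} \<in> sets (train n)" .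
  fix S S' :: sample assume "\<forall>i<n. fst (S i) = fst (S' i)"
  then show "generic n d S = generic n d S'" by (intro generic_cong) simp
qed

text \<open>
  If the integrand is not integrable, the excess error is zero by the convention for integrals. Otherwise
  the integrand is measurable and Fubini's theorem permits integrating over the test point last.
\<close>

lemma excess_error_le:
  assumes C: "0 \<le> C"
    and bound: "\<And>x. x \<in> pos_cube d \<Longrightarrow> f x \<in> {- M..M} \<Longrightarrow>
      (\<integral>\<^sup>+S. (\<integral>\<^sup>+J. ennreal ((predict n d S (final_tree M n d k sel S J) x - f x)\<^sup>2) \<partial>candidate_law d) \<partial>train n)
        \<le> ennreal C"
  shows "0 \<le> excess_error M n d k D sel f" "excess_error M n d k D sel f \<le> C"
proof -
  let ?A = "training_law n D" and ?B = "candidate_law d" and ?X = "distr D (point_space {..<d}) fst"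
  define F where "F = (\<lambda>(S, J, x). (predict n d S (final_tree M n d k sel S J) x - f x)\<^sup>2)"
  have ex: "excess_error M n d k D sel f = (\<integral>w. F w \<partial>(?A \<Otimes>\<^sub>M ?B \<Otimes>\<^sub>M ?X))"
    by (simp add: excess_error_def F_def)
  have F0: "0 \<le> F w" for w by (auto simp: F_def split: prod.splits)
  show "0 \<le> excess_error M n d k D sel f" unfolding ex by (simp add: F0)
  show "excess_error M n d k D sel f \<le> C"
  proof (cases "integrable (?A \<Otimes>\<^sub>M ?B \<Otimes>\<^sub>M ?X) F")
    case False
    then show ?thesis using C by (simp add: ex not_integrable_integral_eq)
  next
    case True
    interpret A: prob_space ?A using prob_space_train by (simp add: train_def)
    interpret B: prob_space ?B
      unfolding candidate_law_def by (intro prob_space_PiM prob_space_measure_pmf)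
    interpret X: prob_space ?X by (rule prob_space_distr[OF measurable_fst_D])
    interpret BX: pair_prob_space ?B ?X ..
    interpret ABX: pair_prob_space ?A "?B \<Otimes>\<^sub>M ?X" ..
    interpret AB: pair_prob_space ?A ?B ..
    define G where "G w = ennreal (F w)" for w
    have G: "G \<in> borel_measurable (?A \<Otimes>\<^sub>M ?B \<Otimes>\<^sub>M ?X)"
      using True unfolding G_def by auto
    have "(\<integral>\<^sup>+w. G w \<partial>(?A \<Otimes>\<^sub>M ?B \<Otimes>\<^sub>M ?X)) = (\<integral>\<^sup>+y. (\<integral>\<^sup>+S. G (S, y) \<partial>?A) \<partial>(?B \<Otimes>\<^sub>M ?X))"
      by (rule ABX.nn_integral_snd[OF G, symmetric])
    also have "\<dots> = (\<integral>\<^sup>+x. (\<integral>\<^sup>+J. (\<integral>\<^sup>+S. G (S, J, x) \<partial>?A) \<partial>?B) \<partial>?X)"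
    proof -
      have "(\<lambda>y. \<integral>\<^sup>+S. G (S, y) \<partial>?A) \<in> borel_measurable (?B \<Otimes>\<^sub>M ?X)"
      proof -
        have "(\<lambda>p. (snd p, fst p)) \<in> measurable ((?B \<Otimes>\<^sub>M ?X) \<Otimes>\<^sub>M ?A) (?A \<Otimes>\<^sub>M ?B \<Otimes>\<^sub>M ?X)"
          by (rule measurable_Pair[OF measurable_snd measurable_fst])
        from measurable_compose[OF this G]
        have "(\<lambda>p. G (snd p, fst p)) \<in> borel_measurable ((?B \<Otimes>\<^sub>M ?X) \<Otimes>\<^sub>M ?A)" .
        from A.borel_measurable_nn_integral_fst[OF this] show ?thesis by (simp only: fst_conv snd_conv)
      qed
      from BX.nn_integral_snd[OF this] show ?thesis by simp
    qed
    also have "\<dots> = (\<integral>\<^sup>+x. (\<integral>\<^sup>+S. (\<integral>\<^sup>+J. G (S, J, x) \<partial>?B) \<partial>?A) \<partial>?X)"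
    proof (intro nn_integral_cong)
      fix x assume x: "x \<in> space ?X"
      have "(\<lambda>p. (fst p, snd p, x)) \<in> measurable (?A \<Otimes>\<^sub>M ?B) (?A \<Otimes>\<^sub>M ?B \<Otimes>\<^sub>M ?X)"
        using x by (intro measurable_Pair measurable_fst measurable_snd measurable_const)
      from measurable_compose[OF this G]
      have "(\<lambda>(S, J). G (S, J, x)) \<in> borel_measurable (?A \<Otimes>\<^sub>M ?B)" by (simp add: case_prod_beta')
      from AB.Fubini'[of "\<lambda>S J. G (S, J, x)", OF this]
      show "(\<integral>\<^sup>+J. (\<integral>\<^sup>+S. G (S, J, x) \<partial>?A) \<partial>?B) = (\<integral>\<^sup>+S. (\<integral>\<^sup>+J. G (S, J, x) \<partial>?B) \<partial>?A)" .
    qed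
    also have "\<dots> \<le> (\<integral>\<^sup>+x. ennreal C \<partial>?X)"
    proof (rule nn_integral_mono_AE)
      have "AE z in D. fst z \<in> pos_cube d \<and> f (fst z) \<in> {- M..M}"
        using AE_pos_cube regression_bounded by eventually_elim simp
      then have "AE x in ?X. x \<in> pos_cube d \<and> f x \<in> {- M..M}"
      proof (subst AE_distr_iff[OF measurable_fst_D])
        have "{x \<in> space (point_space {..<d}). in_box {..<d} (\<lambda>_. 0) (\<lambda>_. 1) x} \<in> sets (point_space {..<d})"
          by (intro sets_Collect_in_box[where g = "\<lambda>x. x"] measurable_coordinate) auto
        moreover have "{x \<in> space (point_space {..<d}). f x \<in> {- M..M}} \<in> sets (point_space {..<d})" by measurable
        ultimately have "{x \<in> space (point_space {..<d}). in_box {..<d} (\<lambda>_. 0) (\<lambda>_. 1) x} \<inter>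
            {x \<in> space (point_space {..<d}). f x \<in> {- M..M}} \<in> sets (point_space {..<d})" by (rule sets.Int)
        also have "{x \<in> space (point_space {..<d}). in_box {..<d} (\<lambda>_. 0) (\<lambda>_. 1) x} \<inter>
            {x \<in> space (point_space {..<d}). f x \<in> {- M..M}} =
            {x \<in> space (point_space {..<d}). x \<in> pos_cube d \<and> f x \<in> {- M..M}}"
          by (auto simp: in_box_def pos_cube_def point_space_def space_PiM PiE_def Pi_def)
        finally show "{x \<in> space (point_space {..<d}). x \<in> pos_cube d \<and> f x \<in> {- M..M}} \<in> sets (point_space {..<d})" .
      qed
      then show "AE x in ?X. (\<integral>\<^sup>+S. (\<integral>\<^sup>+J. G (S, J, x) \<partial>?B) \<partial>?A) \<le> ennreal C"
      proof eventually_elim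
        fix x assume "x \<in> pos_cube d \<and> f x \<in> {- M..M}"
        then show "(\<integral>\<^sup>+S. (\<integral>\<^sup>+J. G (S, J, x) \<partial>?B) \<partial>?A) \<le> ennreal C"
          using bound[of x] by (simp add: G_def F_def train_def)
      qed
    qed
    also have "\<dots> = ennreal C" by (simp only: nn_integral_const X.emeasure_space_1 mult_1_right)
    finally have "ennreal (excess_error M n d k D sel f) \<le> ennreal C"
      unfolding ex G_def using True F0 by (subst (asm) nn_integral_eq_integral) auto
    then show ?thesis using C by simp
  qed
qed

lemma excess_error_bound:
  fixes \<delta> \<epsilon> :: real
  assumes k: "k \<ge> 1" and q: "card Q \<le> q" "q \<ge> 1" and d: "d \<ge> 1" and t: "2 ^ t * k \<le> n"
    and sel: "valid_selection_rule M n d k D sel"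
    and \<delta>: "0 < \<delta>" "\<delta> \<le> 1 / 90" "2 * (real q + 1) \<le> \<delta> * k"
    and \<epsilon>: "0 < \<epsilon>" "\<epsilon> \<le> 1 / 90" "2 * (real q + 1) \<le> \<epsilon> * k"
    and thr: "144 * (M * (9 * \<delta>))\<^sup>2 < split_threshold (1 / 2) M n d k" "split_threshold (1 / 2) M n d k \<le> \<beta>\<^sup>2 / 6"
    and small: "48 * M * (9 * \<delta>) \<le> \<beta>"
    and \<rho>: "\<rho> = 1 - (1 - ((1 + 54 * \<epsilon>) / 2)\<^sup>2) / real q"
  defines "C \<equiv> 4 * M\<^sup>2 * (real (n + 1) ^ (2 * q) * (4 * exp (- (\<epsilon>\<^sup>2 * k / 4))) +
        real d * (real (n + 1) ^ (2 * (q + 1)) * (4 * exp (- (\<delta>\<^sup>2 * k / 4))))) +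
      8 * M\<^sup>2 / k + 2 * L\<^sup>2 * real q * \<rho> ^ t"
  shows "0 \<le> excess_error M n d k D sel f" "excess_error M n d k D sel f \<le> C"
proof -
  interpret T: prob_space "train n" by (rule prob_space_train)
  have n1: "n \<ge> 1" using t k by (cases n) auto
  have n1': "real (n + 1) \<ge> 1" by simp
  have \<rho>0: "0 \<le> \<rho>"
  proof -
    have "((1 + 54 * \<epsilon>) / 2)\<^sup>2 \<le> 1\<^sup>2" using \<epsilon> by (intro power_mono) auto
    then have a: "0 \<le> 1 - ((1 + 54 * \<epsilon>) / 2)\<^sup>2" by simp
    have "(1 - ((1 + 54 * \<epsilon>) / 2)\<^sup>2) / real q \<le> (1 - ((1 + 54 * \<epsilon>) / 2)\<^sup>2) / 1"
      using q(2) a by (intro divide_left_mono) auto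
    also have "\<dots> \<le> 1" using zero_le_power2[of "(1 + 54 * \<epsilon>) / 2"] by simp
    finally show ?thesis by (simp add: \<rho>)
  qed
  \<comment> \<open>Outside this event the sample is concentrated at both accuracies; on it the error is at most \<open>(2 * M)\<^sup>2\<close>.\<close>
  define Bad where "Bad = grid_deviant n k \<epsilon> Q \<union> (\<Union>j<d. grid_deviant n k \<delta> (insert j Q))"
  have sub: "insert j Q \<subseteq> {..<d}" if "j < d" for j using that Q_subset by auto
  have card_ins: "card (insert j Q) \<le> q + 1" for j using q(1) card_insert_le_m1[of "q + 1" Q j] by simp
  have gQ: "grid_deviant n k \<epsilon> Q \<in> T.events"
    "T.prob (grid_deviant n k \<epsilon> Q) \<le> real (n + 1) ^ (2 * q) * (4 * exp (- (\<epsilon>\<^sup>2 * k / 4)))"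
  proof -
    show "grid_deviant n k \<epsilon> Q \<in> T.events" using \<epsilon> by (intro grid_deviant_prob(1)[OF n1 Q_subset k]) auto
    have "T.prob (grid_deviant n k \<epsilon> Q) \<le> real (n + 1) ^ (2 * card Q) * (4 * exp (- (\<epsilon>\<^sup>2 * k / 4)))"
      using \<epsilon> by (intro grid_deviant_prob(2)[OF n1 Q_subset k]) auto
    also have "\<dots> \<le> real (n + 1) ^ (2 * q) * (4 * exp (- (\<epsilon>\<^sup>2 * k / 4)))"
      using q(1) n1' by (intro mult_right_mono power_increasing) auto
    finally show "T.prob (grid_deviant n k \<epsilon> Q) \<le> real (n + 1) ^ (2 * q) * (4 * exp (- (\<epsilon>\<^sup>2 * k / 4)))" .
  qed
  have gj: "grid_deviant n k \<delta> (insert j Q) \<in> T.events"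
    "T.prob (grid_deviant n k \<delta> (insert j Q)) \<le> real (n + 1) ^ (2 * (q + 1)) * (4 * exp (- (\<delta>\<^sup>2 * k / 4)))"
    if j: "j < d" for j
  proof -
    show "grid_deviant n k \<delta> (insert j Q) \<in> T.events" using \<delta> by (intro grid_deviant_prob(1)[OF n1 sub[OF j] k]) auto
    have "T.prob (grid_deviant n k \<delta> (insert j Q)) \<le>
        real (n + 1) ^ (2 * card (insert j Q)) * (4 * exp (- (\<delta>\<^sup>2 * k / 4)))"
      using \<delta> by (intro grid_deviant_prob(2)[OF n1 sub[OF j] k]) auto
    also have "\<dots> \<le> real (n + 1) ^ (2 * (q + 1)) * (4 * exp (- (\<delta>\<^sup>2 * k / 4)))"
      using card_ins[of j] n1' by (intro mult_right_mono power_increasing) auto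
    finally show "T.prob (grid_deviant n k \<delta> (insert j Q)) \<le> real (n + 1) ^ (2 * (q + 1)) * (4 * exp (- (\<delta>\<^sup>2 * k / 4)))" .
  qed
  have Bad: "Bad \<in> T.events" unfolding Bad_def using gQ gj by (intro sets.Un sets.finite_UN) auto
  define PB where "PB = real (n + 1) ^ (2 * q) * (4 * exp (- (\<epsilon>\<^sup>2 * k / 4))) +
        real d * (real (n + 1) ^ (2 * (q + 1)) * (4 * exp (- (\<delta>\<^sup>2 * k / 4))))"
  have pBad: "T.prob Bad \<le> PB"
  proof -
    have "T.prob Bad \<le> T.prob (grid_deviant n k \<epsilon> Q) + T.prob (\<Union>j<d. grid_deviant n k \<delta> (insert j Q))"
      unfolding Bad_def using gQ gj by (intro measure_Un_le sets.finite_UN) auto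
    also have "T.prob (\<Union>j<d. grid_deviant n k \<delta> (insert j Q)) \<le> (\<Sum>j<d. T.prob (grid_deviant n k \<delta> (insert j Q)))"
      using gj by (intro T.finite_measure_subadditive_finite) auto
    also have "\<dots> \<le> (\<Sum>j<d. real (n + 1) ^ (2 * (q + 1)) * (4 * exp (- (\<delta>\<^sup>2 * k / 4))))"
      by (intro sum_mono gj) auto
    finally show ?thesis using gQ(2) by (simp add: PB_def)
  qed
  have PB0: "PB \<ge> 0" unfolding PB_def by (intro add_nonneg_nonneg mult_nonneg_nonneg) auto
  have C: "C = 4 * M\<^sup>2 * PB + (8 * M\<^sup>2 / k + 2 * L\<^sup>2 * real q * \<rho> ^ t)" by (simp add: C_def PB_def)
  have C0: "0 \<le> C" unfolding C using PB0 \<rho>0 by simp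
  have "k \<le> n" using t by (metis le_trans mult_le_mono1 mult_1 one_le_numeral one_le_power)
  let ?G = "generic n d"
  have noise: "noise_average n k x Q n [] \<in> borel_measurable (train n)"
    "(\<integral>\<^sup>+S. indicator {S. ?G S} S * noise_average n k x Q n [] S \<partial>train n) \<le> ennreal (4 * M\<^sup>2 / k)" for x
  proof -
    note na = noise_average_integral[OF Q_subset k _ depends_on_inputs_generic, of "[]" n x n]
    have "noise_average n k x Q n [] \<in> borel_measurable (train n) \<and>
     (\<integral>\<^sup>+S. indicator {S. ?G S} S * noise_average n k x Q n [] S \<partial>train n) \<le>
      ennreal (4 * M\<^sup>2 / k) * (\<integral>\<^sup>+S. indicator {S. ?G S} S \<partial>train n)"
      using \<open>k \<le> n\<close> by (intro na) auto
    moreover have "(\<integral>\<^sup>+S. indicator {S. ?G S} S \<partial>train n) \<le> (\<integral>\<^sup>+S. 1 \<partial>train n)"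
      by (intro nn_integral_mono) (auto simp: indicator_def)
    then have "ennreal (4 * M\<^sup>2 / k) * (\<integral>\<^sup>+S. indicator {S. ?G S} S \<partial>train n) \<le> ennreal (4 * M\<^sup>2 / k) * 1"
      by (intro mult_left_mono) (auto simp: T.emeasure_space_1)
    ultimately show "noise_average n k x Q n [] \<in> borel_measurable (train n)"
      "(\<integral>\<^sup>+S. indicator {S. ?G S} S * noise_average n k x Q n [] S \<partial>train n) \<le> ennreal (4 * M\<^sup>2 / k)"
      by auto
  qed
  have main: "(\<integral>\<^sup>+S. (\<integral>\<^sup>+J. ennreal ((predict n d S (final_tree M n d k sel S J) x - f x)\<^sup>2) \<partial>candidate_law d) \<partial>train n)
        \<le> ennreal C" if x: "x \<in> pos_cube d" and fx: "f x \<in> {- M..M}" for x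
  proof -
    let ?N = "noise_average n k x Q n []"
    let ?b = "ennreal (2 * L\<^sup>2 * real q * \<rho> ^ t)"
    have ae: "AE S in train n. (\<forall>i<n. snd (S i) \<in> {- M..M}) \<and> ?G S"
      using AE_train[OF bounded, of n] AE_generic[of n] by eventually_elim simp
    have "(\<integral>\<^sup>+S. (\<integral>\<^sup>+J. ennreal ((predict n d S (final_tree M n d k sel S J) x - f x)\<^sup>2) \<partial>candidate_law d) \<partial>train n)
      \<le> (\<integral>\<^sup>+S. ennreal (4 * M\<^sup>2) * indicator Bad S + (2 * (indicator {S. ?G S} S * ?N S) + ?b) \<partial>train n)"
    proof (rule nn_integral_mono_AE, use ae AE_space in eventually_elim)
      fix S assume S: "(\<forall>i<n. snd (S i) \<in> {- M..M}) \<and> ?G S" "S \<in> space (train n)"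
      then have Y: "\<bar>snd (S i)\<bar> \<le> M" if "i < n" for i using that by (auto simp: abs_le_iff)
      show "(\<integral>\<^sup>+J. ennreal ((predict n d S (final_tree M n d k sel S J) x - f x)\<^sup>2) \<partial>candidate_law d) \<le>
          ennreal (4 * M\<^sup>2) * indicator Bad S + (2 * (indicator {S. ?G S} S * ?N S) + ?b)"
      proof (cases "S \<in> Bad")
        case True
        interpret B: prob_space "candidate_law d"
          unfolding candidate_law_def by (intro prob_space_PiM prob_space_measure_pmf)
        have "(\<integral>\<^sup>+J. ennreal ((predict n d S (final_tree M n d k sel S J) x - f x)\<^sup>2) \<partial>candidate_law d) \<le>
            (\<integral>\<^sup>+J. ennreal (4 * M\<^sup>2) \<partial>candidate_law d)"
        proof (intro nn_integral_mono ennreal_leI)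
          fix J
          have "\<bar>predict n d S (final_tree M n d k sel S J) x\<bar> \<le> M" by (rule predict_bounded) (rule Y)
          then have "\<bar>predict n d S (final_tree M n d k sel S J) x - f x\<bar> \<le> \<bar>2 * M\<bar>"
            using fx M_pos by auto
          then have "(predict n d S (final_tree M n d k sel S J) x - f x)\<^sup>2 \<le> (2 * M)\<^sup>2"
            by (rule abs_le_square_iff[THEN iffD1])
          then show "(predict n d S (final_tree M n d k sel S J) x - f x)\<^sup>2 \<le> 4 * M\<^sup>2"
            by (simp add: power_mult_distrib)
        qed
        also have "\<dots> = ennreal (4 * M\<^sup>2) * indicator Bad S" using True by (simp add: B.emeasure_space_1)
        finally show ?thesis by (rule order_trans) simp
      next
        case False
        have kn: "real k > 0" using k by simp
        interpret cs: concentrated_sample D d M f Q \<beta> L \<sigma> n k S "9 * \<delta>" "9 * \<epsilon>"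
        proof
          show "k \<ge> 1" by (rule k)
          show "generic n d S" using S by simp
          have "2 * real (card Q) \<le> 2 * (real q + 1)" using q(1) by simp
          also have "\<dots> \<le> \<epsilon> * k" by (rule \<epsilon>(3))
          finally have "2 * real (card Q) \<le> \<epsilon> * k" .
          then show "concentrated n k (9 * \<epsilon>) Q S"
            using False \<epsilon> S Y by (intro concentratedI[OF n1 k Q_subset]) (auto simp: Bad_def)
          show "concentrated n k (9 * \<delta>) (insert j Q) S" if j: "j < d" for j
          proof -
            have "real (card (insert j Q)) \<le> real (q + 1)" using card_ins[of j] by (simp only: of_nat_le_iff)
            then have "2 * real (card (insert j Q)) \<le> 2 * (real q + 1)" by simp
            also have "\<dots> \<le> \<delta> * k" by (rule \<delta>(3))
            finally have "2 * real (card (insert j Q)) \<le> \<delta> * k" .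
            then show ?thesis
              using False \<delta> S Y j by (intro concentratedI[OF n1 k sub[OF j]]) (auto simp: Bad_def)
          qed
          have one: "1 \<le> 2 * (real q + 1)" by simp
          have "1 \<le> \<delta> * k" "1 \<le> \<epsilon> * k" by (rule order_trans[OF one \<delta>(3)], rule order_trans[OF one \<epsilon>(3)])
          then show "1 \<le> 9 * \<delta> * k" "1 \<le> 9 * \<epsilon> * k" by simp_all
        qed (use \<delta> \<epsilon> in auto)
        have "(\<integral>\<^sup>+J. ennreal ((predict n d S (final_tree M n d k sel S J) x - f x)\<^sup>2) \<partial>candidate_law d) \<le>
            2 * ?N S + ?b"
          using S by (intro cs.tree_error_bound[OF thr small q d t Y sel _ x]) (auto simp: \<rho>)
        also have "\<dots> = 2 * (indicator {S. ?G S} S * ?N S) + ?b" using S by simp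
        finally show ?thesis using False by simp
      qed
    qed
    also have "\<dots> = ennreal (4 * M\<^sup>2) * emeasure (train n) Bad +
        (2 * (\<integral>\<^sup>+S. indicator {S. ?G S} S * ?N S \<partial>train n) + ?b)"
    proof -
      have m: "(\<lambda>S. indicator {S. ?G S} S * ?N S) \<in> borel_measurable (train n)"
        by (rule borel_measurable_times_ennreal[OF indicator_measurable(2)[OF depends_on_inputs_generic] noise(1)])
      show ?thesis
        using m Bad by (simp add: nn_integral_add nn_integral_cmult T.emeasure_space_1)
    qed
    also have "\<dots> \<le> ennreal (4 * M\<^sup>2) * ennreal PB + (2 * ennreal (4 * M\<^sup>2 / k) + ?b)"
      using pBad noise(2)[of x] unfolding T.emeasure_eq_measure
      by (intro add_mono mult_left_mono ennreal_leI) auto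
    also have "\<dots> = ennreal C"
    proof -
      have "(2::ennreal) * ennreal (4 * M\<^sup>2 / k) = ennreal (8 * M\<^sup>2 / k)"
        by (subst ennreal_numeral[symmetric], subst ennreal_mult[symmetric]) auto
      then show ?thesis
        using PB0 \<rho>0 unfolding C by (simp add: ennreal_mult'[symmetric])
    qed
    finally show ?thesis .
  qed
  show "0 \<le> excess_error M n d k D sel f" "excess_error M n d k D sel f \<le> C"
    using excess_error_le[OF C0 main] by auto
qed

end

section \<open>Rates\<close>

text \<open>
  The side ratio \<open>(1 + 54 * \<epsilon>) / 2\<close> differs from \<open>1 / 2\<close> by a relative error that only costs \<open>exp (144 * \<epsilon>)\<close>
  per level.
\<close>

lemma contraction_factor:
  fixes \<epsilon> \<xi> \<rho> :: real and q :: nat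
  assumes q: "q \<ge> 1" and \<xi>: "\<xi> = 1 / (1 - 3 / (4 * real q))" and \<epsilon>: "0 < \<epsilon>" "\<epsilon> \<le> 1 / 90"
    and \<rho>: "\<rho> = 1 - (1 - ((1 + 54 * \<epsilon>) / 2)\<^sup>2) / real q"
  shows "\<rho> \<le> 1 / \<xi> * exp (144 * \<epsilon>)"
proof -
  have q0: "real q \<ge> 1" using q by simp
  have u: "3 / (4 * real q) \<le> 3 / 4" using q0 by (simp add: field_simps)
  then have x: "1 / \<xi> = 1 - 3 / (4 * real q)" "1 / 4 \<le> 1 / \<xi>" by (simp_all add: \<xi>)
  have "\<epsilon> * \<epsilon> \<le> 1 / 90 * \<epsilon>" using \<epsilon> by (intro mult_right_mono) auto
  then have "((1 + 54 * \<epsilon>) / 2)\<^sup>2 \<le> 1 / 4 + 36 * \<epsilon>" using \<epsilon>(1) by (simp add: power2_eq_square field_simps)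
  then have "(1 - (1 / 4 + 36 * \<epsilon>)) / real q \<le> (1 - ((1 + 54 * \<epsilon>) / 2)\<^sup>2) / real q"
    using q0 by (intro divide_right_mono) auto
  then have "\<rho> \<le> 1 - (1 - (1 / 4 + 36 * \<epsilon>)) / real q" by (simp add: \<rho>)
  also have "\<dots> = 1 / \<xi> + 36 * \<epsilon> / real q" using q0 unfolding x(1) by (simp add: field_simps)
  also have "\<dots> \<le> 1 / \<xi> + 36 * \<epsilon>"
    using q0 \<epsilon> by (simp add: pos_divide_le_eq)
  also have "\<dots> \<le> 1 / \<xi> + 1 / \<xi> * (144 * \<epsilon>)"
    using mult_right_mono[OF x(2), of "144 * \<epsilon>"] \<epsilon> by simp
  also have "\<dots> = 1 / \<xi> * (1 + 144 * \<epsilon>)" by (simp add: distrib_left)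
  also have "\<dots> \<le> 1 / \<xi> * exp (144 * \<epsilon>)"
  proof (rule mult_left_mono[OF exp_ge_add_one_self])
    show "0 \<le> 1 / \<xi>" using x(2) by linarith
  qed
  finally show ?thesis .
qed

text \<open>
  With \<open>k / n\<close> of order \<open>n powr (\<gamma> - 1)\<close> the exponent becomes \<open>(\<gamma> - 1) * log 2 \<xi> = - \<gamma>\<close>, which is the equation
  that determines \<open>\<gamma>\<close>.
\<close>

lemma power_depth_bound:
  fixes \<xi> c y \<gamma> :: real and n k t :: nat
  assumes \<xi>: "\<xi> > 1" and \<gamma>: "\<gamma> = ln \<xi> / ln (2 * \<xi>)" and c: "c > 0" and n: "n \<ge> 1" and k: "k \<ge> 1" "k \<le> n"
    and kc: "real k \<le> c * real n powr \<gamma>" and t: "t = nat \<lfloor>log 2 (real n / real k)\<rfloor>"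
  shows "(1 / \<xi>) ^ t \<le> \<xi> * c powr (log 2 \<xi>) * real n powr (- \<gamma>)"
proof -
  have n0: "real n > 0" and k0: "real k > 0" using n k by auto
  define r where "r = log 2 (real n / real k)"
  have r0: "r \<ge> 0" unfolding r_def using k by (simp add: zero_le_log_cancel_iff)
  have tr: "r - 1 \<le> real t" unfolding t r_def[symmetric] using r0 by linarith
  have l0: "log 2 \<xi> > 0" using \<xi> by simp
  have "(1 / \<xi>) ^ t = \<xi> powr (- real t)"
    using \<xi> by (simp add: powr_minus powr_realpow power_one_over inverse_eq_divide)
  also have "\<dots> \<le> \<xi> powr (1 - r)" using tr \<xi> by (intro powr_mono) auto
  also have "\<dots> = \<xi> * \<xi> powr (- r)" using \<xi> by (simp add: powr_diff powr_minus field_simps)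
  also have "\<xi> powr (- r) = (real k / real n) powr (log 2 \<xi>)"
    using \<xi> n0 k0 unfolding r_def powr_def
    by (simp add: log_def ln_div field_simps)
  also have "\<dots> \<le> (c * real n powr (\<gamma> - 1)) powr (log 2 \<xi>)"
  proof (rule powr_mono2)
    have "real k / real n \<le> c * real n powr \<gamma> / real n" using kc n0 by (intro divide_right_mono) auto
    also have "\<dots> = c * real n powr (\<gamma> - 1)" using n0 by (simp add: powr_diff)
    finally show "real k / real n \<le> c * real n powr (\<gamma> - 1)" .
  qed (use l0 n0 k0 in auto)
  also have "\<dots> = c powr (log 2 \<xi>) * real n powr ((\<gamma> - 1) * log 2 \<xi>)"
    using c n0 by (simp add: powr_mult powr_powr)
  also have "(\<gamma> - 1) * log 2 \<xi> = - \<gamma>"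
  proof -
    have calc: "(a / s - 1) * (a / b) = - (a / s)" if "s = b + a" "s > 0" "b > 0" for a b s :: real
    proof -
      have "a / s - 1 = - (b / s)" using that by (simp add: field_simps)
      then show ?thesis using that by simp
    qed
    have "ln (2 * \<xi>) = ln 2 + ln \<xi>" using \<xi> by (simp add: ln_mult)
    moreover have "ln (2 * \<xi>) > 0" using \<xi> by (intro ln_gt_zero) simp
    ultimately show ?thesis unfolding \<gamma> log_def by (intro calc) auto
  qed
  finally show ?thesis using \<xi> by (simp add: mult.assoc)
qed

lemma eventually_poly_exp_le:
  fixes a c :: real and B :: nat
  assumes a: "a > 0" and c: "c > 0"
  shows "eventually (\<lambda>n. real (n + 1) ^ B * (4 * exp (- (c * real n powr a))) \<le> 1 / real n) sequentially"
proof -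
  have "eventually (\<lambda>n. real B * ln (real n + 1) + ln 4 + ln (real n) \<le> c * real n powr a) sequentially"
    using a c by real_asymp
  then show ?thesis
    using eventually_ge_at_top[of 1]
  proof eventually_elim
    fix n :: nat assume n: "n \<ge> 1" and le: "real B * ln (real n + 1) + ln 4 + ln (real n) \<le> c * real n powr a"
    have "real (n + 1) ^ B * (4 * exp (- (c * real n powr a))) =
        exp (real B * ln (real n + 1) + ln 4 - c * real n powr a)"
      by (simp add: exp_add exp_diff exp_minus exp_of_nat_mult field_simps)
    also have "\<dots> \<le> exp (- ln (real n))" using le by simp
    also have "\<dots> = 1 / real n" using n by (simp add: exp_minus inverse_eq_divide)
    finally show "real (n + 1) ^ B * (4 * exp (- (c * real n powr a))) \<le> 1 / real n" .
  qed
qed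

text \<open>
  Half of \<open>ln n * ln d / 144\<close> pays for the factor \<open>d\<close> once \<open>ln n \<ge> 288\<close>, and the other half pays for the
  polynomial in \<open>n\<close> once \<open>ln d\<close> is large.
\<close>

lemma dimension_times_tail_le:
  fixes n d B :: nat
  assumes n: "n \<ge> 2" "ln (real n) \<ge> 288" and d: "d \<ge> 1" "ln (real d) \<ge> 288 * (2 * real B + 3)"
  shows "real d * (real (n + 1) ^ B * (4 * exp (- (ln (real n) * ln (real d) / 144)))) \<le> 1 / real n"
proof -
  define l where "l = ln (real n)"
  define m where "m = ln (real d)"
  have nn: "real n + 1 \<le> real n ^ 2"
  proof -
    have "2 * real n \<le> real n * real n" using n(1) by (intro mult_right_mono) auto
    moreover have "real n + 1 \<le> 2 * real n" using n(1) by simp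
    ultimately show ?thesis unfolding power2_eq_square by (rule order_trans[rotated])
  qed
  then have "ln (real n + 1) \<le> ln (real n ^ 2)" using n(1) by (subst ln_le_cancel_iff) auto
  then have l1: "ln (real n + 1) \<le> 2 * l" using n(1) by (simp add: l_def ln_realpow)
  have "ln (4::real) \<le> l"
  proof -
    have "ln (4::real) \<le> 4 - 1" by (rule ln_le_minus_one) simp
    then show ?thesis using n(2) by (simp add: l_def)
  qed
  moreover have "real B * ln (real n + 1) \<le> real B * (2 * l)" using l1 by (intro mult_left_mono) auto
  moreover have "m \<le> l * m / 288"
    using mult_right_mono[OF n(2), of m] d(2) by (simp add: l_def m_def)
  moreover have "(2 * real B + 3) * l \<le> l * m / 288"
    using mult_left_mono[OF d(2), of l] n(2) by (simp add: l_def m_def mult.commute)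
  moreover have "(2 * real B + 3) * l = 2 * (real B * l) + 3 * l" "real B * (2 * l) = 2 * (real B * l)"
    by (simp_all add: algebra_simps)
  moreover have "l \<ge> 0" using n(2) by (simp add: l_def)
  ultimately have le: "m + real B * ln (real n + 1) + ln 4 - l * m / 144 \<le> - l" by linarith
  have "real d * (real (n + 1) ^ B * (4 * exp (- p))) = exp (m + real B * ln (real n + 1) + ln 4 - p)" for p
    using d(1) by (simp add: exp_add exp_diff exp_minus exp_of_nat_mult m_def field_simps)
  then have "real d * (real (n + 1) ^ B * (4 * exp (- (l * m / 144)))) =
      exp (m + real B * ln (real n + 1) + ln 4 - l * m / 144)" .
  also have "\<dots> \<le> exp (- l)" using le by simp
  also have "\<dots> = 1 / real n" using n(1) by (simp add: l_def exp_minus inverse_eq_divide)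
  finally show ?thesis by (simp add: l_def m_def)
qed

theorem theorem4:
  fixes M \<xi> \<beta> L :: real
    and q :: nat
    and d k :: "nat \<Rightarrow> nat"
    and D :: "nat \<Rightarrow> (point \<times> real) measure"
    and Q :: "nat \<Rightarrow> nat set"
    and \<sigma> :: "nat \<Rightarrow> nat \<Rightarrow> real"
    and f :: "nat \<Rightarrow> point \<Rightarrow> real"
    and sel :: "nat \<Rightarrow> selection_rule"
  assumes M: "M > 0"
    and q: "q \<ge> 1"
    and xi: "\<xi> = 1 / (1 - 3 / (4 * real q))"
    and prob: "\<And>n. n \<ge> 1 \<Longrightarrow> prob_space (D n)"
    and sets_D: "\<And>n. n \<ge> 1 \<Longrightarrow> sets (D n) = sets (point_space {..<d n} \<Otimes>\<^sub>M borel)"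
    and bounded: "\<And>n. n \<ge> 1 \<Longrightarrow> AE z in D n. snd z \<in> {- M..M}"
    and uniform: "\<And>n. n \<ge> 1 \<Longrightarrow> distr (D n) (point_space {..<d n}) fst
                      = uniform_measure (\<Pi>\<^sub>M j\<in>{..<d n}. lborel) (cube (d n))"
    and growth: "(\<lambda>n. ln (real n) * max (ln (real (d n))) (ln (ln (real n))) / real (k n))
                   \<longlonglongrightarrow> 0"
    and dim: "liminf (\<lambda>n. ereal (real (d n) / real n)) > 0"
    and sparse: "\<And>n. n \<ge> 1 \<Longrightarrow> Q n \<subseteq> {..<d n} \<and> card (Q n) \<le> q"
    and indep: "\<And>n. n \<ge> 1 \<Longrightarrow> independent_rvs (D n)
                  (\<lambda>z. restrict (fst z) ({..<d n} - Q n)) (point_space ({..<d n} - Q n))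
                  (\<lambda>z. (snd z, restrict (fst z) (Q n))) (borel \<Otimes>\<^sub>M point_space (Q n))"
    and beta: "\<beta> > 0"
    and signs: "\<And>n j. n \<ge> 1 \<Longrightarrow> j \<in> Q n \<Longrightarrow> \<sigma> n j \<in> {-1, 1}"
    and monotone: "\<And>n j. n \<ge> 1 \<Longrightarrow> j \<in> Q n \<Longrightarrow>
          \<exists>g_above g_below.
            cond_mean_version (uniform_measure (D n) {z \<in> space (D n). fst z j > 1 / 2})
              (\<lambda>z. others (d n) j (fst z)) (point_space ({..<d n} - {j})) snd g_above \<and>
            cond_mean_version (uniform_measure (D n) {z \<in> space (D n). fst z j \<le> 1 / 2})
              (\<lambda>z. others (d n) j (fst z)) (point_space ({..<d n} - {j})) snd g_below \<and>
            (\<forall>x\<in>cube (d n).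
               \<sigma> n j * (g_above (others (d n) j x) - g_below (others (d n) j x)) \<ge> \<beta>)"
    and regression: "\<And>n. n \<ge> 1 \<Longrightarrow>
          cond_mean_version (D n) fst (point_space {..<d n}) snd (f n)"
    and lipschitz: "\<And>n x y. n \<ge> 1 \<Longrightarrow> x \<in> cube (d n) \<Longrightarrow> y \<in> cube (d n) \<Longrightarrow>
          \<bar>f n x - f n y\<bar> \<le> L * L2_set (\<lambda>j. x j - y j) {..<d n}"
    and selection: "\<And>n. n \<ge> 1 \<Longrightarrow> valid_selection_rule M n (d n) (k n) (D n) (sel n)"
    and leaf_size: "(\<lambda>n. real (k n)) \<in> \<Theta>(\<lambda>n. real n powr (ln \<xi> / ln (2 * \<xi>)))"
  shows "(\<lambda>n. excess_error M n (d n) (k n) (D n) (sel n) (f n))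
           \<in> O(\<lambda>n. real n powr (- (ln \<xi> / ln (2 * \<xi>))))"
proof -
  define \<gamma> where "\<gamma> = ln \<xi> / ln (2 * \<xi>)"
  have q0: "real q \<ge> 1" using q by simp
  have xi1: "\<xi> > 1"
  proof -
    have "3 / (4 * real q) \<le> 3 / 4" "3 / (4 * real q) > 0" using q0 by (simp_all add: field_simps)
    then show ?thesis unfolding xi by (simp add: field_simps)
  qed
  have \<gamma>: "0 < \<gamma>" "\<gamma> < 1"
  proof -
    have l: "ln (2 * \<xi>) = ln 2 + ln \<xi>" "ln \<xi> > 0" "ln (2::real) > 0" using xi1 by (simp_all add: ln_mult)
    then have "ln (2 * \<xi>) > 0" "ln \<xi> < ln (2 * \<xi>)" by linarith+
    then show "0 < \<gamma>" "\<gamma> < 1" unfolding \<gamma>_def using l(2) by simp_all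
  qed
  have model: "sparse_model (D n) (d n) M (f n) (Q n) \<beta> L (\<sigma> n)" if n: "n \<ge> 1" for n
  proof -
    show ?thesis
    proof (intro sparse_model.intro regression_model.intro regression_model_axioms.intro sparse_model_axioms.intro)
      show "prob_space (D n)" by (rule prob[OF n])
      show "sets (D n) = sets (point_space {..<d n} \<Otimes>\<^sub>M borel)" by (rule sets_D[OF n])
      show "M > 0" by (rule M)
      show "AE z in D n. snd z \<in> {- M..M}" by (rule bounded[OF n])
      show "cond_mean_version (D n) fst (point_space {..<d n}) snd (f n)" by (rule regression[OF n])
      show "Q n \<subseteq> {..<d n}" using sparse[OF n] by (rule conjunct1)
    qed (fact uniform[OF n] indep[OF n] beta signs[OF n] monotone[OF n] lipschitz[OF n])+
  qed
  obtain c2 where c2: "c2 > 0" "eventually (\<lambda>n. norm (real (k n)) \<le> c2 * norm (real n powr \<gamma>)) sequentially"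
    using landau_o.bigE[OF bigthetaD1[OF leaf_size]] unfolding \<gamma>_def by metis
  obtain c1 where c1: "c1 > 0" "eventually (\<lambda>n. norm (real (k n)) \<ge> c1 * norm (real n powr \<gamma>)) sequentially"
    using landau_omega.bigE[OF bigthetaD2[OF leaf_size]] unfolding \<gamma>_def by metis
  have k_hi: "eventually (\<lambda>n. real (k n) \<le> c2 * real n powr \<gamma>) sequentially" using c2(2) by simp
  have k_lo: "eventually (\<lambda>n. c1 * real n powr \<gamma> \<le> real (k n)) sequentially" using c1(2) by simp
  have "filterlim (\<lambda>n::nat. c1 * real n powr \<gamma>) at_top sequentially" using \<gamma>(1) c1(1) by real_asymp
  then have k_top: "filterlim (\<lambda>n. real (k n)) at_top sequentially"
    by (rule filterlim_at_top_mono[OF _ k_lo])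
  obtain c where c: "c > 0" "eventually (\<lambda>n. ereal c < ereal (real (d n) / real n)) sequentially"
  proof -
    obtain c' where "0 < c'" "c' < liminf (\<lambda>n. ereal (real (d n) / real n))" using dense[OF dim] by blast
    then obtain c where "c > 0" "ereal c < liminf (\<lambda>n. ereal (real (d n) / real n))"
      by (cases c') auto
    then show ?thesis using that less_LiminfD by blast
  qed
  have d_top: "filterlim (\<lambda>n. real (d n)) at_top sequentially"
  proof (rule filterlim_at_top_mono)
    show "filterlim (\<lambda>n::nat. c * real n) at_top sequentially" using c(1) by real_asymp
    show "eventually (\<lambda>n. c * real n \<le> real (d n)) sequentially"
      using c(2) eventually_gt_at_top[of 0] by eventually_elim (simp add: pos_less_divide_eq)
  qed
  have lnd_top: "filterlim (\<lambda>n. ln (real (d n))) at_top sequentially"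
    by (rule filterlim_compose[OF ln_at_top d_top])
  have lnn_top: "filterlim (\<lambda>n::nat. ln (real n)) at_top sequentially" by real_asymp
  \<comment> \<open>The threshold of the check is a multiple of \<open>X\<close>. The factor \<open>1 / 6\<close> in \<open>\<delta>\<close> makes \<open>144 * (M * (9 * \<delta>))\<^sup>2\<close>
    equal to \<open>324 * M\<^sup>2 * X\<close>, while the threshold is \<open>324 * M\<^sup>2 * X / ln 2\<close>.\<close>
  define X where "X n = ln (real n) * ln (real (d n)) / real (k n)" for n
  define \<delta> where "\<delta> n = sqrt (X n) / 6" for n
  define \<epsilon> where "\<epsilon> n = real (k n) powr (- 1 / 4)" for n
  have ev_k: "eventually (\<lambda>n. k n \<ge> 1) sequentially"
    using filterlim_at_top[THEN iffD1, OF k_top, rule_format, of 1] by eventually_elim simp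
  have ev_d: "eventually (\<lambda>n. d n \<ge> 1 \<and> ln (real (d n)) \<ge> 288 * (2 * real (2 * (q + 1)) + 3)) sequentially"
    using filterlim_at_top[THEN iffD1, OF d_top, rule_format, of 1]
      filterlim_at_top[THEN iffD1, OF lnd_top, rule_format, of "288 * (2 * real (2 * (q + 1)) + 3)"]
    by eventually_elim simp
  have ev_n: "eventually (\<lambda>n. n \<ge> 2 \<and> ln (real n) \<ge> 288) sequentially"
    using eventually_ge_at_top[of 2]
      filterlim_at_top[THEN iffD1, OF lnn_top, rule_format, of 288]
    by eventually_elim simp
  have X_pos: "eventually (\<lambda>n. X n > 0) sequentially"
    using ev_k ev_d ev_n
  proof eventually_elim
    fix n assume "k n \<ge> 1" "d n \<ge> 1 \<and> ln (real (d n)) \<ge> 288 * (2 * real (2 * (q + 1)) + 3)"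
      "n \<ge> 2 \<and> ln (real n) \<ge> 288"
    moreover have "0 < 288 * (2 * real (2 * (q + 1)) + 3)" by simp
    ultimately have "real (k n) > 0" "ln (real (d n)) > 0" "ln (real n) > 0"
      by (simp, blast intro: less_le_trans, linarith)
    then show "X n > 0" by (simp add: X_def)
  qed
  have X_lim: "X \<longlonglongrightarrow> 0"
  proof (rule tendsto_sandwich[OF _ _ tendsto_const growth])
    show "eventually (\<lambda>n. 0 \<le> X n) sequentially" using X_pos by eventually_elim simp
    show "eventually (\<lambda>n. X n \<le> ln (real n) * max (ln (real (d n))) (ln (ln (real n))) / real (k n)) sequentially"
      using ev_n by eventually_elim (auto simp: X_def intro!: divide_right_mono mult_left_mono)
  qed
  have \<delta>_lim: "\<delta> \<longlonglongrightarrow> 0"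
    using tendsto_divide[OF tendsto_real_sqrt[OF X_lim] tendsto_const[of 6]] by (simp add: \<delta>_def[abs_def])
  have \<epsilon>_lim: "\<epsilon> \<longlonglongrightarrow> 0"
    unfolding \<epsilon>_def by (rule tendsto_neg_powr[OF _ k_top]) simp
  have ev_\<delta>: "eventually (\<lambda>n. \<delta> n < 1 / 90 \<and> \<delta> n < \<beta> / (432 * M)) sequentially"
    using order_tendstoD(2)[OF \<delta>_lim, of "1 / 90"] order_tendstoD(2)[OF \<delta>_lim, of "\<beta> / (432 * M)"] beta M
    by (auto intro: eventually_conj)
  have ev_X: "eventually (\<lambda>n. X n < \<beta>\<^sup>2 * ln 2 / (6 * 324 * M\<^sup>2)) sequentially"
    by (rule order_tendstoD(2)[OF X_lim]) (use beta M in simp)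
  have ev_\<epsilon>: "eventually (\<lambda>n. \<epsilon> n < 1 / 90) sequentially"
    by (rule order_tendstoD(2)[OF \<epsilon>_lim]) simp
  have "filterlim (\<lambda>x::real. x powr (3 / 4)) at_top at_top" by real_asymp
  from filterlim_compose[OF this k_top]
  have ev_\<epsilon>k: "eventually (\<lambda>n. 2 * (real q + 1) \<le> real (k n) powr (3 / 4)) sequentially"
    by (simp add: filterlim_at_top)
  have ev_ln: "eventually (\<lambda>n::nat. 144 * (c1 * real n powr \<gamma>) powr (- 1 / 4) * (ln (real n) / ln 2) \<le> 1) sequentially"
    using \<gamma>(1) c1(1) by real_asymp
  have ev_kn: "eventually (\<lambda>n::nat. c2 * real n powr \<gamma> \<le> real n) sequentially"
    using \<gamma> c2(1) by real_asymp
  have ev_tail: "eventually (\<lambda>n. real (n + 1) ^ (2 * q) * (4 * exp (- (sqrt c1 / 4 * real n powr (\<gamma> / 2)))) \<le> 1 / real n) sequentially"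
    using \<gamma> c1(1) by (intro eventually_poly_exp_le) auto
  define K where "K = 8 * M\<^sup>2 + 8 * M\<^sup>2 / c1 + 2 * L\<^sup>2 * real q * (\<xi> * c2 powr (log 2 \<xi>) * exp 1)"
  have "eventually (\<lambda>n. norm (excess_error M n (d n) (k n) (D n) (sel n) (f n)) \<le> K * norm (real n powr (- \<gamma>))) sequentially"
    using k_hi k_lo ev_k ev_d ev_n X_pos ev_\<delta> ev_X ev_\<epsilon> ev_\<epsilon>k ev_ln ev_kn ev_tail
  proof eventually_elim
    fix n
    assume khi: "real (k n) \<le> c2 * real n powr \<gamma>" and klo: "c1 * real n powr \<gamma> \<le> real (k n)"
      and k1: "k n \<ge> 1" and dn: "d n \<ge> 1 \<and> ln (real (d n)) \<ge> 288 * (2 * real (2 * (q + 1)) + 3)"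
      and nn: "n \<ge> 2 \<and> ln (real n) \<ge> 288" and Xp: "X n > 0"
      and \<delta>s: "\<delta> n < 1 / 90 \<and> \<delta> n < \<beta> / (432 * M)" and Xs: "X n < \<beta>\<^sup>2 * ln 2 / (6 * 324 * M\<^sup>2)"
      and \<epsilon>s: "\<epsilon> n < 1 / 90" and \<epsilon>k: "2 * (real q + 1) \<le> real (k n) powr (3 / 4)"
      and lns: "144 * (c1 * real n powr \<gamma>) powr (- 1 / 4) * (ln (real n) / ln 2) \<le> 1"
      and kn: "c2 * real n powr \<gamma> \<le> real n"
      and tail: "real (n + 1) ^ (2 * q) * (4 * exp (- (sqrt c1 / 4 * real n powr (\<gamma> / 2)))) \<le> 1 / real n"
    have n1: "n \<ge> 1" and n0: "real n > 0" and k0: "real (k n) > 0" using nn k1 by auto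
    have kle: "k n \<le> n" using khi kn by linarith
    interpret sparse_model "D n" "d n" M "f n" "Q n" \<beta> L "\<sigma> n" by (rule model[OF n1])
    define t where "t = nat \<lfloor>log 2 (real n / real (k n))\<rfloor>"
    define \<rho> where "\<rho> = 1 - (1 - ((1 + 54 * \<epsilon> n) / 2)\<^sup>2) / real q"
    have r0: "log 2 (real n / real (k n)) \<ge> 0" using kle k0 by (simp add: zero_le_log_cancel_iff)
    have t_le: "real t \<le> log 2 (real n / real (k n))" unfolding t_def using r0 by linarith
    have tk: "2 ^ t * k n \<le> n"
    proof -
      have "2 powr real t \<le> 2 powr log 2 (real n / real (k n))" using t_le by (intro powr_mono) auto
      then have "2 ^ t \<le> real n / real (k n)" using n0 k0 by (simp add: powr_realpow)
      then have "2 ^ t * real (k n) \<le> real n" using k0 by (simp add: pos_le_divide_eq)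
      then have "real (2 ^ t * k n) \<le> real n" by simp
      then show ?thesis by (simp only: of_nat_le_iff)
    qed
    have \<delta>0: "0 < \<delta> n" using Xp by (simp add: \<delta>_def)
    have \<delta>2: "(\<delta> n)\<^sup>2 = X n / 36" using Xp by (simp add: \<delta>_def power_divide)
    have \<delta>k: "(\<delta> n)\<^sup>2 * real (k n) / 4 = ln (real n) * ln (real (d n)) / 144"
      using k0 by (simp add: \<delta>2 X_def)
    have \<delta>k': "2 * (real q + 1) \<le> \<delta> n * real (k n)"
    proof -
      have "288 * (288 * (2 * real (2 * (q + 1)) + 3)) \<le> ln (real n) * ln (real (d n))"
        using nn dn by (intro mult_mono) auto
      moreover have "2 * (real q + 1) * 36 \<le> 288 * (288 * (2 * real (2 * (q + 1)) + 3))" using q0 by simp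
      ultimately have "2 * (real q + 1) * 36 \<le> ln (real n) * ln (real (d n))" by (rule order_trans[rotated])
      then have "2 * (real q + 1) \<le> ln (real n) * ln (real (d n)) / 36" by simp
      also have "\<dots> = (\<delta> n)\<^sup>2 * real (k n)" using \<delta>k by linarith
      also have "\<dots> \<le> \<delta> n * real (k n)"
        using \<delta>0 \<delta>s k0 by (intro mult_right_mono) (auto simp: power2_eq_square mult_left_le_one_le)
      finally show ?thesis .
    qed
    have \<epsilon>0: "0 < \<epsilon> n" using k0 by (simp add: \<epsilon>_def)
    have \<epsilon>1: "\<epsilon> n * real (k n) = real (k n) powr (3 / 4)"
      using k0 powr_add[of "real (k n)" "- 1 / 4" 1] by (simp add: \<epsilon>_def)
    have \<epsilon>2: "(\<epsilon> n)\<^sup>2 * real (k n) = sqrt (real (k n))"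
    proof -
      have "(\<epsilon> n)\<^sup>2 * real (k n) = \<epsilon> n * real (k n) powr (3 / 4)" by (simp add: power2_eq_square mult.assoc \<epsilon>1)
      also have "\<dots> = real (k n) powr (1 / 2)" unfolding \<epsilon>_def by (simp flip: powr_add)
      finally show ?thesis using k0 by (simp add: powr_half_sqrt)
    qed
    have thr: "split_threshold (1 / 2) M n (d n) (k n) = 324 * M\<^sup>2 * (X n / ln 2)"
    proof -
      have "ln (real n) * ln (real (d n)) / (real (k n) * ln (1 / (1 - 1 / 2))) = X n / ln 2"
        by (simp add: X_def)
      moreover have "X n / ln 2 \<ge> 0" using Xp by simp
      ultimately show ?thesis unfolding split_threshold_def by (simp add: power_mult_distrib)
    qed
    have thr1: "144 * (M * (9 * \<delta> n))\<^sup>2 < split_threshold (1 / 2) M n (d n) (k n)"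
    proof -
      have "X n < X n / ln 2" using Xp ln_2_less_1 by (simp add: pos_less_divide_eq)
      moreover have "144 * (M * (9 * \<delta> n))\<^sup>2 = 324 * M\<^sup>2 * X n" by (simp add: power_mult_distrib \<delta>2)
      moreover have "324 * M\<^sup>2 * X n < 324 * M\<^sup>2 * (X n / ln 2)"
        using calculation(1) M by (intro mult_strict_left_mono) auto
      ultimately show ?thesis unfolding thr by (simp only:)
    qed
    have thr2: "split_threshold (1 / 2) M n (d n) (k n) \<le> \<beta>\<^sup>2 / 6"
    proof -
      have "X n * (6 * 324 * M\<^sup>2) < \<beta>\<^sup>2 * ln 2" using Xs M by (simp add: pos_less_divide_eq)
      then show ?thesis unfolding thr by (simp add: field_simps)
    qed
    have small: "48 * M * (9 * \<delta> n) \<le> \<beta>" using \<delta>s M by (simp add: pos_less_divide_eq field_simps)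
    have cQ: "card (Q n) \<le> q" using sparse[OF n1] by simp
    note eb = excess_error_bound[OF k1 cQ q _ tk selection[OF n1] \<delta>0 _ \<delta>k' \<epsilon>0 _ _ thr1 thr2 small \<rho>_def]
    have E: "0 \<le> excess_error M n (d n) (k n) (D n) (sel n) (f n)"
      "excess_error M n (d n) (k n) (D n) (sel n) (f n) \<le>
        4 * M\<^sup>2 * (real (n + 1) ^ (2 * q) * (4 * exp (- ((\<epsilon> n)\<^sup>2 * real (k n) / 4))) +
        real (d n) * (real (n + 1) ^ (2 * (q + 1)) * (4 * exp (- ((\<delta> n)\<^sup>2 * real (k n) / 4))))) +
      8 * M\<^sup>2 / real (k n) + 2 * L\<^sup>2 * real q * \<rho> ^ t"
      using eb dn \<delta>s \<epsilon>s \<epsilon>k \<epsilon>1 by auto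
    let ?r = "real n powr (- \<gamma>)"
    have inv: "1 / real n \<le> ?r"
    proof -
      have "real n powr (- 1) \<le> ?r" using \<gamma> nn by (intro powr_mono) auto
      then show ?thesis using n0 by (simp add: powr_minus_divide)
    qed
    have p1: "real (n + 1) ^ (2 * q) * (4 * exp (- ((\<epsilon> n)\<^sup>2 * real (k n) / 4))) \<le> ?r"
    proof -
      have "sqrt c1 * real n powr (\<gamma> / 2) = sqrt (c1 * real n powr \<gamma>)"
        using c1(1) n0 by (simp add: real_sqrt_mult powr_half_sqrt[symmetric] powr_powr)
      also have "\<dots> \<le> sqrt (real (k n))" using klo by simp
      finally have "exp (- (sqrt (real (k n)) / 4)) \<le> exp (- (sqrt c1 / 4 * real n powr (\<gamma> / 2)))" by simp
      then have "real (n + 1) ^ (2 * q) * (4 * exp (- ((\<epsilon> n)\<^sup>2 * real (k n) / 4))) \<le>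
          real (n + 1) ^ (2 * q) * (4 * exp (- (sqrt c1 / 4 * real n powr (\<gamma> / 2))))"
        unfolding \<epsilon>2 by (intro mult_left_mono) auto
      then show ?thesis using tail inv by linarith
    qed
    have p2: "real (d n) * (real (n + 1) ^ (2 * (q + 1)) * (4 * exp (- ((\<delta> n)\<^sup>2 * real (k n) / 4)))) \<le> ?r"
      using dimension_times_tail_le[of n "d n" "2 * (q + 1)"] nn dn inv unfolding \<delta>k by linarith
    have p3: "8 * M\<^sup>2 / real (k n) \<le> 8 * M\<^sup>2 / c1 * ?r"
    proof -
      have "8 * M\<^sup>2 / real (k n) \<le> 8 * M\<^sup>2 / (c1 * real n powr \<gamma>)"
        using klo c1(1) n0 k0 by (intro divide_left_mono) auto
      also have "\<dots> = 8 * M\<^sup>2 / c1 * ?r" by (simp add: powr_minus_divide)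
      finally show ?thesis .
    qed
    have \<rho>0: "0 \<le> \<rho>"
    proof -
      have a: "((1 + 54 * \<epsilon> n) / 2)\<^sup>2 \<le> 1\<^sup>2" using \<epsilon>0 \<epsilon>s by (intro power_mono) auto
      have "(1 - ((1 + 54 * \<epsilon> n) / 2)\<^sup>2) / real q \<le> (1 - ((1 + 54 * \<epsilon> n) / 2)\<^sup>2) / 1"
        using q a by (intro divide_left_mono) auto
      also have "\<dots> \<le> 1" using zero_le_power2[of "(1 + 54 * \<epsilon> n) / 2"] by simp
      finally show ?thesis by (simp add: \<rho>_def)
    qed
    have p4: "\<rho> ^ t \<le> \<xi> * c2 powr (log 2 \<xi>) * exp 1 * ?r"
    proof -
      have "\<rho> ^ t \<le> (1 / \<xi> * exp (144 * \<epsilon> n)) ^ t"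
        using contraction_factor[OF q xi \<epsilon>0 _ \<rho>_def] \<epsilon>s \<rho>0 by (intro power_mono) auto
      also have "\<dots> = (1 / \<xi>) ^ t * exp (real t * (144 * \<epsilon> n))"
        by (simp only: power_mult_distrib exp_of_nat_mult)
      also have "\<dots> \<le> (\<xi> * c2 powr (log 2 \<xi>) * ?r) * exp 1"
      proof (rule mult_mono)
        show "(1 / \<xi>) ^ t \<le> \<xi> * c2 powr (log 2 \<xi>) * ?r"
          by (rule power_depth_bound[OF xi1 \<gamma>_def c2(1) n1 k1 kle khi t_def])
        have "real n / real (k n) \<le> real n" using k1 n0 by (simp add: pos_divide_le_eq)
        then have "log 2 (real n / real (k n)) \<le> log 2 (real n)"
          using n0 k0 by (subst log_le_cancel_iff) auto
        then have tl: "real t \<le> ln (real n) / ln 2" using t_le by (simp add: log_def)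
        have "\<epsilon> n \<le> (c1 * real n powr \<gamma>) powr (- 1 / 4)"
          unfolding \<epsilon>_def using klo c1(1) n0 by (intro powr_mono2') auto
        then have "real t * (144 * \<epsilon> n) \<le> ln (real n) / ln 2 * (144 * (c1 * real n powr \<gamma>) powr (- 1 / 4))"
          using tl \<epsilon>0 by (intro mult_mono) auto
        also have "\<dots> \<le> 1" using lns by (simp add: mult.commute)
        finally show "exp (real t * (144 * \<epsilon> n)) \<le> exp 1" by simp
      qed (use xi1 in auto)
      finally show ?thesis by (simp add: mult_ac)
    qed
    have "excess_error M n (d n) (k n) (D n) (sel n) (f n) \<le>
        4 * M\<^sup>2 * (?r + ?r) + 8 * M\<^sup>2 / c1 * ?r + 2 * L\<^sup>2 * real q * (\<xi> * c2 powr (log 2 \<xi>) * exp 1 * ?r)"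
    proof -
      have "4 * M\<^sup>2 * (real (n + 1) ^ (2 * q) * (4 * exp (- ((\<epsilon> n)\<^sup>2 * real (k n) / 4))) +
          real (d n) * (real (n + 1) ^ (2 * (q + 1)) * (4 * exp (- ((\<delta> n)\<^sup>2 * real (k n) / 4))))) \<le> 4 * M\<^sup>2 * (?r + ?r)"
        using p1 p2 by (intro mult_left_mono add_mono) auto
      moreover have "2 * L\<^sup>2 * real q * \<rho> ^ t \<le> 2 * L\<^sup>2 * real q * (\<xi> * c2 powr (log 2 \<xi>) * exp 1 * ?r)"
        using p4 by (intro mult_left_mono) auto
      ultimately show ?thesis using E(2) p3 by linarith
    qed
    also have "\<dots> = K * ?r" by (simp add: K_def algebra_simps)
    finally show "norm (excess_error M n (d n) (k n) (D n) (sel n) (f n)) \<le> K * norm ?r"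
      using E(1) by simp
  qed
  then show ?thesis unfolding \<gamma>_def[symmetric] by (rule bigoI)
qed

end
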